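(* Let $\Omega$ be a Polish space and let $(T(t))_{t\ge0}$ be a $\tau_{\mathrm{c}}$-bi-continuous semigroup on $\mathrm{C}_{\mathrm{b}}(\Omega)$. Then the semigroup $(T(t)^\circ)_{t\ge0}$ defined by $T(t)^\circ:=T(t)'|_{\mathrm{M}(\Omega)}$ is a $\tau^\circ$-bi-continuous semigroup on the space $\mathrm{M}(\Omega)$ of bounded Baire measures, where $\tau^\circ=\sigma(\mathrm{M}(\Omega),\mathrm{C}_{\mathrm{b}}(\Omega))$.
   Context: $\mathrm{C}_{\mathrm{b}}(\Omega)$ is the Banach space of bounded continuous functions $f:\Omega\to\mathbb{R}$ with the sup-norm. $\tau_{\mathrm{c}}$ is the compact-open topology on $\mathrm{C}_{\mathrm{b}}(\Omega)$, generated by the seminorms $p_K(f)=\sup_{x\in K}|f(x)|$, $K\subseteq\Omega$ compact. $\mathrm{M}(\Omega)$ is the Banach space of bounded (signed) Baire measures on $\Omega$ with the total variation norm, identified with a closed subspace of the norm dual $\mathrm{C}_{\mathrm{b}}(\Omega)'$ via $\mu\mapsto\big(f\mapsto\int_\Omega f\,d\mu\big)$; $\tau^\circ=\sigma(\mathrm{M}(\Omega),\mathrm{C}_{\mathrm{b}}(\Omega))$ is the weak topology on $\mathrm{M}(\Omega)$ induced by this duality. $T(t)'$ is the Banach space adjoint of $T(t)$ on $\mathrm{C}_{\mathrm{b}}(\Omega)'$; when $T(t)$ is $\tau_{\mathrm{c}}$-sequentially continuous on norm-bounded sets, $T(t)'$ leaves $\mathrm{M}(\Omega)$ invariant. Let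 $X$ be a Banach space with an additional locally convex topology $\tau$ such that: (i) $\tau$ is Hausdorff and coarser than the norm topology; (ii) $(X,\tau)$ is sequentially complete on $\tau$-closed, norm-bounded sets; (iii) $\|x\|=\sup\{|\varphi(x)|:\varphi\in(X,\tau)',\|\varphi\|\le1\}$ for all $x\in X$. A (one-parameter) semigroup $(T(t))_{t\ge0}$ of bounded linear operators on $X$ ($T(0)=I$, $T(t+s)=T(t)T(s)$) is $\tau$-bi-continuous if: (a) for every $x\in X$ the orbit $t\mapsto T(t)x$ is $\tau$-continuous on $[0,\infty)$; (b) $t\mapsto T(t)$ is norm-bounded on $[0,1]$ (hence exponentially bounded); (c) for every norm-bounded sequence $(x_n)$ with $x_n\to0$ in $\tau$, $T(t)x_n\to0$ in $\tau$ uniformly for $t$ in compact subintervals of $[0,\infty)$. This is applied to $(\mathrm{C}_{\mathrm{b}}(\Omega),\tau_{\mathrm{c}})$ and to $(\mathrm{M}(\Omega),\tau^\circ)$, both of which satisfy (i)--(iii) for Polish $\Omega$. *)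

theory Defs
  imports "HOL-Analysis.Analysis"
begin

instance bcontfun :: (metric_space, banach) banach ..

section \<open>Bi-continuous semigroups\<close>

definition locally_convex_topology :: "'x::real_vector topology \<Rightarrow> bool" where
  "locally_convex_topology \<tau> \<longleftrightarrow>
     topspace \<tau> = UNIV \<and>
     continuous_map (prod_topology \<tau> \<tau>) \<tau> (\<lambda>(x, y). x + y) \<and>
     continuous_map (prod_topology euclideanreal \<tau>) \<tau> (\<lambda>(c, x). c *\<^sub>R x) \<and>
     (\<forall>U. openin \<tau> U \<and> 0 \<in> U \<longrightarrow> (\<exists>V. openin \<tau> V \<and> 0 \<in> V \<and> convex V \<and> V \<subseteq> U))"

definition Cauchy_wrt :: "'x::real_vector topology \<Rightarrow> (nat \<Rightarrow> 'x) \<Rightarrow> bool" where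
  "Cauchy_wrt \<tau> x \<longleftrightarrow>
     (\<forall>U. openin \<tau> U \<and> 0 \<in> U \<longrightarrow> (\<exists>N. \<forall>m\<ge>N. \<forall>n\<ge>N. x m - x n \<in> U))"

text \<open>
  In \<open>norming\<close> the dual of \<open>(X, \<tau>)\<close> consists of bounded functionals, since \<open>\<tau>\<close> is coarser than
  the norm topology; hence its elements can be taken from the norm dual \<open>'x \<Rightarrow>\<^sub>L real\<close>.
\<close>

locale bicontinuous_space =
  fixes \<tau> :: "'x::banach topology"
  assumes locally_convex: "locally_convex_topology \<tau>"
    and Hausdorff: "Hausdorff_space \<tau>"
    and coarser: "\<And>U. openin \<tau> U \<Longrightarrow> open U"
    and sequentially_complete:
      "\<And>S x. closedin \<tau> S \<Longrightarrow> bounded S \<Longrightarrow> range x \<subseteq> S \<Longrightarrow> Cauchy_wrt \<tau> x \<Longrightarrow>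
         \<exists>l\<in>S. limitin \<tau> x l sequentially"
    and norming:
      "\<And>x. norm x =
         (SUP \<phi>\<in>{\<phi> :: 'x \<Rightarrow>\<^sub>L real. continuous_map \<tau> euclideanreal (blinfun_apply \<phi>) \<and> norm \<phi> \<le> 1}.
            \<bar>blinfun_apply \<phi> x\<bar>)"

text \<open>Only the values \<open>T t\<close> with \<open>t \<ge> 0\<close> are constrained.\<close>

locale bicontinuous_semigroup = bicontinuous_space \<tau>
  for \<tau> :: "'x::banach topology" +
  fixes T :: "real \<Rightarrow> 'x \<Rightarrow> 'x"
  assumes bounded_linear: "\<And>t. t \<ge> 0 \<Longrightarrow> bounded_linear (T t)"
    and semigroup_zero: "T 0 = id"
    and semigroup_add: "\<And>s t. s \<ge> 0 \<Longrightarrow> t \<ge> 0 \<Longrightarrow> T (t + s) = T t \<circ> T s"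
    and orbit_continuous: "\<And>x. continuous_map (top_of_set {0..}) \<tau> (\<lambda>t. T t x)"
    and locally_bounded: "\<exists>C. \<forall>t\<in>{0..1}. onorm (T t) \<le> C"
    and locally_bi_equicontinuous:
      "\<And>x a b U. bounded (range x) \<Longrightarrow> limitin \<tau> x 0 sequentially \<Longrightarrow> 0 \<le> a \<Longrightarrow> a \<le> b \<Longrightarrow>
         openin \<tau> U \<Longrightarrow> 0 \<in> U \<Longrightarrow> \<forall>\<^sub>F n in sequentially. \<forall>t\<in>{a..b}. T t (x n) \<in> U"


section \<open>The compact-open topology\<close>

definition seminorm_topology :: "('x::real_vector \<Rightarrow> real) set \<Rightarrow> 'x topology" where
  "seminorm_topology P = topology_generated_by {{x. p (x - a) < r} | p a r. p \<in> P \<and> r > 0}"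

text \<open>The empty compact set, whose seminorm is zero, is left out because \<open>Sup {}\<close> is unspecified.\<close>

definition compact_open_topology :: "('a::topological_space \<Rightarrow>\<^sub>C real) topology" where
  "compact_open_topology =
     seminorm_topology {\<lambda>f. SUP x\<in>K. \<bar>apply_bcontfun f x\<bar> | K. compact K \<and> K \<noteq> {}}"


section \<open>Bounded signed Baire measures\<close>

definition baire_algebra :: "'a::topological_space measure" where
  "baire_algebra = sigma UNIV {f -` U | (f :: 'a \<Rightarrow> real) U. continuous_on UNIV f \<and> open U}"

lemma space_baire [simp]: "space baire_algebra = UNIV"
  by (simp add: baire_algebra_def)

definition variation_sums :: "('a::topological_space set \<Rightarrow> real) \<Rightarrow> real set" where
  "variation_sums m =
     {(\<Sum>A\<in>P. \<bar>m A\<bar>) | P. finite P \<and> P \<subseteq> sets baire_algebra \<and> disjoint P}"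

text \<open>
  A signed measure is a set function, made zero outside the Baire sets so that it is determined by
  its values on them. Countable additivity gives \<open>m {} = 0\<close> (take all sets empty).
\<close>

definition bounded_baire_measures :: "('a::topological_space set \<Rightarrow> real) set" where
  "bounded_baire_measures = {m.
     (\<forall>A. A \<notin> sets baire_algebra \<longrightarrow> m A = 0) \<and>
     (\<forall>A :: nat \<Rightarrow> 'a set. range A \<subseteq> sets baire_algebra \<and> disjoint_family A \<longrightarrow>
        (\<lambda>n. m (A n)) sums m (\<Union>n. A n)) \<and>
     bdd_above (variation_sums m)}"

lemma variation_sums_zero: "variation_sums (\<lambda>_. 0) = {0}"
  by (auto simp: variation_sums_def intro: exI[of _ "{}"])

typedef (overloaded) 'a baire_measure = "bounded_baire_measures :: ('a::topological_space set \<Rightarrow> real) set"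
  morphisms bm_value Abs_baire_measure
  by (rule exI[of _ "\<lambda>_. 0"]) (simp add: bounded_baire_measures_def variation_sums_zero)

lemma bm_outside: "A \<notin> sets baire_algebra \<Longrightarrow> bm_value \<mu> A = 0"
  using bm_value[of \<mu>] by (simp add: bounded_baire_measures_def)

lemma bm_sums:
  "range A \<subseteq> sets baire_algebra \<Longrightarrow> disjoint_family A \<Longrightarrow>
    (\<lambda>n::nat. bm_value \<mu> (A n)) sums bm_value \<mu> (\<Union>n. A n)"
  using bm_value[of \<mu>] by (simp add: bounded_baire_measures_def)

lemma bm_bdd: "bdd_above (variation_sums (bm_value \<mu>))"
  using bm_value[of \<mu>] by (simp add: bounded_baire_measures_def)

lemma bm_eqI: "(\<And>A. A \<in> sets baire_algebra \<Longrightarrow> bm_value \<mu> A = bm_value \<nu> A) \<Longrightarrow> \<mu> = \<nu>"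
  by (metis bm_outside bm_value_inject ext)

lemma variation_sumsI:
  "finite P \<Longrightarrow> P \<subseteq> sets baire_algebra \<Longrightarrow> disjoint P \<Longrightarrow> (\<Sum>A\<in>P. \<bar>m A\<bar>) \<in> variation_sums m"
  by (auto simp: variation_sums_def)

lemma variation_sums_nonempty: "variation_sums m \<noteq> {}"
  using variation_sumsI[of "{}" m] by (auto simp: disjoint_def)

lemma Abs_bm_value: "m \<in> bounded_baire_measures \<Longrightarrow> bm_value (Abs_baire_measure m) = m"
  by (rule Abs_baire_measure_inverse)

lemma bdd_variationI:
  assumes "\<And>P. finite P \<Longrightarrow> P \<subseteq> sets baire_algebra \<Longrightarrow> disjoint P \<Longrightarrow> (\<Sum>A\<in>P. \<bar>m A\<bar>) \<le> C"
  shows "bdd_above (variation_sums m)"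
  by (rule bdd_aboveI[of _ C]) (use assms in \<open>auto simp: variation_sums_def\<close>)

lemma bm_variation_le:
  "finite P \<Longrightarrow> P \<subseteq> sets baire_algebra \<Longrightarrow> disjoint P \<Longrightarrow>
    (\<Sum>A\<in>P. \<bar>bm_value \<mu> A\<bar>) \<le> Sup (variation_sums (bm_value \<mu>))"
  by (intro cSup_upper variation_sumsI bm_bdd)

lemma bm_plus_in: "(\<lambda>A. bm_value \<mu> A + bm_value \<nu> A) \<in> bounded_baire_measures"
proof -
  have "bdd_above (variation_sums (\<lambda>A. bm_value \<mu> A + bm_value \<nu> A))"
  proof (rule bdd_variationI)
    fix P :: "'a set set" assume P: "finite P" "P \<subseteq> sets baire_algebra" "disjoint P"
    have "(\<Sum>A\<in>P. \<bar>bm_value \<mu> A + bm_value \<nu> A\<bar>) \<le> (\<Sum>A\<in>P. \<bar>bm_value \<mu> A\<bar>) + (\<Sum>A\<in>P. \<bar>bm_value \<nu> A\<bar>)"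
      by (simp flip: sum.distrib) (intro sum_mono, simp)
    then show "(\<Sum>A\<in>P. \<bar>bm_value \<mu> A + bm_value \<nu> A\<bar>) \<le>
        Sup (variation_sums (bm_value \<mu>)) + Sup (variation_sums (bm_value \<nu>))"
      using bm_variation_le[OF P, of \<mu>] bm_variation_le[OF P, of \<nu>] by simp
  qed
  then show ?thesis
    by (auto simp: bounded_baire_measures_def bm_outside intro!: sums_add bm_sums)
qed

lemma bm_scale_in: "(\<lambda>A. c * bm_value \<mu> A) \<in> bounded_baire_measures"
proof -
  have "bdd_above (variation_sums (\<lambda>A. c * bm_value \<mu> A))"
  proof (rule bdd_variationI)
    fix P :: "'a set set" assume P: "finite P" "P \<subseteq> sets baire_algebra" "disjoint P"
    show "(\<Sum>A\<in>P. \<bar>c * bm_value \<mu> A\<bar>) \<le> \<bar>c\<bar> * Sup (variation_sums (bm_value \<mu>))"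
      using bm_variation_le[OF P, of \<mu>]
      by (simp add: abs_mult mult_left_mono flip: sum_distrib_left)
  qed
  then show ?thesis
    by (auto simp: bounded_baire_measures_def bm_outside intro!: sums_mult bm_sums)
qed

instantiation baire_measure :: (topological_space) real_vector
begin

definition "0 = Abs_baire_measure (\<lambda>_. 0)"
definition "\<mu> + \<nu> = Abs_baire_measure (\<lambda>A. bm_value \<mu> A + bm_value \<nu> A)"
definition "c *\<^sub>R \<mu> = Abs_baire_measure (\<lambda>A. c * bm_value \<mu> A)"
definition "- \<mu> = Abs_baire_measure (\<lambda>A. - bm_value \<mu> A)"
definition "\<mu> - \<nu> = Abs_baire_measure (\<lambda>A. bm_value \<mu> A - bm_value \<nu> A)"

lemma bm_value_zero [simp]: "bm_value 0 A = 0"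
  unfolding zero_baire_measure_def
  by (subst Abs_bm_value) (simp_all add: bounded_baire_measures_def variation_sums_zero)

lemma bm_value_plus [simp]: "bm_value (\<mu> + \<nu>) A = bm_value \<mu> A + bm_value \<nu> A"
  unfolding plus_baire_measure_def by (simp add: Abs_bm_value[OF bm_plus_in])

lemma bm_value_scaleR [simp]: "bm_value (c *\<^sub>R \<mu>) A = c * bm_value \<mu> A"
  unfolding scaleR_baire_measure_def by (simp add: Abs_bm_value[OF bm_scale_in])

lemma bm_value_uminus [simp]: "bm_value (- \<mu>) A = - bm_value \<mu> A"
  unfolding uminus_baire_measure_def using bm_scale_in[of "-1" \<mu>] by (simp add: Abs_bm_value)

lemma bm_value_minus [simp]: "bm_value (\<mu> - \<nu>) A = bm_value \<mu> A - bm_value \<nu> A"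
  unfolding minus_baire_measure_def using bm_plus_in[of \<mu> "- \<nu>"] by (simp add: Abs_bm_value)

instance
  by standard (auto intro!: bm_eqI simp: algebra_simps)

end

instantiation baire_measure :: (topological_space) real_normed_vector
begin

text \<open>The total variation norm.\<close>

definition norm_baire_measure :: "'a baire_measure \<Rightarrow> real" where
  "norm_baire_measure \<mu> = Sup (variation_sums (bm_value \<mu>))"

definition dist_baire_measure :: "'a baire_measure \<Rightarrow> 'a baire_measure \<Rightarrow> real" where
  "dist_baire_measure \<mu> \<nu> = norm (\<mu> - \<nu>)"

definition sgn_baire_measure :: "'a baire_measure \<Rightarrow> 'a baire_measure" where
  "sgn_baire_measure \<mu> = \<mu> /\<^sub>R norm \<mu>"

definition uniformity_baire_measure :: "('a baire_measure \<times> 'a baire_measure) filter" where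
  "uniformity_baire_measure = (INF e\<in>{0 <..}. principal {(x, y). dist x y < e})"

definition open_baire_measure :: "'a baire_measure set \<Rightarrow> bool" where
  "open_baire_measure S = (\<forall>x\<in>S. \<forall>\<^sub>F (x', y) in uniformity. x' = x \<longrightarrow> y \<in> S)"

lemma bm_sum_le_norm:
  "finite P \<Longrightarrow> P \<subseteq> sets baire_algebra \<Longrightarrow> disjoint P \<Longrightarrow> (\<Sum>A\<in>P. \<bar>bm_value \<mu> A\<bar>) \<le> norm \<mu>"
  unfolding norm_baire_measure_def by (rule bm_variation_le)

lemma bm_norm_le:
  assumes "\<And>P. finite P \<Longrightarrow> P \<subseteq> sets baire_algebra \<Longrightarrow> disjoint P \<Longrightarrow> (\<Sum>A\<in>P. \<bar>bm_value \<mu> A\<bar>) \<le> C"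
  shows "norm \<mu> \<le> C"
  unfolding norm_baire_measure_def
  by (rule cSup_least[OF variation_sums_nonempty]) (use assms in \<open>auto simp: variation_sums_def\<close>)

lemma bm_value_le_norm: "\<bar>bm_value \<mu> A\<bar> \<le> norm \<mu>"
proof (cases "A \<in> sets baire_algebra")
  case True
  then show ?thesis using bm_sum_le_norm[of "{A}" \<mu>] by (simp add: disjoint_def)
next
  case False
  then show ?thesis using bm_sum_le_norm[of "{}" \<mu>] by (simp add: disjoint_def bm_outside)
qed

instance
proof
  fix \<mu> \<nu> :: "'a baire_measure" and c :: real
  show "norm \<mu> = 0 \<longleftrightarrow> \<mu> = 0"
  proof
    assume "norm \<mu> = 0"
    then show "\<mu> = 0" using bm_value_le_norm[of \<mu>] by (intro bm_eqI) simp
  next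
    assume "\<mu> = 0"
    moreover have "norm (0::'a baire_measure) \<le> 0" by (rule bm_norm_le) simp
    moreover have "0 \<le> norm (0::'a baire_measure)" using bm_value_le_norm[of 0 "{}"] by simp
    ultimately show "norm \<mu> = 0" by simp
  qed
  show "norm (\<mu> + \<nu>) \<le> norm \<mu> + norm \<nu>"
  proof (rule bm_norm_le)
    fix P :: "'a set set" assume P: "finite P" "P \<subseteq> sets baire_algebra" "disjoint P"
    have "(\<Sum>A\<in>P. \<bar>bm_value (\<mu> + \<nu>) A\<bar>) \<le> (\<Sum>A\<in>P. \<bar>bm_value \<mu> A\<bar>) + (\<Sum>A\<in>P. \<bar>bm_value \<nu> A\<bar>)"
      by (simp flip: sum.distrib) (intro sum_mono, simp)
    then show "(\<Sum>A\<in>P. \<bar>bm_value (\<mu> + \<nu>) A\<bar>) \<le> norm \<mu> + norm \<nu>"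
      using bm_sum_le_norm[OF P, of \<mu>] bm_sum_le_norm[OF P, of \<nu>] by simp
  qed
  have scale: "norm (d *\<^sub>R \<kappa>) \<le> \<bar>d\<bar> * norm \<kappa>" for d and \<kappa> :: "'a baire_measure"
  proof (rule bm_norm_le)
    fix P :: "'a set set" assume P: "finite P" "P \<subseteq> sets baire_algebra" "disjoint P"
    show "(\<Sum>A\<in>P. \<bar>bm_value (d *\<^sub>R \<kappa>) A\<bar>) \<le> \<bar>d\<bar> * norm \<kappa>"
      using bm_sum_le_norm[OF P, of \<kappa>]
      by (simp add: abs_mult mult_left_mono flip: sum_distrib_left)
  qed
  show "norm (c *\<^sub>R \<mu>) = \<bar>c\<bar> * norm \<mu>"
  proof (cases "c = 0")
    case True
    have "0 \<le> norm (0::'a baire_measure)" using bm_value_le_norm[of 0 "{}"] by simp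
    with True show ?thesis using scale[of 0 \<mu>] by simp
  next
    case False
    have "norm \<mu> \<le> \<bar>inverse c\<bar> * norm (c *\<^sub>R \<mu>)"
      using scale[of "inverse c" "c *\<^sub>R \<mu>"] False by simp
    with False have "\<bar>c\<bar> * norm \<mu> \<le> norm (c *\<^sub>R \<mu>)" by (simp add: field_simps)
    with scale[of c \<mu>] show ?thesis by simp
  qed
qed (rule dist_baire_measure_def sgn_baire_measure_def open_baire_measure_def
      uniformity_baire_measure_def)+

end

lemma bm_empty [simp]: "bm_value \<mu> {} = 0"
proof -
  have "(\<lambda>n::nat. bm_value \<mu> {}) sums bm_value \<mu> (\<Union>n::nat. {})"
    by (rule bm_sums) (auto simp: disjoint_family_on_def)
  then have "(\<lambda>n::nat. bm_value \<mu> {}) \<longlonglongrightarrow> 0"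
    using sums_summable summable_LIMSEQ_zero by blast
  then show ?thesis by (simp add: LIMSEQ_const_iff)
qed

lemma bm_finite_additive:
  assumes "range A \<subseteq> sets baire_algebra" "disjoint_family A"
  shows "(\<Sum>i<k. bm_value \<mu> (A i)) = bm_value \<mu> (\<Union>i<k::nat. A i)"
proof -
  let ?B = "\<lambda>i. if i < k then A i else {}"
  have "(\<lambda>i. bm_value \<mu> (?B i)) sums bm_value \<mu> (\<Union>i. ?B i)"
    using assms by (intro bm_sums) (auto simp: disjoint_family_on_def)
  moreover have "(\<lambda>i. bm_value \<mu> (?B i)) sums (\<Sum>i<k. bm_value \<mu> (?B i))"
    by (rule sums_finite) auto
  moreover have "(\<Union>i. ?B i) = (\<Union>i<k. A i)" by (auto split: if_splits)
  ultimately show ?thesis using sums_unique2 by fastforce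
qed

instance baire_measure :: (topological_space) banach
proof
  fix X :: "nat \<Rightarrow> 'a baire_measure"
  assume X: "Cauchy X"
  define l where "l A = lim (\<lambda>n. bm_value (X n) A)" for A
  have C: "\<exists>N. \<forall>m\<ge>N. \<forall>n\<ge>N. norm (X m - X n) < e" if "e > 0" for e
    using X that by (simp add: Cauchy_iff)
  have lim: "(\<lambda>n. bm_value (X n) A) \<longlonglongrightarrow> l A" for A
  proof -
    have "Cauchy (\<lambda>n. bm_value (X n) A)"
      unfolding Cauchy_iff
    proof (intro allI impI)
      fix e :: real assume "e > 0"
      then obtain N where N: "\<And>m n. m \<ge> N \<Longrightarrow> n \<ge> N \<Longrightarrow> norm (X m - X n) < e" using C by blast
      have "norm (bm_value (X m) A - bm_value (X n) A) < e" if "m \<ge> N" "n \<ge> N" for m n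
        using bm_value_le_norm[of "X m - X n" A] N[OF that] by simp
      then show "\<exists>M. \<forall>m\<ge>M. \<forall>n\<ge>M. norm (bm_value (X m) A - bm_value (X n) A) < e" by blast
    qed
    then show ?thesis unfolding l_def using Cauchy_convergent convergent_LIMSEQ_iff by blast
  qed
  have unif: "\<exists>N. \<forall>n\<ge>N. \<forall>P. finite P \<and> P \<subseteq> sets baire_algebra \<and> disjoint P \<longrightarrow>
      (\<Sum>A\<in>P. \<bar>bm_value (X n) A - l A\<bar>) \<le> e" if e: "e > 0" for e
  proof -
    obtain N where N: "\<And>m n. m \<ge> N \<Longrightarrow> n \<ge> N \<Longrightarrow> norm (X m - X n) < e" using C e by blast
    have "(\<Sum>A\<in>P. \<bar>bm_value (X n) A - l A\<bar>) \<le> e"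
      if n: "n \<ge> N" and P: "finite P" "P \<subseteq> sets baire_algebra" "disjoint P" for n and P :: "'a set set"
    proof (rule tendsto_upperbound)
      show "(\<lambda>m. \<Sum>A\<in>P. \<bar>bm_value (X n) A - bm_value (X m) A\<bar>) \<longlonglongrightarrow> (\<Sum>A\<in>P. \<bar>bm_value (X n) A - l A\<bar>)"
        by (intro tendsto_intros lim)
      show "\<forall>\<^sub>F m in sequentially. (\<Sum>A\<in>P. \<bar>bm_value (X n) A - bm_value (X m) A\<bar>) \<le> e"
        using eventually_ge_at_top[of N]
      proof eventually_elim
        case (elim m)
        then show ?case using bm_sum_le_norm[OF P, of "X n - X m"] N[OF n elim] by simp
      qed
    qed simp
    then show ?thesis by blast
  qed
  have unif1: "\<exists>N. \<forall>A. \<bar>bm_value (X N) A - l A\<bar> \<le> e" if e: "e > 0" for e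
  proof -
    obtain N where N: "\<And>P. finite P \<and> P \<subseteq> sets baire_algebra \<and> disjoint P \<Longrightarrow>
      (\<Sum>A\<in>P. \<bar>bm_value (X N) A - l A\<bar>) \<le> e" using unif[OF e] by blast
    have "\<bar>bm_value (X N) A - l A\<bar> \<le> e" for A
    proof (cases "A \<in> sets baire_algebra")
      case True
      then show ?thesis using N[of "{A}"] by (simp add: disjoint_def)
    next
      case False
      then have "l A = 0" by (simp add: l_def bm_outside)
      with False e show ?thesis by (simp add: bm_outside)
    qed
    then show ?thesis by blast
  qed
  have add: "(\<lambda>n. l (A n)) sums l (\<Union>n. A n)"
    if A: "range A \<subseteq> sets baire_algebra" "disjoint_family A" for A :: "nat \<Rightarrow> 'a set"
  proof -
    have fin: "(\<Sum>i<k. l (A i)) = l (\<Union>i<k. A i)" for k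
    proof (rule LIMSEQ_unique)
      show "(\<lambda>n. bm_value (X n) (\<Union>i<k. A i)) \<longlonglongrightarrow> l (\<Union>i<k. A i)" by (rule lim)
      show "(\<lambda>n. bm_value (X n) (\<Union>i<k. A i)) \<longlonglongrightarrow> (\<Sum>i<k. l (A i))"
        by (simp flip: bm_finite_additive[OF A]) (intro tendsto_intros lim)
    qed
    show ?thesis
      unfolding sums_def
    proof (rule LIMSEQ_I)
      fix r :: real assume "r > 0"
      then obtain N where N: "\<And>A. \<bar>bm_value (X N) A - l A\<bar> \<le> r / 4"
        using unif1[of "r / 4"] by auto
      have "(\<lambda>k. \<Sum>i<k. bm_value (X N) (A i)) \<longlonglongrightarrow> bm_value (X N) (\<Union>n. A n)"
        using bm_sums[OF A] by (simp add: sums_def)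
      from LIMSEQ_D[OF this, of "r / 4"] \<open>r > 0\<close> obtain k0 where
        k0: "\<And>k. k \<ge> k0 \<Longrightarrow> norm ((\<Sum>i<k. bm_value (X N) (A i)) - bm_value (X N) (\<Union>n. A n)) < r / 4"
        by auto
      have "norm ((\<Sum>i<k. l (A i)) - l (\<Union>n. A n)) < r" if "k \<ge> k0" for k
        using k0[OF that] N[of "\<Union>i<k. A i"] N[of "\<Union>n. A n"] \<open>r > 0\<close>
        unfolding fin bm_finite_additive[OF A] real_norm_def by linarith
      then show "\<exists>k0. \<forall>k\<ge>k0. norm ((\<Sum>i<k. l (A i)) - l (\<Union>n. A n)) < r" by blast
    qed
  qed
  obtain N where N: "\<And>P. finite P \<and> P \<subseteq> sets baire_algebra \<and> disjoint P \<Longrightarrow>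
      (\<Sum>A\<in>P. \<bar>bm_value (X N) A - l A\<bar>) \<le> 1" using unif[of 1] by auto
  have "bdd_above (variation_sums l)"
  proof (rule bdd_variationI)
    fix P :: "'a set set" assume P: "finite P" "P \<subseteq> sets baire_algebra" "disjoint P"
    have "(\<Sum>A\<in>P. \<bar>l A\<bar>) \<le> (\<Sum>A\<in>P. \<bar>bm_value (X N) A - l A\<bar>) + (\<Sum>A\<in>P. \<bar>bm_value (X N) A\<bar>)"
      by (simp flip: sum.distrib) (intro sum_mono, simp)
    then show "(\<Sum>A\<in>P. \<bar>l A\<bar>) \<le> 1 + norm (X N)"
      using N[of P] P bm_sum_le_norm[OF P, of "X N"] by simp
  qed
  moreover have "l A = 0" if "A \<notin> sets baire_algebra" for A
    using that by (simp add: l_def bm_outside)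
  ultimately have l: "l \<in> bounded_baire_measures"
    using add by (simp add: bounded_baire_measures_def)
  have "X \<longlonglongrightarrow> Abs_baire_measure l"
  proof (rule LIMSEQ_I)
    fix r :: real assume "r > 0"
    then obtain N where N: "\<And>n P. n \<ge> N \<Longrightarrow> finite P \<and> P \<subseteq> sets baire_algebra \<and> disjoint P \<Longrightarrow>
      (\<Sum>A\<in>P. \<bar>bm_value (X n) A - l A\<bar>) \<le> r / 2" using unif[of "r / 2"] by (meson half_gt_zero)
    have "norm (X n - Abs_baire_measure l) \<le> r / 2" if "n \<ge> N" for n
      using N[OF that] by (intro bm_norm_le) (simp add: Abs_bm_value[OF l])
    then show "\<exists>N. \<forall>n\<ge>N. norm (X n - Abs_baire_measure l) < r"
      using \<open>r > 0\<close> by (intro exI[of _ N]) fastforce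
  qed
  then show "convergent X" by (rule convergentI)
qed


section \<open>Integration and the embedding into the dual\<close>

text \<open>The positive part of the Jordan decomposition; the negative part is \<open>bm_pos (- \<mu>)\<close>.\<close>

definition bm_pos :: "'a::topological_space baire_measure \<Rightarrow> 'a measure" where
  "bm_pos \<mu> = measure_of UNIV (sets baire_algebra)
     (\<lambda>A. SUP B\<in>{B \<in> sets baire_algebra. B \<subseteq> A}. ennreal (bm_value \<mu> B))"

definition bm_integral :: "'a::topological_space baire_measure \<Rightarrow> ('a \<Rightarrow> real) \<Rightarrow> real" where
  "bm_integral \<mu> f = (LINT x|bm_pos \<mu>. f x) - (LINT x|bm_pos (- \<mu>). f x)"

lemma sets_bm_pos [simp]: "sets (bm_pos \<mu>) = sets baire_algebra"
  unfolding bm_pos_def using sets.sets_measure_of_eq[of baire_algebra] by simp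

lemma space_bm_pos [simp]: "space (bm_pos \<mu>) = UNIV"
  unfolding bm_pos_def using sets.space_measure_of_eq[of baire_algebra] by simp

lemma bm_union2:
  assumes "A \<in> sets baire_algebra" "B \<in> sets baire_algebra" "A \<inter> B = {}"
  shows "bm_value \<mu> (A \<union> B) = bm_value \<mu> A + bm_value \<mu> B"
proof -
  let ?F = "\<lambda>i::nat. if i = 0 then A else if i = 1 then B else {}"
  have "(\<Sum>i<2. bm_value \<mu> (?F i)) = bm_value \<mu> (\<Union>i<2. ?F i)"
    using assms by (intro bm_finite_additive) (auto simp: disjoint_family_on_def)
  moreover have "(\<Union>i<2. ?F i) = A \<union> B" by (force simp: numeral_2_eq_2 less_Suc_eq split: if_splits)
  ultimately show ?thesis by (simp add: numeral_2_eq_2)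
qed

lemma emeasure_bm_pos:
  assumes "A \<in> sets baire_algebra"
  shows "emeasure (bm_pos \<mu>) A = (SUP B\<in>{B \<in> sets baire_algebra. B \<subseteq> A}. ennreal (bm_value \<mu> B))"
    (is "_ = ?V A")
  unfolding bm_pos_def
proof (rule emeasure_measure_of_sigma)
  have 1: "sigma_algebra (space baire_algebra) (sets baire_algebra)" by (rule sets.sigma_algebra_axioms)
  then show "sigma_algebra UNIV (sets (baire_algebra :: 'a measure))" by simp
  have "?V {} = (SUP B\<in>{{}}. ennreal (bm_value \<mu> B))" by (rule SUP_cong) auto
  then show "positive (sets baire_algebra) ?V" by (simp add: positive_def)
  show "countably_additive (sets baire_algebra) ?V"
  proof (rule countably_additiveI)
    fix A :: "nat \<Rightarrow> 'a set"
    assume A: "range A \<subseteq> sets baire_algebra" "disjoint_family A" and UA: "(\<Union>i. A i) \<in> sets baire_algebra"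
    show "(\<Sum>i. ?V (A i)) = ?V (\<Union>i. A i)"
    proof (rule antisym)
      have add2: "?V C + ?V D \<le> ?V (C \<union> D)"
        if "C \<in> sets baire_algebra" "D \<in> sets baire_algebra" "C \<inter> D = {}" for C D
      proof -
        have "?V C + ?V D = (SUP B\<in>{B \<in> sets baire_algebra. B \<subseteq> C}. ennreal (bm_value \<mu> B) + ?V D)"
          by (rule ennreal_SUP_add_left[symmetric]) auto
        also have "\<dots> \<le> ?V (C \<union> D)"
        proof (rule SUP_least)
          fix B assume B: "B \<in> {B \<in> sets baire_algebra. B \<subseteq> C}"
          have "ennreal (bm_value \<mu> B) + ?V D =
              (SUP E\<in>{B \<in> sets baire_algebra. B \<subseteq> D}. ennreal (bm_value \<mu> B) + ennreal (bm_value \<mu> E))"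
            by (rule ennreal_SUP_add_right) auto
          also have "\<dots> \<le> ?V (C \<union> D)"
          proof (rule SUP_least)
            fix E assume E: "E \<in> {B \<in> sets baire_algebra. B \<subseteq> D}"
            have le: "ennreal (bm_value \<mu> F) \<le> ?V (C \<union> D)"
              if "F \<in> sets baire_algebra" "F \<subseteq> C \<union> D" for F
              using that by (intro SUP_upper) auto
            have BE: "bm_value \<mu> (B \<union> E) = bm_value \<mu> B + bm_value \<mu> E"
              using B E that by (intro bm_union2) auto
            consider "bm_value \<mu> B \<le> 0" | "bm_value \<mu> E \<le> 0" | "bm_value \<mu> B \<ge> 0" "bm_value \<mu> E \<ge> 0"
              by linarith
            then show "ennreal (bm_value \<mu> B) + ennreal (bm_value \<mu> E) \<le> ?V (C \<union> D)"
            proof cases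
              case 1
              then show ?thesis using le[of E] E by (simp add: ennreal_neg le_supI2)
            next
              case 2
              then show ?thesis using le[of B] B by (simp add: ennreal_neg le_supI1)
            next
              case 3
              then show ?thesis
                using le[of "B \<union> E"] B E BE by (simp add: ennreal_plus) blast
            qed
          qed
          finally show "ennreal (bm_value \<mu> B) + ?V D \<le> ?V (C \<union> D)" .
        qed
        finally show ?thesis .
      qed
      have fin: "(\<Sum>i<n. ?V (A i)) \<le> ?V (\<Union>i<n. A i)" for n
      proof (induction n)
        case 0
        then show ?case by simp
      next
        case (Suc n)
        have "(\<Sum>i<Suc n. ?V (A i)) \<le> ?V (\<Union>i<n. A i) + ?V (A n)" using Suc by (simp add: add_right_mono)
        also have "\<dots> \<le> ?V ((\<Union>i<n. A i) \<union> A n)"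
        proof (rule add2)
          have "A i \<inter> A n = {}" if "i < n" for i
            using A(2) that unfolding disjoint_family_on_def by simp
          then show "(\<Union>i<n. A i) \<inter> A n = {}" by blast
        qed (use A in auto)
        finally show ?case by (simp add: lessThan_Suc Un_commute)
      qed
      show "(\<Sum>i. ?V (A i)) \<le> ?V (\<Union>i. A i)"
      proof (rule suminf_le_const)
        show "summable (\<lambda>i. ?V (A i))" by simp
        fix n
        have "?V (\<Union>i<n. A i) \<le> ?V (\<Union>i. A i)" by (rule SUP_subset_mono) auto
        with fin[of n] show "(\<Sum>i<n. ?V (A i)) \<le> ?V (\<Union>i. A i)" by (rule order_trans)
      qed
      show "?V (\<Union>i. A i) \<le> (\<Sum>i. ?V (A i))"
      proof (rule SUP_least)
        fix B assume B: "B \<in> {B \<in> sets baire_algebra. B \<subseteq> (\<Union>i. A i)}"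
        have s: "(\<lambda>i. bm_value \<mu> (B \<inter> A i)) sums bm_value \<mu> (\<Union>i. B \<inter> A i)"
          using A B by (intro bm_sums) (auto simp: disjoint_family_on_def)
        have "(\<Union>i. B \<inter> A i) = B" using B by auto
        with s have s: "(\<lambda>i. bm_value \<mu> (B \<inter> A i)) sums bm_value \<mu> B" by simp
        have le: "ennreal (\<Sum>i<n. bm_value \<mu> (B \<inter> A i)) \<le> (\<Sum>i. ?V (A i))" for n
        proof -
          have "ennreal (\<Sum>i<n. bm_value \<mu> (B \<inter> A i)) \<le> ennreal (\<Sum>i<n. max 0 (bm_value \<mu> (B \<inter> A i)))"
            by (intro ennreal_leI sum_mono) simp
          also have "\<dots> = (\<Sum>i<n. ennreal (max 0 (bm_value \<mu> (B \<inter> A i))))"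
            by (rule sum_ennreal[symmetric]) simp
          also have "\<dots> \<le> (\<Sum>i<n. ?V (A i))"
          proof (rule sum_mono)
            fix i
            have "ennreal (bm_value \<mu> (B \<inter> A i)) \<le> ?V (A i)" using A B by (intro SUP_upper) auto
            then show "ennreal (max 0 (bm_value \<mu> (B \<inter> A i))) \<le> ?V (A i)" by (simp add: max_def)
          qed
          also have "\<dots> \<le> (\<Sum>i. ?V (A i))" by (rule sum_le_suminf) auto
          finally show ?thesis .
        qed
        show "ennreal (bm_value \<mu> B) \<le> (\<Sum>i. ?V (A i))"
          using s le unfolding sums_def by (intro tendsto_upperbound[OF tendsto_ennrealI]) auto
      qed
    qed
  qed
qed fact

lemma finite_measure_bm_pos: "finite_measure (bm_pos \<mu>)"
proof
  have "emeasure (bm_pos \<mu>) UNIV \<le> ennreal (norm \<mu>)"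
    unfolding emeasure_bm_pos[OF sets.top[of baire_algebra, unfolded space_baire]]
    using bm_value_le_norm[of \<mu>] by (intro SUP_least ennreal_leI) (meson abs_le_D1)
  then show "emeasure (bm_pos \<mu>) (space (bm_pos \<mu>)) \<noteq> \<infinity>"
    using ennreal_less_top[of "norm \<mu>"] by (auto simp: top_unique)
qed

lemma measurable_baire:
  assumes "continuous_on UNIV (f :: 'a::topological_space \<Rightarrow> real)"
  shows "f \<in> borel_measurable baire_algebra"
proof (rule borel_measurableI)
  fix S :: "real set" assume "open S"
  then show "f -` S \<inter> space baire_algebra \<in> sets baire_algebra"
    using assms by (auto simp: baire_algebra_def)
qed

lemma integrable_bm_pos:
  "integrable (bm_pos \<mu>) (apply_bcontfun (f :: 'a::topological_space \<Rightarrow>\<^sub>C real))"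
proof (rule finite_measure.integrable_const_bound[OF finite_measure_bm_pos])
  show "AE x in bm_pos \<mu>. norm (apply_bcontfun f x) \<le> norm f"
    by (rule AE_I2) (rule norm_bounded)
  have "apply_bcontfun f \<in> borel_measurable baire_algebra" by (rule measurable_baire) simp
  then show "apply_bcontfun f \<in> borel_measurable (bm_pos \<mu>)"
    by (simp add: measurable_def)
qed

text \<open>Boundedness of the functional, so that \<open>Blinfun\<close> below is not applied to junk.\<close>

lemma bounded_linear_bm_integral: "bounded_linear (\<lambda>f. bm_integral \<mu> (apply_bcontfun f))"
proof (rule bounded_linear_intro)
  fix f g :: "'a \<Rightarrow>\<^sub>C real" and c :: real
  show "bm_integral \<mu> (apply_bcontfun (f + g)) =
      bm_integral \<mu> (apply_bcontfun f) + bm_integral \<mu> (apply_bcontfun g)"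
    by (simp add: bm_integral_def integrable_bm_pos Bochner_Integration.integral_add)
  show "bm_integral \<mu> (apply_bcontfun (c *\<^sub>R f)) = c *\<^sub>R bm_integral \<mu> (apply_bcontfun f)"
    by (simp add: bm_integral_def algebra_simps)
  have b: "\<bar>LINT x|bm_pos \<nu>. apply_bcontfun f x\<bar> \<le> norm f * measure (bm_pos \<nu>) UNIV" for \<nu>
  proof -
    interpret finite_measure "bm_pos \<nu>" by (rule finite_measure_bm_pos)
    have "\<bar>LINT x|bm_pos \<nu>. apply_bcontfun f x\<bar> \<le> (LINT x|bm_pos \<nu>. \<bar>apply_bcontfun f x\<bar>)"
      by (rule integral_abs_bound)
    also have "\<dots> \<le> (LINT x|bm_pos \<nu>. norm f)"
      using norm_bounded[of f]
      by (intro integral_mono integrable_abs integrable_bm_pos) auto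
    finally show ?thesis by (simp add: mult.commute)
  qed
  show "norm (bm_integral \<mu> (apply_bcontfun f)) \<le>
      norm f * (measure (bm_pos \<mu>) UNIV + measure (bm_pos (- \<mu>)) UNIV)"
    using b[of \<mu>] b[of "- \<mu>"] by (simp add: bm_integral_def algebra_simps)
qed

definition bm_functional :: "'a::topological_space baire_measure \<Rightarrow> ('a \<Rightarrow>\<^sub>C real) \<Rightarrow>\<^sub>L real" where
  "bm_functional \<mu> = Blinfun (\<lambda>f. bm_integral \<mu> (apply_bcontfun f))"

lemma bm_functional_apply: "blinfun_apply (bm_functional \<mu>) f = bm_integral \<mu> (apply_bcontfun f)"
  unfolding bm_functional_def by (simp add: bounded_linear_Blinfun_apply bounded_linear_bm_integral)

text \<open>The topology \<open>\<sigma>(M(\<Omega>), C\<^sub>b(\<Omega>))\<close>.\<close>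

definition weak_measure_topology :: "'a::topological_space baire_measure topology" where
  "weak_measure_topology =
     seminorm_topology (range (\<lambda>f \<mu>. \<bar>blinfun_apply (bm_functional \<mu>) f\<bar>))"

definition banach_adjoint ::
  "('x::real_normed_vector \<Rightarrow>\<^sub>L 'y::real_normed_vector) \<Rightarrow> ('y \<Rightarrow>\<^sub>L real) \<Rightarrow> ('x \<Rightarrow>\<^sub>L real)" where
  "banach_adjoint A \<phi> = \<phi> o\<^sub>L A"

text \<open>
  The restriction of the adjoint to measures, read through the identification of \<open>\<mu>\<close> with
  \<open>bm_functional \<mu>\<close>. As \<open>inv\<close> is total, that the adjoint maps the range of \<open>bm_functional\<close> into
  itself has to be stated separately, as \<open>bm_functional (measure_adjoint A \<mu>) = banach_adjoint A (bm_functional \<mu>)\<close>.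
\<close>

definition measure_adjoint ::
  "(('a::topological_space \<Rightarrow>\<^sub>C real) \<Rightarrow>\<^sub>L ('a \<Rightarrow>\<^sub>C real)) \<Rightarrow> 'a baire_measure \<Rightarrow> 'a baire_measure" where
  "measure_adjoint A \<mu> = inv bm_functional (banach_adjoint A (bm_functional \<mu>))"

end

theory Submission
  imports Defs
begin

text \<open>
  The crux is that a weakly null sequence of measures integrates a bounded sequence, null in the
  compact-open topology, to a null sequence. A gliding hump argument gives this directly. It
  implies on the one hand that weak limits of measures are again continuous along bounded
  \<open>\<tau>\<^sub>c\<close>-null sequences, and such functionals are measures by a Riesz representation theorem; hence
  \<open>M(\<Omega>)\<close> is weakly sequentially complete. The same representation theorem shows that the adjoints
  preserve \<open>M(\<Omega>)\<close>. On the other hand, if \<open>\<mu>\<^sub>n \<rightarrow> 0\<close> weakly but \<open>\<integral>T(t\<^sub>n)f d\<mu>\<^sub>n\<close> stays away from \<open>0\<close>, a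
  subsequence with \<open>t\<^sub>n \<rightarrow> t\<close> contradicts the crux applied to \<open>T(t\<^sub>n)f - T(t)f\<close>, which gives local
  bi-equicontinuity. Continuity of the orbits is dominated convergence.
\<close>

section \<open>Topologies generated by seminorms\<close>

text \<open>Two substitutes carry the proof. First, a convergent sequence together with its limit is
  compact; hence sequences null on compact sets are equicontinuous, and their tail suprema are
  continuous and can be used to build test functions. Second, Dini's theorem turns monotone
  pointwise convergence into uniform convergence on compact sets, so continuity along bounded null
  sequences yields Daniell's smoothness condition, which stands in for compact support when the
  representing measure is constructed. Completeness and separability enter through inner regularity:
  finite Borel measures live on compact sets up to epsilon, so the total variation is the dual norm.
  From this come the injectivity of \<open>bm_functional\<close>, the Hausdorff and norming
  properties of the weak topology and the norm bound for the adjoints.\<close>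

definition seminorm :: "('x::real_vector \<Rightarrow> real) \<Rightarrow> bool" where
  "seminorm p \<longleftrightarrow> (\<forall>x y. p (x + y) \<le> p x + p y) \<and> (\<forall>c x. p (c *\<^sub>R x) = \<bar>c\<bar> * p x)"

lemma seminorm_add: "seminorm p \<Longrightarrow> p (x + y) \<le> p x + p y"
  by (simp add: seminorm_def)

lemma seminorm_scaleR: "seminorm p \<Longrightarrow> p (c *\<^sub>R x) = \<bar>c\<bar> * p x"
  by (simp add: seminorm_def)

lemma seminorm_zero: "seminorm p \<Longrightarrow> p 0 = 0"
  using seminorm_scaleR[of p 0 0] by simp

lemma seminorm_minus: "seminorm p \<Longrightarrow> p (- x) = p x"
  using seminorm_scaleR[of p "-1" x] by simp

lemma seminorm_diff: "seminorm p \<Longrightarrow> p (x - y) \<le> p (x - z) + p (z - y)"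
  using seminorm_add[of p "x - z" "z - y"] by simp

lemma seminorm_nonneg: "seminorm p \<Longrightarrow> 0 \<le> p x"
  using seminorm_add[of p x "- x"] by (simp add: seminorm_minus seminorm_zero)

lemma openin_seminorm_ball:
  "p \<in> P \<Longrightarrow> r > 0 \<Longrightarrow> openin (seminorm_topology P) {x. p (x - a) < r}"
  unfolding seminorm_topology_def by (rule topology_generated_by_Basis) blast

lemma topspace_seminorm_topology:
  assumes "P \<noteq> {}" "\<forall>p\<in>P. seminorm p"
  shows "topspace (seminorm_topology P) = UNIV"
proof -
  obtain p where p: "p \<in> P" using assms by auto
  have "x \<in> topspace (seminorm_topology P)" for x
    using openin_subset[OF openin_seminorm_ball[OF p zero_less_one, of x]] seminorm_zero[OF assms(2)[rule_format, OF p]]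
    by auto
  then show ?thesis by auto
qed

text \<open>The generating balls may be centred anywhere. The induction therefore treats all points
  of \<open>U\<close> at once, and its \<open>Basis\<close> case recentres a ball at
  \<open>a\<close>: by the triangle inequality the radius left over is
  \<open>r - p (a - b)\<close>.\<close>

lemma seminorm_topology_nhd:
  assumes sn: "\<forall>p\<in>P. seminorm p"
    and "openin (seminorm_topology P) U" "a \<in> U"
  obtains F e where "finite F" "F \<subseteq> P" "e > 0" "{x. \<forall>p\<in>F. p (x - a) < e} \<subseteq> U"
proof -
  have "generate_topology_on {{x. p (x - a) < r} | p a r. p \<in> P \<and> r > 0} U"
    using assms(2) unfolding seminorm_topology_def by (rule openin_topology_generated_by)
  then have "\<forall>a\<in>U. \<exists>F e. finite F \<and> F \<subseteq> P \<and> e > 0 \<and> {x. \<forall>p\<in>F. p (x - a) < e} \<subseteq> U"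
  proof induction
    case (Int U V)
    show ?case
    proof
      fix a assume "a \<in> U \<inter> V"
      then obtain F e G d where F: "finite F" "F \<subseteq> P" "e > 0" "{x. \<forall>p\<in>F. p (x - a) < e} \<subseteq> U"
        and G: "finite G" "G \<subseteq> P" "d > 0" "{x. \<forall>p\<in>G. p (x - a) < d} \<subseteq> V"
        using Int.IH by (auto dest!: bspec)
      have "{x. \<forall>p\<in>F \<union> G. p (x - a) < min e d} \<subseteq> U \<inter> V" using F(4) G(4) by auto
      with F G show "\<exists>F e. finite F \<and> F \<subseteq> P \<and> e > 0 \<and> {x. \<forall>p\<in>F. p (x - a) < e} \<subseteq> U \<inter> V"
        by (intro exI[of _ "F \<union> G"] exI[of _ "min e d"]) auto
    qed
  next
    case (UN K)
    show ?case
    proof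
      fix a assume "a \<in> \<Union>K"
      then obtain U where U: "U \<in> K" "a \<in> U" by blast
      obtain F e where "finite F" "F \<subseteq> P" "e > 0" "{x. \<forall>p\<in>F. p (x - a) < e} \<subseteq> U"
        using bspec[OF UN.IH[OF U(1)] U(2)] by (elim exE conjE)
      with U show "\<exists>F e. finite F \<and> F \<subseteq> P \<and> e > 0 \<and> {x. \<forall>p\<in>F. p (x - a) < e} \<subseteq> \<Union>K"
        by (intro exI[of _ F] exI[of _ e]) auto
    qed
  next
    case (Basis s)
    then obtain p b r where s: "s = {x. p (x - b) < r}" "p \<in> P" by blast
    show ?case
    proof
      fix a assume "a \<in> s"
      have "x \<in> s" if "p (x - a) < r - p (a - b)" for x
        using seminorm_diff[OF bspec[OF sn, OF s(2)], of x b a] s that by simp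
      then have "{x. \<forall>q\<in>{p}. q (x - a) < r - p (a - b)} \<subseteq> s" by blast
      with s \<open>a \<in> s\<close> show "\<exists>F e. finite F \<and> F \<subseteq> P \<and> e > 0 \<and> {x. \<forall>p\<in>F. p (x - a) < e} \<subseteq> s"
        by (intro exI[of _ "{p}"] exI[of _ "r - p (a - b)"]) auto
    qed
  qed simp
  then show ?thesis using that \<open>a \<in> U\<close> by blast
qed

lemma limitin_seminorm_topology:
  assumes "P \<noteq> {}" and sn: "\<forall>p\<in>P. seminorm p"
  shows "limitin (seminorm_topology P) x l F \<longleftrightarrow> (\<forall>p\<in>P. ((\<lambda>n. p (x n - l)) \<longlongrightarrow> 0) F)"
proof safe
  fix p assume lim: "limitin (seminorm_topology P) x l F" and p: "p \<in> P"
  show "((\<lambda>n. p (x n - l)) \<longlongrightarrow> 0) F"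
  proof (rule tendstoI)
    fix e :: real assume "e > 0"
    then have "\<forall>\<^sub>F n in F. x n \<in> {x. p (x - l) < e}"
      using lim openin_seminorm_ball[OF p, of e l] seminorm_zero[OF bspec[OF sn p]]
      by (auto simp: limitin_def)
    then show "\<forall>\<^sub>F n in F. dist (p (x n - l)) 0 < e"
      by eventually_elim (use seminorm_nonneg[OF bspec[OF sn p]] in auto)
  qed
next
  assume lim: "\<forall>p\<in>P. ((\<lambda>n. p (x n - l)) \<longlongrightarrow> 0) F"
  show "limitin (seminorm_topology P) x l F"
    unfolding limitin_def
  proof (intro conjI allI impI)
    show "l \<in> topspace (seminorm_topology P)" using topspace_seminorm_topology[OF assms] by simp
    fix U assume U: "openin (seminorm_topology P) U \<and> l \<in> U"
    obtain G e where G: "finite G" "G \<subseteq> P" "e > 0" "{x. \<forall>p\<in>G. p (x - l) < e} \<subseteq> U"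
      by (rule seminorm_topology_nhd[of P U l, OF sn]) (use U in auto)
    have "\<forall>\<^sub>F n in F. \<forall>p\<in>G. p (x n - l) < e"
      using G lim by (intro eventually_ball_finite) (auto intro: order_tendstoD(2))
    then show "\<forall>\<^sub>F n in F. x n \<in> U" by eventually_elim (use G in auto)
  qed
qed

text \<open>Openness of preimages has to be checked for the generating balls only. A ball around
  \<open>a\<close> that contains \<open>f x\<close> also contains the ball around \<open>f x\<close>
  of radius \<open>r - p (f x - a)\<close>.\<close>

lemma continuous_map_seminorm_topology:
  assumes "P \<noteq> {}" and sn: "\<forall>p\<in>P. seminorm p"
  shows "continuous_map X (seminorm_topology P) f \<longleftrightarrow>
    (\<forall>p\<in>P. \<forall>x\<in>topspace X. \<forall>e>0. \<exists>U. openin X U \<and> x \<in> U \<and> (\<forall>y\<in>U. p (f y - f x) < e))"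
proof safe
  fix p x and e :: real
  assume c: "continuous_map X (seminorm_topology P) f" and p: "p \<in> P" and "x \<in> topspace X" "e > 0"
  then have "openin X {y \<in> topspace X. f y \<in> {z. p (z - f x) < e}}"
    by (intro openin_continuous_map_preimage[OF c] openin_seminorm_ball)
  then show "\<exists>U. openin X U \<and> x \<in> U \<and> (\<forall>y\<in>U. p (f y - f x) < e)"
    using \<open>e > 0\<close> \<open>x \<in> topspace X\<close> seminorm_zero[OF bspec[OF sn p]]
    by (intro exI[of _ "{y \<in> topspace X. f y \<in> {z. p (z - f x) < e}}"]) auto
next
  assume *: "\<forall>p\<in>P. \<forall>x\<in>topspace X. \<forall>e>0. \<exists>U. openin X U \<and> x \<in> U \<and> (\<forall>y\<in>U. p (f y - f x) < e)"
  have "openin X (f -` S \<inter> topspace X)"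
    if S: "S \<in> {{x. p (x - a) < r} | p a r. p \<in> P \<and> r > 0}" for S
  proof (subst openin_subopen, safe)
    fix x assume x: "x \<in> topspace X" "f x \<in> S"
    obtain p a r where p: "S = {x. p (x - a) < r}" "p \<in> P" using S by blast
    with x have "r - p (f x - a) > 0" by auto
    with * p(2) x(1) obtain U where U: "openin X U" "x \<in> U" "\<And>y. y \<in> U \<Longrightarrow> p (f y - f x) < r - p (f x - a)"
      by meson
    have "f y \<in> S" if "y \<in> U" for y
      using U(3)[OF that] seminorm_diff[OF bspec[OF sn, OF p(2)], of "f y" a "f x"] unfolding p by auto
    with U openin_subset[OF U(1)] show "\<exists>T. openin X T \<and> x \<in> T \<and> T \<subseteq> f -` S \<inter> topspace X" by blast
  qed
  then show "continuous_map X (seminorm_topology P) f"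
    using topspace_seminorm_topology[OF assms]
    unfolding seminorm_topology_def continuous_on_generated_topo_iff by auto
qed

lemma locally_convex_seminorm_topology:
  assumes "P \<noteq> {}" and sn: "\<forall>p\<in>P. seminorm p"
  shows "locally_convex_topology (seminorm_topology P)"
  unfolding locally_convex_topology_def
proof (intro conjI allI impI)
  note top = topspace_seminorm_topology[OF assms]
  note cont = continuous_map_seminorm_topology[OF assms]
  show "topspace (seminorm_topology P) = UNIV" by (rule top)
  show "continuous_map (prod_topology (seminorm_topology P) (seminorm_topology P))
      (seminorm_topology P) (\<lambda>(x, y). x + y)"
    unfolding cont
  proof clarify
    fix p x y and e :: real assume p: "p \<in> P" and e: "e > 0"
    let ?B = "\<lambda>a. {z. p (z - a) < e / 2}"
    have "p ((u + v) - (x + y)) < e" if "u \<in> ?B x" "v \<in> ?B y" for u v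
      using that seminorm_add[OF bspec[OF sn p], of "u - x" "v - y"] by (simp add: add_diff_add)
    moreover have "openin (prod_topology (seminorm_topology P) (seminorm_topology P)) (?B x \<times> ?B y)"
      unfolding openin_prod_Times_iff using p e by (intro disjI2 conjI openin_seminorm_ball) auto
    ultimately show "\<exists>U. openin (prod_topology (seminorm_topology P) (seminorm_topology P)) U \<and> (x, y) \<in> U \<and>
        (\<forall>w\<in>U. p ((case w of (x, y) \<Rightarrow> x + y) - (x + y)) < e)"
      using e seminorm_zero[OF bspec[OF sn p]] by (intro exI[of _ "?B x \<times> ?B y"]) auto
  qed
  show "continuous_map (prod_topology euclideanreal (seminorm_topology P)) (seminorm_topology P)
      (\<lambda>(c, x). c *\<^sub>R x)"
    unfolding cont
  proof clarify
    fix p c x and e :: real assume p: "p \<in> P" and e: "e > 0"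
    note p0 = seminorm_nonneg[OF bspec[OF sn p]]
    \<comment> \<open>The radii come from splitting \<open>a u - c x\<close> into
      \<open>a (u - x)\<close> and \<open>(a - c) x\<close>: as \<open>d \<le> 1\<close> bounds
      \<open>\<bar>a\<bar>\<close> by \<open>\<bar>c\<bar> + 1\<close>, each term costs at most
      \<open>e / 2\<close>. The added 1 avoids division by zero.\<close>
    define d where "d = min 1 (e / (2 * (p x + 1)))"
    define r where "r = e / (2 * (\<bar>c\<bar> + 1))"
    have d: "0 < d" "d \<le> 1" "d * p x < e / 2" and r: "0 < r" "(\<bar>c\<bar> + 1) * r = e / 2"
    proof -
      show "0 < d" "d \<le> 1" "0 < r" "(\<bar>c\<bar> + 1) * r = e / 2"
        using e p0[of x] by (auto simp: d_def r_def field_simps)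
      have "d * p x \<le> e / (2 * (p x + 1)) * p x"
        using p0[of x] by (intro mult_right_mono) (auto simp: d_def)
      also have "\<dots> < e / 2" using e p0[of x] by (simp add: field_simps)
      finally show "d * p x < e / 2" .
    qed
    let ?U = "ball c d \<times> {z. p (z - x) < r}"
    have "p (a *\<^sub>R u - c *\<^sub>R x) < e" if a: "a \<in> ball c d" and u: "p (u - x) < r" for a u
    proof -
      have "\<bar>a\<bar> \<le> \<bar>c\<bar> + 1" "\<bar>a - c\<bar> \<le> d" using a d by (auto simp: dist_real_def)
      have "p (a *\<^sub>R u - c *\<^sub>R x) \<le> p (a *\<^sub>R (u - x)) + p ((a - c) *\<^sub>R x)"
        using seminorm_add[OF bspec[OF sn p], of "a *\<^sub>R (u - x)" "(a - c) *\<^sub>R x"] by (simp add: algebra_simps)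
      also have "\<dots> = \<bar>a\<bar> * p (u - x) + \<bar>a - c\<bar> * p x" by (simp add: seminorm_scaleR bspec[OF sn p])
      also have "\<dots> \<le> (\<bar>c\<bar> + 1) * r + d * p x"
        using \<open>\<bar>a\<bar> \<le> \<bar>c\<bar> + 1\<close> \<open>\<bar>a - c\<bar> \<le> d\<close> u p0 by (intro add_mono mult_mono) auto
      also have "\<dots> < e" using d r by simp
      finally show ?thesis .
    qed
    moreover have "openin (prod_topology euclideanreal (seminorm_topology P)) ?U"
      unfolding openin_prod_Times_iff using p r by (intro disjI2 conjI openin_seminorm_ball) auto
    ultimately show "\<exists>U. openin (prod_topology euclideanreal (seminorm_topology P)) U \<and> (c, x) \<in> U \<and>
        (\<forall>w\<in>U. p ((case w of (c, x) \<Rightarrow> c *\<^sub>R x) - c *\<^sub>R x) < e)"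
      using d r seminorm_zero[OF bspec[OF sn p]] by (intro exI[of _ ?U]) auto
  qed
  fix U assume U: "openin (seminorm_topology P) U \<and> 0 \<in> U"
  obtain F e where F: "finite F" "F \<subseteq> P" "e > 0" "{x. \<forall>p\<in>F. p (x - 0) < e} \<subseteq> U"
    by (rule seminorm_topology_nhd[of P U 0, OF sn]) (use U in blast)+
  let ?V = "{x. \<forall>p\<in>F. p (x - 0) < e}"
  \<comment> \<open>The empty \<open>F\<close> is treated apart because \<open>openin_INT2\<close>
    needs a nonempty index set; the neighbourhood is then the whole space.\<close>
  have "openin (seminorm_topology P) (\<Inter>p\<in>F. {x. p (x - 0) < e})" if "F \<noteq> {}"
    using F that by (intro openin_INT2 openin_seminorm_ball) (simp_all add: subset_iff)
  moreover have "?V = (\<Inter>p\<in>F. {x. p (x - 0) < e})" by auto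
  moreover have "openin (seminorm_topology P) UNIV" using top by (metis openin_topspace)
  ultimately have "openin (seminorm_topology P) ?V" by (cases "F = {}") auto
  moreover have "convex ?V"
  proof (rule convexI, safe)
    fix x y p and u v :: real
    assume x: "\<forall>p\<in>F. p (x - 0) < e" and y: "\<forall>p\<in>F. p (y - 0) < e"
      and uv: "0 \<le> u" "0 \<le> v" "u + v = 1" and p: "p \<in> F"
    have "p (u *\<^sub>R x + v *\<^sub>R y) \<le> u * p x + v * p y"
      using seminorm_add[of p "u *\<^sub>R x" "v *\<^sub>R y"] F p sn uv by (auto simp: seminorm_scaleR)
    also have "\<dots> < e"
      using x y p uv by (intro convex_bound_lt) auto
    finally show "p (u *\<^sub>R x + v *\<^sub>R y - 0) < e" by simp
  qed
  moreover have "0 \<in> ?V" using F sn by (auto simp: seminorm_zero subset_iff)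
  ultimately show "\<exists>V. openin (seminorm_topology P) V \<and> 0 \<in> V \<and> convex V \<and> V \<subseteq> U"
    using F(4) by blast
qed

section \<open>Integration against signed measures\<close>

text \<open>
  The set function enters \<open>level_sum\<close> linearly, through its values on the level sets of \<open>f\<close>. As
  integrals are limits of such sums, the integral against a signed measure is linear in the measure
  and does not depend on the chosen decomposition into positive measures.
\<close>

definition level_sum :: "('a set \<Rightarrow> real) \<Rightarrow> ('a \<Rightarrow> real) \<Rightarrow> real \<Rightarrow> nat \<Rightarrow> real" where
  "level_sum m f B n =
     (\<Sum>k\<in>{- \<lceil>real (Suc n) * B\<rceil> - 1..\<lceil>real (Suc n) * B\<rceil> + 1}. (k / real (Suc n)) * m {x. \<lfloor>real (Suc n) * f x\<rfloor> = k})"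

lemma floor_in_level_range:
  assumes "\<bar>y\<bar> \<le> B"
  shows "\<lfloor>real (Suc n) * y\<rfloor> \<in> {- \<lceil>real (Suc n) * B\<rceil> - 1..\<lceil>real (Suc n) * B\<rceil> + 1}"
proof -
  have "\<bar>real (Suc n) * y\<bar> \<le> real (Suc n) * B" using assms by (simp add: abs_mult)
  then show ?thesis unfolding atLeastAtMost_iff by linarith
qed

lemma floor_div_Suc_approx: "\<bar>real_of_int \<lfloor>real (Suc n) * y\<rfloor> / real (Suc n) - y\<bar> \<le> 1 / real (Suc n)"
proof -
  have "\<bar>real_of_int \<lfloor>real (Suc n) * y\<rfloor> - real (Suc n) * y\<bar> \<le> 1" by linarith
  then have "\<bar>real_of_int \<lfloor>real (Suc n) * y\<rfloor> - real (Suc n) * y\<bar> / real (Suc n) \<le> 1 / real (Suc n)"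
    by (intro divide_right_mono) auto
  moreover have "real_of_int \<lfloor>real (Suc n) * y\<rfloor> / real (Suc n) - y = (real_of_int \<lfloor>real (Suc n) * y\<rfloor> - real (Suc n) * y) / real (Suc n)"
    by (simp add: diff_divide_distrib)
  ultimately show ?thesis by (simp only: abs_divide abs_of_nat)
qed

text \<open>The level sum is the integral of the simple function that rounds \<open>f\<close> down
  to a multiple of \<open>1 / Suc n\<close>. It differs from \<open>f\<close> by at most
  \<open>1 / Suc n\<close>, so dominated convergence applies with the constant
  \<open>B + 1\<close>.\<close>

lemma level_sum_tendsto_integral:
  assumes M: "finite_measure M" and sp: "space M = UNIV"
    and f: "f \<in> borel_measurable M" and B: "\<And>x. \<bar>f x\<bar> \<le> B"
  shows "level_sum (measure M) f B \<longlonglongrightarrow> (LINT x|M. f x)"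
proof -
  interpret finite_measure M by fact
  define s where "s n x = real_of_int \<lfloor>real (Suc n) * f x\<rfloor> / real (Suc n)" for n x
  let ?K = "\<lambda>n. {- \<lceil>real (Suc n) * B\<rceil> - 1..\<lceil>real (Suc n) * B\<rceil> + 1}"
  have meas: "{x. \<lfloor>real (Suc n) * f x\<rfloor> = k} \<in> sets M" for n k
  proof -
    have "{x \<in> space M. \<lfloor>real (Suc n) * f x\<rfloor> = k} \<in> sets M" using f by measurable
    then show ?thesis using sp by simp
  qed
  have "(LINT x|M. s n x) = level_sum (measure M) f B n" for n
  proof -
    have "s n x = (\<Sum>k\<in>?K n. (k / real (Suc n)) * indicator {x. \<lfloor>real (Suc n) * f x\<rfloor> = k} x)" for x
    proof -
      have "(\<Sum>k\<in>?K n. (k / real (Suc n)) * indicator {x. \<lfloor>real (Suc n) * f x\<rfloor> = k} x) =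
          (\<Sum>k\<in>?K n. if k = \<lfloor>real (Suc n) * f x\<rfloor> then k / real (Suc n) else 0)"
        by (intro sum.cong) (auto simp: indicator_def)
      also have "\<dots> = s n x"
        using floor_in_level_range[OF B, of n x] by (simp only: sum.delta finite_atLeastAtMost_int s_def) simp
      finally show ?thesis ..
    qed
    then have "(LINT x|M. s n x) =
        (LINT x|M. (\<Sum>k\<in>?K n. (k / real (Suc n)) * indicator {x. \<lfloor>real (Suc n) * f x\<rfloor> = k} x))"
      by presburger
    also have "\<dots> = (\<Sum>k\<in>?K n. (LINT x|M. (k / real (Suc n)) * indicator {x. \<lfloor>real (Suc n) * f x\<rfloor> = k} x))"
      by (intro Bochner_Integration.integral_sum integrable_mult_right integrable_real_indicator meas)
        (simp add: less_top[symmetric])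
    also have "\<dots> = level_sum (measure M) f B n"
      using meas sp by (simp add: level_sum_def)
    finally show ?thesis .
  qed
  moreover have "(\<lambda>n. LINT x|M. s n x) \<longlonglongrightarrow> (LINT x|M. f x)"
  proof (rule integral_dominated_convergence[where w = "\<lambda>_. B + 1"])
    show "s n \<in> borel_measurable M" for n unfolding s_def using f by measurable
    show "AE x in M. (\<lambda>n. s n x) \<longlonglongrightarrow> f x"
    proof (rule AE_I2)
      fix x
      have "(\<lambda>n. s n x - f x) \<longlonglongrightarrow> 0"
        using floor_div_Suc_approx[of _ "f x"]
        by (intro Lim_null_comparison[OF _ LIMSEQ_inverse_real_of_nat]) (simp add: s_def inverse_eq_divide)
      then show "(\<lambda>n. s n x) \<longlonglongrightarrow> f x" by (simp add: LIM_zero_iff)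
    qed
    show "AE x in M. norm (s n x) \<le> B + 1" for n
    proof (rule AE_I2)
      fix x
      have "1 / real (Suc n) \<le> 1" by simp
      then show "norm (s n x) \<le> B + 1"
        using floor_div_Suc_approx[of n "f x"] B[of x] unfolding s_def real_norm_def by linarith
    qed
  qed (use f in auto)
  ultimately show ?thesis by simp
qed

text \<open>No Hahn decomposition is used. For \<open>B\<close> inside \<open>A\<close>, the value
  at \<open>B\<close> is the value at \<open>A\<close> minus the value at \<open>A - B\<close>, and
  the latter is at least minus the negative part of \<open>A\<close>. The supremum over
  \<open>B\<close> gives one inequality; the other is the same for \<open>- \<mu>\<close>.\<close>

lemma bm_value_jordan:
  assumes "A \<in> sets baire_algebra"
  shows "bm_value \<mu> A = measure (bm_pos \<mu>) A - measure (bm_pos (- \<mu>)) A"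
proof -
  have em: "emeasure (bm_pos \<nu>) A = ennreal (measure (bm_pos \<nu>) A)" for \<nu> :: "'a baire_measure"
    using finite_measure.emeasure_eq_measure[OF finite_measure_bm_pos] by blast
  have upper: "bm_value \<nu> B \<le> measure (bm_pos \<nu>) A" if "B \<in> sets baire_algebra" "B \<subseteq> A"
    for B and \<nu> :: "'a baire_measure"
  proof -
    have "ennreal (bm_value \<nu> B) \<le> ennreal (measure (bm_pos \<nu>) A)"
      unfolding em[symmetric] emeasure_bm_pos[OF assms] using that by (intro SUP_upper) auto
    then show ?thesis by (auto simp: ennreal_le_iff2 intro: order_trans)
  qed
  have half: "measure (bm_pos \<nu>) A \<le> bm_value \<nu> A + measure (bm_pos (- \<nu>)) A" for \<nu> :: "'a baire_measure"
  proof -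
    have le: "bm_value \<nu> B \<le> bm_value \<nu> A + measure (bm_pos (- \<nu>)) A"
      if B: "B \<in> sets baire_algebra" "B \<subseteq> A" for B
    proof -
      have "bm_value \<nu> A = bm_value \<nu> (B \<union> (A - B))" using B by (intro arg_cong[of _ _ "bm_value \<nu>"]) auto
      also have "\<dots> = bm_value \<nu> B + bm_value \<nu> (A - B)" using B assms by (intro bm_union2) auto
      finally show ?thesis using upper[of "A - B" "- \<nu>"] B assms by (simp add: sets.Diff)
    qed
    have "ennreal (measure (bm_pos \<nu>) A) \<le> ennreal (bm_value \<nu> A + measure (bm_pos (- \<nu>)) A)"
      unfolding em[symmetric] emeasure_bm_pos[OF assms] using le by (intro SUP_least ennreal_leI) auto
    moreover have "0 \<le> bm_value \<nu> A + measure (bm_pos (- \<nu>)) A" using le[of "{}"] by simp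
    ultimately show ?thesis by (simp add: ennreal_le_iff)
  qed
  show ?thesis using half[of \<mu>] half[of "- \<mu>"] by simp
qed

lemma level_set_baire:
  fixes f :: "'a::topological_space \<Rightarrow> real"
  assumes "f \<in> borel_measurable baire_algebra"
  shows "{x. \<lfloor>c * f x\<rfloor> = k} \<in> sets baire_algebra"
proof -
  have "{x \<in> space baire_algebra. \<lfloor>c * f x\<rfloor> = k} \<in> sets baire_algebra" using assms by measurable
  then show ?thesis by simp
qed

text \<open>\<open>M\<close> and \<open>N\<close> form an arbitrary decomposition. The lemma serves
  for the Jordan parts, where it gives \<open>bm_integral\<close>, and for the two measures found in
  \<open>riesz_representation\<close>; uniqueness of limits then identifies the two
  differences.\<close>

lemma bm_integral_eq_diff:
  assumes M: "finite_measure M" "sets M = sets baire_algebra" "finite_measure N" "sets N = sets baire_algebra"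
    and \<mu>: "\<And>A. A \<in> sets baire_algebra \<Longrightarrow> bm_value \<mu> A = measure M A - measure N A"
    and f: "f \<in> borel_measurable baire_algebra" and B: "\<And>x. \<bar>f x\<bar> \<le> B"
  shows "level_sum (bm_value \<mu>) f B \<longlonglongrightarrow> (LINT x|M. f x) - (LINT x|N. f x)"
proof -
  have sp: "space M = UNIV" "space N = UNIV"
    using sets_eq_imp_space_eq[OF M(2)] sets_eq_imp_space_eq[OF M(4)] by simp_all
  have "f \<in> borel_measurable M" "f \<in> borel_measurable N"
    using f measurable_cong_sets[OF M(2) refl] measurable_cong_sets[OF M(4) refl] by auto
  then have "(\<lambda>n. level_sum (measure M) f B n - level_sum (measure N) f B n) \<longlonglongrightarrow> (LINT x|M. f x) - (LINT x|N. f x)"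
    using M sp B by (intro tendsto_diff level_sum_tendsto_integral) auto
  moreover have "level_sum (measure M) f B n - level_sum (measure N) f B n = level_sum (bm_value \<mu>) f B n" for n
    unfolding level_sum_def sum_subtractf[symmetric] right_diff_distrib[symmetric]
    by (intro sum.cong) (simp_all only: \<mu> level_set_baire[OF f])
  ultimately show ?thesis by simp
qed

lemma level_sum_tendsto_bm_integral:
  assumes "f \<in> borel_measurable baire_algebra" "\<And>x. \<bar>f x\<bar> \<le> B"
  shows "level_sum (bm_value \<mu>) f B \<longlonglongrightarrow> bm_integral \<mu> f"
  unfolding bm_integral_def
  by (rule bm_integral_eq_diff) (use assms in \<open>simp_all add: finite_measure_bm_pos bm_value_jordan\<close>)

section \<open>The pairing of measures with bounded continuous functions\<close>

lemma bcontfun_measurable_baire [measurable]: "apply_bcontfun f \<in> borel_measurable baire_algebra"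
  for f :: "'a::topological_space \<Rightarrow>\<^sub>C real"
  by (rule measurable_baire) simp

lemma abs_bcontfun_le: "\<bar>apply_bcontfun f x\<bar> \<le> norm f" for f :: "'a::topological_space \<Rightarrow>\<^sub>C real"
  using norm_bounded[of f x] by simp

lemmas level_sum_bcontfun = level_sum_tendsto_bm_integral[OF bcontfun_measurable_baire abs_bcontfun_le]

lemma bm_integral_add:
  "bm_integral (\<mu> + \<nu>) (apply_bcontfun f) = bm_integral \<mu> (apply_bcontfun f) + bm_integral \<nu> (apply_bcontfun f)"
proof (rule LIMSEQ_unique[OF level_sum_bcontfun])
  show "level_sum (bm_value (\<mu> + \<nu>)) f (norm f) \<longlonglongrightarrow> bm_integral \<mu> (apply_bcontfun f) + bm_integral \<nu> (apply_bcontfun f)"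
    using tendsto_add[OF level_sum_bcontfun[of \<mu> f] level_sum_bcontfun[of \<nu> f]]
    unfolding level_sum_def sum.distrib[symmetric] distrib_left[symmetric] bm_value_plus .
qed

lemma bm_integral_scaleR:
  "bm_integral (c *\<^sub>R \<mu>) (apply_bcontfun f) = c * bm_integral \<mu> (apply_bcontfun f)"
proof (rule LIMSEQ_unique[OF level_sum_bcontfun])
  show "level_sum (bm_value (c *\<^sub>R \<mu>)) f (norm f) \<longlonglongrightarrow> c * bm_integral \<mu> (apply_bcontfun f)"
    using tendsto_mult_left[OF level_sum_bcontfun[of \<mu> f], of c]
    unfolding level_sum_def sum_distrib_left bm_value_scaleR mult.left_commute[of c] .
qed

lemma bm_functional_add: "bm_functional (\<mu> + \<nu>) = bm_functional \<mu> + bm_functional \<nu>"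
  by (rule blinfun_eqI) (simp add: bm_functional_apply bm_integral_add blinfun.add_left)

lemma bm_functional_scaleR: "bm_functional (c *\<^sub>R \<mu>) = c *\<^sub>R bm_functional \<mu>"
  by (rule blinfun_eqI) (simp add: bm_functional_apply bm_integral_scaleR blinfun.scaleR_left)

lemma bm_functional_diff: "bm_functional (\<mu> - \<nu>) = bm_functional \<mu> - bm_functional \<nu>"
  using bm_functional_add[of \<mu> "- \<nu>"] bm_functional_scaleR[of "- 1" \<nu>] by simp

text \<open>For fixed \<open>n\<close> the level sets are disjoint, so a level sum is at most a
  bound for its coefficients times the total variation. That bound tends to
  \<open>norm f\<close>.\<close>

lemma abs_bm_functional_le: "\<bar>blinfun_apply (bm_functional \<mu>) f\<bar> \<le> norm f * norm \<mu>"
proof -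
  have bnd: "\<bar>level_sum (bm_value \<mu>) f (norm f) n\<bar> \<le> (norm f + 2 / real (Suc n)) * norm \<mu>" for n
  proof -
    let ?K = "{- \<lceil>real (Suc n) * norm f\<rceil> - 1..\<lceil>real (Suc n) * norm f\<rceil> + 1}"
    let ?A = "\<lambda>k. {x. \<lfloor>real (Suc n) * apply_bcontfun f x\<rfloor> = k}"
    \<comment> \<open>The 2 is made up of the extra index at the end of the range and the rounding
      of the ceiling.\<close>
    have k: "\<bar>real_of_int k / real (Suc n)\<bar> \<le> norm f + 2 / real (Suc n)" if "k \<in> ?K" for k
    proof -
      have "\<bar>real_of_int k\<bar> \<le> real (Suc n) * norm f + 2" using that by (simp only: atLeastAtMost_iff) linarith
      then have "\<bar>real_of_int k\<bar> / real (Suc n) \<le> (real (Suc n) * norm f + 2) / real (Suc n)" by (rule divide_right_mono) simp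
      then show ?thesis by (simp add: add_divide_distrib)
    qed
    have "\<bar>level_sum (bm_value \<mu>) f (norm f) n\<bar> \<le> (\<Sum>k\<in>?K. \<bar>real_of_int k / real (Suc n) * bm_value \<mu> (?A k)\<bar>)"
      unfolding level_sum_def by (rule sum_abs)
    also have "\<dots> \<le> (\<Sum>k\<in>?K. (norm f + 2 / real (Suc n)) * \<bar>bm_value \<mu> (?A k)\<bar>)"
      unfolding abs_mult using k by (intro sum_mono mult_right_mono) auto
    also have "\<dots> = (norm f + 2 / real (Suc n)) * (\<Sum>k\<in>?K. \<bar>bm_value \<mu> (?A k)\<bar>)" by (rule sum_distrib_left[symmetric])
    \<comment> \<open>Distinct indices can share a level set only if it is empty, where the measure
      vanishes; so the sum may run over the sets themselves.\<close>
    also have "(\<Sum>k\<in>?K. \<bar>bm_value \<mu> (?A k)\<bar>) = (\<Sum>A\<in>?A ` ?K. \<bar>bm_value \<mu> A\<bar>)"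
    proof (rule sum.reindex_nontrivial[symmetric, unfolded o_def])
      fix i j assume "i \<noteq> j" "?A i = ?A j"
      then have "?A i = {}" by auto
      then show "\<bar>bm_value \<mu> (?A i)\<bar> = 0" by simp
    qed simp
    also have "(norm f + 2 / real (Suc n)) * (\<Sum>A\<in>?A ` ?K. \<bar>bm_value \<mu> A\<bar>) \<le> (norm f + 2 / real (Suc n)) * norm \<mu>"
      by (intro mult_left_mono bm_sum_le_norm) (auto simp: disjoint_def level_set_baire)
    finally show ?thesis .
  qed
  have "(\<lambda>n. (norm f + 2 / real (Suc n)) * norm \<mu>) \<longlonglongrightarrow> (norm f + 0) * norm \<mu>"
    by (intro tendsto_intros tendsto_divide_0[OF tendsto_const] filterlim_at_top_imp_at_infinity
        filterlim_compose[OF filterlim_real_sequentially filterlim_Suc])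
  from tendsto_le[OF _ this tendsto_rabs[OF level_sum_bcontfun[of \<mu> f]]] bnd show ?thesis
    by (simp add: bm_functional_apply)
qed

lemma norm_bm_functional_le: "norm (bm_functional \<mu>) \<le> norm \<mu>"
  by (rule norm_blinfun_bound) (use abs_bm_functional_le[of \<mu>] in \<open>simp_all add: mult.commute\<close>)

lemma bm_functional_dominated_convergence:
  fixes f :: "nat \<Rightarrow> 'a::topological_space \<Rightarrow>\<^sub>C real"
  assumes bnd: "\<And>n. norm (f n) \<le> C" and lim: "\<And>x. (\<lambda>n. apply_bcontfun (f n) x) \<longlonglongrightarrow> apply_bcontfun g x"
  shows "(\<lambda>n. blinfun_apply (bm_functional \<mu>) (f n)) \<longlonglongrightarrow> blinfun_apply (bm_functional \<mu>) g"
proof -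
  have "(\<lambda>n. LINT x|bm_pos \<nu>. apply_bcontfun (f n) x) \<longlonglongrightarrow> (LINT x|bm_pos \<nu>. apply_bcontfun g x)" for \<nu>
  proof (rule integral_dominated_convergence[where w = "\<lambda>_. C"])
    interpret finite_measure "bm_pos \<nu>" by (rule finite_measure_bm_pos)
    show "integrable (bm_pos \<nu>) (\<lambda>_. C)" by simp
    show "AE x in bm_pos \<nu>. norm (apply_bcontfun (f n) x) \<le> C" for n
      using norm_bounded[of "f n"] bnd[of n] by (intro AE_I2) (rule order_trans)
  qed (use lim integrable_bm_pos in \<open>auto intro: borel_measurable_integrable\<close>)
  then show ?thesis unfolding bm_functional_apply bm_integral_def by (intro tendsto_diff)
qed

section \<open>The variation norm is the dual norm\<close>

text \<open>In a metric space an open set is where the distance to its complement is positive. The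
  whole space is a separate case because \<open>infdist x {} = 0\<close>.\<close>

lemma sets_baire_eq_borel: "sets (baire_algebra :: 'a::metric_space measure) = sets borel"
proof (rule antisym)
  show "sets (baire_algebra :: 'a measure) \<subseteq> sets borel"
    unfolding baire_algebra_def
    by (subst sets_measure_of)
      (auto intro!: sets.sigma_sets_subset[of _ borel, simplified] borel_open open_vimage)
  have "S \<in> sets baire_algebra" if "open S" for S :: "'a set"
  proof (cases "S = UNIV")
    case True
    then show ?thesis using sets.top[of baire_algebra] by simp
  next
    case False
    have "(\<lambda>x. infdist x (- S)) -` {0<..} = S"
      using in_closed_iff_infdist_zero[OF closed_Compl[OF that]] False infdist_nonneg[of _ "- S"]
      by (force simp: less_le)
    moreover have "continuous_on UNIV (\<lambda>x. infdist x (- S))" by (intro continuous_intros)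
    ultimately have "S \<in> {f -` U | (f :: 'a \<Rightarrow> real) U. continuous_on UNIV f \<and> open U}"
      using open_greaterThan by blast
    then show ?thesis unfolding baire_algebra_def by simp
  qed
  then show "sets borel \<subseteq> sets (baire_algebra :: 'a measure)"
    unfolding borel_def
    using sets.sigma_sets_subset[of "{S :: 'a set. open S}" baire_algebra] by (subst sets_measure_of) auto
qed

lemma finite_measure_inner_compact:
  fixes M :: "'a::polish_space measure"
  assumes M: "finite_measure M" "sets M = sets borel" and A: "A \<in> sets borel" and "e > 0"
  obtains K where "compact K" "K \<subseteq> A" "measure M A \<le> measure M K + e"
proof -
  interpret finite_measure M by fact
  have "ennreal (measure M A) = (SUP K\<in>{K. K \<subseteq> A \<and> compact K}. ennreal (measure M K))"
    using inner_regular[OF M(2) _ A] by (simp add: emeasure_eq_measure)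
  note SUP = this
  show thesis
  proof (cases "measure M A \<le> e")
    case True
    then show thesis using that[of "{}"] by simp
  next
    case False
    then have "ennreal (measure M A - e) < ennreal (measure M A)"
      using \<open>e > 0\<close> by (intro ennreal_lessI) auto
    then obtain K where K: "K \<subseteq> A" "compact K" "ennreal (measure M A - e) < ennreal (measure M K)"
      unfolding SUP less_SUP_iff by auto
    then have "measure M A - e < measure M K" by (metis ennreal_leI not_le)
    with K show thesis using that[of K] by simp
  qed
qed

text \<open>One compact set has to serve both Jordan parts, since a single test function is
  integrated against both.\<close>

lemma finite_measures_inner_compact:
  fixes M N :: "'a::polish_space measure"
  assumes M: "finite_measure M" "sets M = sets borel" and N: "finite_measure N" "sets N = sets borel"
    and A: "A \<in> sets borel" and "e > 0"
  obtains K where "compact K" "K \<subseteq> A" "measure M A \<le> measure M K + e" "measure N A \<le> measure N K + e"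
proof -
  interpret M: finite_measure M by fact
  interpret N: finite_measure N by fact
  obtain K where K: "compact K" "K \<subseteq> A" "measure M A \<le> measure M K + e"
    using finite_measure_inner_compact[OF M A \<open>e > 0\<close>] .
  obtain L where L: "compact L" "L \<subseteq> A" "measure N A \<le> measure N L + e"
    using finite_measure_inner_compact[OF N A \<open>e > 0\<close>] .
  have b: "K \<union> L \<in> sets borel" using K L by (intro borel_closed compact_imp_closed compact_Un)
  have "measure M K \<le> measure M (K \<union> L)" "measure N L \<le> measure N (K \<union> L)"
    using b M N by (auto intro!: M.finite_measure_mono N.finite_measure_mono)
  with K L show thesis by (intro that[of "K \<union> L"]) auto
qed

lemma bcontfun_of_continuous:
  fixes f :: "'a::topological_space \<Rightarrow> real"
  assumes "continuous_on UNIV f" "\<And>x. \<bar>f x\<bar> \<le> B"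
  obtains g :: "'a \<Rightarrow>\<^sub>C real" where "apply_bcontfun g = f" "norm g \<le> B"
proof -
  have "apply_bcontfun (Bcontfun f) = f"
    using assms by (intro Bcontfun_inverse bcontfun_normI[of _ B]) auto
  then show thesis using assms(2) by (intro that[of "Bcontfun f"] norm_bound) auto
qed

text \<open>Inside each block a compact set carries all but \<open>d\<close> of both Jordan parts.
  The sign pattern of \<open>\<mu>\<close> is continuous on the finite union of these disjoint
  compact sets, so Tietze's theorem extends it to a test function of norm at most 1. Off the compact
  sets the two differ by at most 2, which costs \<open>2 * card P * d\<close> for each of the two
  parts.\<close>

lemma partition_variation_le:
  fixes \<mu> :: "'a::polish_space baire_measure"
  assumes C: "\<And>f. norm f \<le> 1 \<Longrightarrow> blinfun_apply (bm_functional \<mu>) f \<le> C"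
    and P: "finite P" "P \<subseteq> sets borel" "disjoint P" "\<Union>P = UNIV" and d: "d > 0"
  shows "(\<Sum>A\<in>P. \<bar>bm_value \<mu> A\<bar>) \<le> C + 4 * real (card P) * d"
proof -
  let ?M = "bm_pos \<mu>" and ?N = "bm_pos (- \<mu>)"
  interpret M: finite_measure ?M by (rule finite_measure_bm_pos)
  interpret N: finite_measure ?N by (rule finite_measure_bm_pos)
  have s: "sets ?M = sets borel" "sets ?N = sets borel" by (simp_all add: sets_baire_eq_borel)
  have "\<exists>K. compact K \<and> K \<subseteq> A \<and> measure ?M A \<le> measure ?M K + d \<and> measure ?N A \<le> measure ?N K + d"
    if "A \<in> P" for A
  proof -
    have "A \<in> sets borel" using that P(2) by blast
    from finite_measures_inner_compact[OF finite_measure_bm_pos s(1) finite_measure_bm_pos s(2) this d]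
    show ?thesis by metis
  qed
  then obtain K where K: "\<And>A. A \<in> P \<Longrightarrow> compact (K A)" "\<And>A. A \<in> P \<Longrightarrow> K A \<subseteq> A"
    "\<And>A. A \<in> P \<Longrightarrow> measure ?M A \<le> measure ?M (K A) + d" "\<And>A. A \<in> P \<Longrightarrow> measure ?N A \<le> measure ?N (K A) + d"
    by metis
  define G where "G x = (\<Sum>A\<in>P. sgn (bm_value \<mu> A) * indicator A x)" for x
  have G: "G x = sgn (bm_value \<mu> A)" if "A \<in> P" "x \<in> A" for A x
  proof -
    have "G x = (\<Sum>B\<in>P. if B = A then sgn (bm_value \<mu> A) else 0)"
      unfolding G_def
    proof (rule sum.cong)
      fix B assume "B \<in> P"
      then show "sgn (bm_value \<mu> B) * indicator B x = (if B = A then sgn (bm_value \<mu> A) else 0)"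
        using that P(3) unfolding disjoint_def indicator_def by (cases "B = A") auto
    qed simp
    then show ?thesis using that P(1) by simp
  qed
  have G_le: "\<bar>G x\<bar> \<le> 1" for x
  proof -
    obtain A where "A \<in> P" "x \<in> A" using UnionE[OF eqset_imp_iff[OF P(4), THEN iffD2, OF UNIV_I]] .
    from G[OF this] show ?thesis by (simp add: sgn_real_def)
  qed
  have cl: "closed (K A)" if "A \<in> P" for A using K(1)[OF that] by (rule compact_imp_closed)
  have "continuous_on (\<Union>A\<in>P. K A) G"
  proof (rule continuous_on_closed_Union)
    fix A assume A: "A \<in> P"
    have "continuous_on (K A) (\<lambda>_. sgn (bm_value \<mu> A))" by simp
    then show "continuous_on (K A) G"
      by (rule continuous_on_eq) (use G[OF A] K(2)[OF A] in auto)
  qed (use P cl in auto)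
  note contG = this
  have clK: "closedin (top_of_set UNIV) (\<Union>A\<in>P. K A)" using P cl by (auto intro: closed_UN)
  obtain f where f: "continuous_on UNIV f" "\<And>x. x \<in> (\<Union>A\<in>P. K A) \<Longrightarrow> f x = G x" "\<And>x. norm (f x) \<le> 1"
    by (rule Tietze[OF contG clK, of 1]) (use G_le in auto)
  obtain F :: "'a \<Rightarrow>\<^sub>C real" where F: "apply_bcontfun F = f" "norm F \<le> 1"
    using bcontfun_of_continuous[of f 1] f by auto
  have diff: "\<bar>f x - G x\<bar> \<le> (\<Sum>A\<in>P. 2 * indicator (A - K A) x)" for x
  proof -
    obtain A where A: "A \<in> P" "x \<in> A" using UnionE[OF eqset_imp_iff[OF P(4), THEN iffD2, OF UNIV_I]] .
    have "\<bar>f x - G x\<bar> \<le> 2 * indicator (A - K A) x"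
    proof (cases "x \<in> K A")
      case True
      then show ?thesis using f(2)[of x] A by auto
    next
      case False
      then show ?thesis using f(3)[of x] G_le[of x] A by simp
    qed
    also have "\<dots> \<le> (\<Sum>A\<in>P. 2 * indicator (A - K A) x)"
      using A P by (intro member_le_sum) auto
    finally show ?thesis .
  qed
  have est: "\<bar>(LINT x|M. f x) - (\<Sum>A\<in>P. sgn (bm_value \<mu> A) * measure M A)\<bar> \<le> 2 * real (card P) * d"
    if M: "finite_measure M" "sets M = sets borel" "\<And>A. A \<in> P \<Longrightarrow> measure M A \<le> measure M (K A) + d"
    for M :: "'a measure"
  proof -
    interpret finite_measure M by fact
    have sA: "A \<in> sets M" "K A \<in> sets M" if "A \<in> P" for A
      using that P(2) borel_closed[OF cl[OF that]] M(2) by auto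
    have intf: "integrable M f"
    proof (rule integrable_const_bound)
      show "AE x in M. norm (f x) \<le> 1" using f(3) by simp
      show "f \<in> borel_measurable M"
        unfolding measurable_cong_sets[OF M(2) refl] using f(1) by (rule borel_measurable_continuous_onI)
    qed
    have int: "integrable M (\<lambda>x. c * indicator B x)" if "B \<in> sets M" for B and c :: real
      using that by (intro integrable_mult_right integrable_real_indicator) (auto simp: less_top[symmetric])
    have intG: "integrable M G" unfolding G_def by (intro Bochner_Integration.integrable_sum int sA)
    have "(LINT x|M. G x) = (\<Sum>A\<in>P. (LINT x|M. sgn (bm_value \<mu> A) * indicator A x))"
      unfolding G_def by (intro Bochner_Integration.integral_sum int sA)
    also have "\<dots> = (\<Sum>A\<in>P. sgn (bm_value \<mu> A) * measure M A)"
      using sA by (intro sum.cong) simp_all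
    finally have "\<bar>(LINT x|M. f x) - (\<Sum>A\<in>P. sgn (bm_value \<mu> A) * measure M A)\<bar> = \<bar>LINT x|M. f x - G x\<bar>"
      using intf intG by simp
    also have "\<dots> \<le> (LINT x|M. \<bar>f x - G x\<bar>)" by (rule integral_abs_bound)
    also have "\<dots> \<le> (LINT x|M. (\<Sum>A\<in>P. 2 * indicator (A - K A) x))"
      using intf intG diff sA by (intro integral_mono Bochner_Integration.integrable_sum int) auto
    also have "\<dots> = (\<Sum>A\<in>P. (LINT x|M. 2 * indicator (A - K A) x))"
      by (intro Bochner_Integration.integral_sum int) (use sA in auto)
    also have "\<dots> = (\<Sum>A\<in>P. 2 * measure M (A - K A))"
      using sA by (intro sum.cong) simp_all
    also have "\<dots> \<le> (\<Sum>A\<in>P. 2 * d)"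
    proof (rule sum_mono)
      fix A assume "A \<in> P"
      from M(3)[OF this] sA[OF this] K(2)[OF this]
      show "2 * measure M (A - K A) \<le> 2 * d" by (simp add: finite_measure_Diff)
    qed
    finally show ?thesis by simp
  qed
  \<comment> \<open>Uses \<open>\<bar>r\<bar> = sgn r * r\<close>, with \<open>r\<close> split into
    its Jordan parts.\<close>
  have "(\<Sum>A\<in>P. \<bar>bm_value \<mu> A\<bar>) = (\<Sum>A\<in>P. sgn (bm_value \<mu> A) * measure ?M A) - (\<Sum>A\<in>P. sgn (bm_value \<mu> A) * measure ?N A)"
    unfolding sum_subtractf[symmetric] right_diff_distrib[symmetric]
    using P(2) by (intro sum.cong) (auto simp: bm_value_jordan[symmetric] sets_baire_eq_borel abs_sgn mult.commute)
  also have "\<dots> \<le> ((LINT x|?M. f x) + 2 * real (card P) * d) - ((LINT x|?N. f x) - 2 * real (card P) * d)"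
    using est[OF finite_measure_bm_pos s(1) K(3)] est[OF finite_measure_bm_pos s(2) K(4)] by linarith
  also have "\<dots> = blinfun_apply (bm_functional \<mu>) F + 4 * real (card P) * d"
    by (simp add: bm_functional_apply bm_integral_def F)
  finally show ?thesis using C[OF F(2)] by linarith
qed

lemma norm_baire_measure_le:
  fixes \<mu> :: "'a::polish_space baire_measure"
  assumes C: "\<And>f. norm f \<le> 1 \<Longrightarrow> blinfun_apply (bm_functional \<mu>) f \<le> C"
  shows "norm \<mu> \<le> C"
proof (rule bm_norm_le)
  fix P :: "'a set set" assume P: "finite P" "P \<subseteq> sets baire_algebra" "disjoint P"
  \<comment> \<open>\<open>partition_variation_le\<close> wants a cover of the space; the
    complementary block, possibly empty, can only enlarge the sum. The slack per block is chosen to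
    total \<open>e\<close>.\<close>
  define Q where "Q = insert (UNIV - \<Union>P) P"
  have Q: "finite Q" "Q \<subseteq> sets borel" "disjoint Q" "\<Union>Q = UNIV"
    using P sets.Diff[OF sets.top sets.finite_Union[OF P(1)], of borel]
    by (auto simp: Q_def sets_baire_eq_borel disjoint_def)
  have "(\<Sum>A\<in>P. \<bar>bm_value \<mu> A\<bar>) \<le> (\<Sum>A\<in>Q. \<bar>bm_value \<mu> A\<bar>)"
    using Q by (intro sum_mono2) (auto simp: Q_def)
  also have "\<dots> \<le> C"
  proof (rule field_le_epsilon)
    fix e :: real assume e: "e > 0"
    have "card Q > 0" using Q(1) by (simp add: Q_def card_gt_0_iff)
    then show "(\<Sum>A\<in>Q. \<bar>bm_value \<mu> A\<bar>) \<le> C + e"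
      using partition_variation_le[OF C Q, of "e / (4 * real (card Q))"] e by simp
  qed
  finally show "(\<Sum>A\<in>P. \<bar>bm_value \<mu> A\<bar>) \<le> C" .
qed

lemma norm_bm_functional: "norm (bm_functional \<mu>) = norm \<mu>" for \<mu> :: "'a::polish_space baire_measure"
proof (rule antisym[OF norm_bm_functional_le norm_baire_measure_le])
  fix f :: "'a \<Rightarrow>\<^sub>C real" assume "norm f \<le> 1"
  have "blinfun_apply (bm_functional \<mu>) f \<le> norm (bm_functional \<mu>) * norm f"
    using norm_blinfun[of "bm_functional \<mu>" f] by simp
  also have "\<dots> \<le> norm (bm_functional \<mu>)" using \<open>norm f \<le> 1\<close> by (simp add: mult_left_le)
  finally show "blinfun_apply (bm_functional \<mu>) f \<le> norm (bm_functional \<mu>)" .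
qed

text \<open>Measures can hence be compared through their integrals; this makes the weak topology
  Hausdorff and yields the algebraic identities for \<open>measure_adjoint\<close>.\<close>

lemma inj_bm_functional: "inj (bm_functional :: 'a::polish_space baire_measure \<Rightarrow> _)"
proof (rule injI)
  fix \<mu> \<nu> :: "'a baire_measure" assume "bm_functional \<mu> = bm_functional \<nu>"
  then show "\<mu> = \<nu>" using norm_bm_functional[of "\<mu> - \<nu>"] by (simp add: bm_functional_diff)
qed

section \<open>Weakly null sequences and the compact-open topology\<close>

text \<open>Schur's lemma, with weak convergence tested against indicators only.\<close>

lemma gliding_hump:
  fixes a :: "nat \<Rightarrow> nat \<Rightarrow> real"
  assumes summ: "\<And>A n. summable (\<lambda>j. indicator A j * a n j)"
    and lim: "\<And>A. (\<lambda>n. \<Sum>j. indicator A j * a n j) \<longlonglongrightarrow> 0"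
  shows "(\<lambda>n. a n n) \<longlonglongrightarrow> 0"
proof (rule ccontr)
  \<comment> \<open>Taking for \<open>A\<close> the indices of one sign shows that each row is
    absolutely summable.\<close>
  have abs_summ: "summable (\<lambda>j. \<bar>a n j\<bar>)" for n
  proof -
    have "\<bar>a n j\<bar> = indicator {j. 0 \<le> a n j} j * a n j - indicator {j. a n j < 0} j * a n j" for j
      by (simp add: indicator_def)
    then show ?thesis using summable_diff[OF summ summ] by presburger
  qed
  have col: "(\<lambda>n. a n j) \<longlonglongrightarrow> 0" for j
  proof -
    have "(\<Sum>i. indicator {j} i * a n i) = a n j" for n
      by (subst suminf_finite[of "{j}"]) (auto simp: indicator_def)
    then show ?thesis using lim[of "{j}"] by simp
  qed
  assume "\<not> (\<lambda>n. a n n) \<longlonglongrightarrow> 0"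
  then obtain e where e: "e > 0" and "\<And>N. \<exists>n\<ge>N. \<not> \<bar>a n n\<bar> < e"
    unfolding lim_sequentially dist_real_def by (metis diff_zero)
  then have big: "\<exists>n\<ge>N. e \<le> \<bar>a n n\<bar>" for N using not_less by blast
  \<comment> \<open>The next index \<open>n'\<close> is so large that row \<open>n'\<close> has a
    big diagonal entry but little mass up to column \<open>n\<close>, and row \<open>n\<close>
    little mass from column \<open>n'\<close> on. Along the chosen columns the off-diagonal part of
    a row is then at most \<open>e / 2\<close>, while the diagonal entry has size at least
    \<open>e\<close>.\<close>
  let ?R = "\<lambda>n n'. n < n' \<and> e \<le> \<bar>a n' n'\<bar> \<and> (\<Sum>i\<le>n. \<bar>a n' i\<bar>) \<le> e / 4 \<and> (\<Sum>j. \<bar>a n (j + n')\<bar>) \<le> e / 4"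
  have "\<exists>n'. ?R n n'" for n
  proof -
    have "(\<lambda>n'. \<Sum>i\<le>n. \<bar>a n' i\<bar>) \<longlonglongrightarrow> (\<Sum>i\<le>n. \<bar>0\<bar>)" by (intro tendsto_intros col)
    then have "\<forall>\<^sub>F n' in sequentially. (\<Sum>i\<le>n. \<bar>a n' i\<bar>) < e / 4" using e by (intro order_tendstoD(2)) auto
    then obtain N1 where N1: "\<And>n'. n' \<ge> N1 \<Longrightarrow> (\<Sum>i\<le>n. \<bar>a n' i\<bar>) < e / 4"
      by (auto simp: eventually_sequentially)
    obtain N2 where N2: "\<And>n'. n' \<ge> N2 \<Longrightarrow> norm (\<Sum>j. \<bar>a n (j + n')\<bar>) < e / 4"
      using suminf_exist_split[OF _ abs_summ[of n], of "e / 4"] e by auto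
    obtain n' where n': "n' \<ge> max (Suc n) (max N1 N2)" "e \<le> \<bar>a n' n'\<bar>" using big by blast
    then show ?thesis using N1[of n'] N2[of n'] by (intro exI[of _ n']) auto
  qed
  then obtain s where s: "\<And>l. ?R (s l) (s (Suc l))"
    using dependent_nat_choice[of "\<lambda>_ _. True" "\<lambda>_. ?R"] by auto
  then have mono: "strict_mono s" by (simp add: strict_mono_Suc_iff)
  let ?A = "range s"
  \<comment> \<open>The row is \<open>s (Suc l)\<close> because the bound on the mass to the left
    comes from a predecessor in \<open>s\<close>.\<close>
  have far: "e / 2 \<le> \<bar>\<Sum>j. indicator ?A j * a (s (Suc l)) j\<bar>" for l
  proof -
    define n where "n = s (Suc l)"
    let ?g = "\<lambda>j. indicator (?A - {n}) j * \<bar>a n j\<bar>"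
    have g: "summable ?g"
      by (rule summable_comparison_test'[OF abs_summ[of n], of 0]) (simp add: indicator_def)
    have "(\<Sum>j<s (Suc (Suc l)). ?g j) \<le> (\<Sum>j\<le>s l. \<bar>a n j\<bar>)"
    proof -
      have "(\<Sum>j<s (Suc (Suc l)). ?g j) = (\<Sum>j\<in>{..<s (Suc (Suc l))} \<inter> (?A - {n}). \<bar>a n j\<bar>)"
        by (simp add: sum.inter_restrict indicator_def mult_if_delta if_distrib cong: if_cong)
      also have "\<dots> \<le> (\<Sum>j\<le>s l. \<bar>a n j\<bar>)"
      proof (rule sum_mono2)
        show "{..<s (Suc (Suc l))} \<inter> (?A - {n}) \<subseteq> {..s l}"
          using strict_mono_less[OF mono] strict_mono_less_eq[OF mono] by (auto simp: n_def less_Suc_eq le_less)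
      qed auto
      finally show ?thesis .
    qed
    moreover have "(\<Sum>j. ?g (j + s (Suc (Suc l)))) \<le> (\<Sum>j. \<bar>a n (j + s (Suc (Suc l)))\<bar>)"
      by (intro suminf_le summable_ignore_initial_segment g abs_summ) (simp add: indicator_def)
    ultimately have "(\<Sum>j. ?g j) \<le> e / 4 + e / 4"
      using s[of l] s[of "Suc l"] suminf_split_initial_segment[OF g, of "s (Suc (Suc l))"] unfolding n_def by linarith
    moreover have "(\<Sum>j. indicator ?A j * a n j) = (\<Sum>j. indicator {n} j * a n j) + (\<Sum>j. indicator (?A - {n}) j * a n j)"
      by (subst suminf_add[OF summ summ]) (auto intro!: suminf_cong simp: indicator_def n_def)
    moreover have "(\<Sum>j. indicator {n} j * a n j) = a n n"
      by (subst suminf_finite[of "{n}"]) (auto simp: indicator_def)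
    moreover have "\<bar>\<Sum>j. indicator (?A - {n}) j * a n j\<bar> \<le> (\<Sum>j. ?g j)"
      using summable_rabs[of "\<lambda>j. indicator (?A - {n}) j * a n j"] g by (simp add: abs_mult)
    moreover have "e \<le> \<bar>a n n\<bar>" using s[of l] by (simp add: n_def)
    ultimately show ?thesis unfolding n_def by linarith
  qed
  have "(\<lambda>l. \<Sum>j. indicator ?A j * a (s (Suc l)) j) \<longlonglongrightarrow> 0"
    using LIMSEQ_subseq_LIMSEQ[OF lim[of ?A], of "\<lambda>l. s (Suc l)"] mono
    by (simp add: o_def strict_mono_Suc_iff)
  from LIMSEQ_D[OF this, of "e / 2"] far e show False by (force simp: not_less[symmetric])
qed

text \<open>This is convergence to 0 for \<open>compact_open_topology\<close>, by
  \<open>limitin_compact_open_topology\<close>; written without suprema it also makes sense for the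
  empty set.\<close>

definition compactly_null :: "(nat \<Rightarrow> 'a::topological_space \<Rightarrow>\<^sub>C real) \<Rightarrow> bool" where
  "compactly_null h \<longleftrightarrow> (\<forall>K. compact K \<longrightarrow> uniform_limit K (\<lambda>n. apply_bcontfun (h n)) (\<lambda>_. 0) sequentially)"

lemma compactly_null_tendsto:
  assumes "compactly_null h"
  shows "(\<lambda>n. apply_bcontfun (h n) x) \<longlonglongrightarrow> 0"
proof -
  have "uniform_limit {x} (\<lambda>n. apply_bcontfun (h n)) (\<lambda>_. 0) sequentially"
    using assms compact_sing[of x] unfolding compactly_null_def by blast
  from tendsto_uniform_limitI[OF this, of x] show ?thesis by simp
qed

lemma compactly_null_le:
  assumes "compactly_null h" "\<And>n x. \<bar>apply_bcontfun (g n) x\<bar> \<le> \<bar>apply_bcontfun (h n) x\<bar>"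
  shows "compactly_null g"
  unfolding compactly_null_def uniform_limit_iff
proof (intro allI impI)
  fix K :: "'a set" and e :: real assume "compact K" "e > 0"
  then have "\<forall>\<^sub>F n in sequentially. \<forall>x\<in>K. dist (apply_bcontfun (h n) x) 0 < e"
    using assms(1) unfolding compactly_null_def uniform_limit_iff by blast
  then show "\<forall>\<^sub>F n in sequentially. \<forall>x\<in>K. dist (apply_bcontfun (g n) x) 0 < e"
    by eventually_elim (use assms(2) in \<open>auto intro: order.strict_trans1\<close>)
qed

lemma compactly_null_compose:
  assumes "compactly_null h" "filterlim s sequentially sequentially"
  shows "compactly_null (\<lambda>n. h (s n))"
  unfolding compactly_null_def
proof (intro allI impI)
  fix K :: "'a set" assume "compact K"
  with assms(1) have "uniform_limit K (\<lambda>n. apply_bcontfun (h n)) (\<lambda>_. 0) sequentially"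
    by (simp add: compactly_null_def)
  from filterlim_compose[OF this assms(2)]
  show "uniform_limit K (\<lambda>n. apply_bcontfun (h (s n))) (\<lambda>_. 0) sequentially" .
qed

text \<open>One open set around the limit contains a tail, and finitely many points remain. Such
  sets supply compact sets near a given point without local compactness.\<close>

lemma compact_insert_limit_range:
  fixes f :: "nat \<Rightarrow> 'a::topological_space"
  assumes "f \<longlonglongrightarrow> l"
  shows "compact (insert l (range f))"
proof (rule compactI)
  fix \<C> assume op: "\<forall>U\<in>\<C>. open U" and cov: "insert l (range f) \<subseteq> \<Union>\<C>"
  then obtain U where U: "U \<in> \<C>" "l \<in> U" by blast
  with assms op obtain N where N: "\<And>n. n \<ge> N \<Longrightarrow> f n \<in> U"
    using topological_tendstoD[of f l sequentially U] by (auto simp: eventually_sequentially)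
  have "\<forall>n. \<exists>V\<in>\<C>. f n \<in> V" using cov by blast
  then obtain V where V: "\<And>n. V n \<in> \<C>" "\<And>n. f n \<in> V n" by metis
  have "f n \<in> \<Union>(insert U (V ` {..<N}))" for n
    using N[of n] V(2)[of n] by (cases "n < N") auto
  then have "insert l (range f) \<subseteq> \<Union>(insert U (V ` {..<N}))" using U by blast
  with U V show "\<exists>\<C>'\<subseteq>\<C>. finite \<C>' \<and> insert l (range f) \<subseteq> \<Union>\<C>'"
    by (intro exI[of _ "insert U (V ` {..<N})"]) auto
qed

text \<open>Members far out are small near \<open>x\<close>: otherwise points \<open>y n\<close>
  tending to \<open>x\<close> carry large values of \<open>h (k n)\<close>, and \<open>h\<close>
  would not tend to 0 uniformly on the compact set formed by \<open>x\<close> and the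
  \<open>y n\<close>. The finitely many remaining members are continuous one by one.\<close>

lemma compactly_null_equicontinuous:
  fixes h :: "nat \<Rightarrow> 'a::metric_space \<Rightarrow>\<^sub>C real"
  assumes h: "compactly_null h" and e: "e > 0"
  shows "\<forall>\<^sub>F y in at x. \<forall>k. \<bar>apply_bcontfun (h k) y - apply_bcontfun (h k) x\<bar> < e"
proof -
  have "\<exists>N. \<forall>k\<ge>N. \<forall>y\<in>ball x (1 / Suc N). \<bar>apply_bcontfun (h k) y\<bar> < e / 2"
  proof (rule ccontr)
    assume "\<not> ?thesis"
    then obtain k y where k: "\<And>n. k n \<ge> n" and y: "\<And>n. y n \<in> ball x (1 / Suc n)"
      and big: "\<And>n. e / 2 \<le> \<bar>apply_bcontfun (h (k n)) (y n)\<bar>"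
      unfolding not_ex not_all not_less Bex_def not_imp ball_simps by metis
    have "y \<longlonglongrightarrow> x"
      unfolding tendsto_dist_iff[of y]
      by (rule Lim_null_comparison[OF _ LIMSEQ_inverse_real_of_nat])
        (use y in \<open>auto simp: inverse_eq_divide dist_commute less_imp_le intro!: always_eventually\<close>)
    then have "compact (insert x (range y))" by (rule compact_insert_limit_range)
    then have "\<forall>\<^sub>F n in sequentially. \<forall>z\<in>insert x (range y). dist (apply_bcontfun (h n) z) 0 < e / 2"
      using h half_gt_zero[OF e] unfolding compactly_null_def uniform_limit_iff by blast
    then obtain N where N: "\<And>n z. n \<ge> N \<Longrightarrow> z \<in> insert x (range y) \<Longrightarrow> \<bar>apply_bcontfun (h n) z\<bar> < e / 2"
      unfolding eventually_sequentially dist_real_def diff_zero by blast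
    from N[of "k N" "y N"] k[of N] big[of N] show False by simp
  qed
  then obtain N where N: "\<And>k y. k \<ge> N \<Longrightarrow> y \<in> ball x (1 / Suc N) \<Longrightarrow> \<bar>apply_bcontfun (h k) y\<bar> < e / 2" by blast
  have "\<forall>\<^sub>F y in at x. \<forall>k\<in>{..<N}. \<bar>apply_bcontfun (h k) y - apply_bcontfun (h k) x\<bar> < e"
  proof (intro eventually_ball_finite ballI)
    fix k
    have "(apply_bcontfun (h k) \<longlongrightarrow> apply_bcontfun (h k) x) (at x)"
      using continuous_on_apply_bcontfun[of UNIV "h k"] by (auto simp: continuous_on_def)
    from tendstoD[OF this e] show "\<forall>\<^sub>F y in at x. \<bar>apply_bcontfun (h k) y - apply_bcontfun (h k) x\<bar> < e"
      by (simp add: dist_real_def)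
  qed simp
  moreover have "\<forall>\<^sub>F y in at x. y \<in> ball x (1 / Suc N)"
    by (intro eventually_at_in_open') auto
  ultimately show ?thesis
  proof eventually_elim
    case (elim y)
    show ?case
    proof
      fix k
      show "\<bar>apply_bcontfun (h k) y - apply_bcontfun (h k) x\<bar> < e"
      proof (cases "k < N")
        case False
        then show ?thesis using N[of k y] N[of k x] elim(2) by simp
      qed (use elim(1) in blast)
    qed
  qed
qed

text \<open>A supremum of infinitely many continuous functions is in general only lower
  semicontinuous. Here \<open>compactly_null_equicontinuous\<close> bounds the oscillation of all
  members at once and so makes the tail suprema continuous.\<close>

lemma compactly_null_decreasing_majorant:
  fixes h :: "nat \<Rightarrow> 'a::metric_space \<Rightarrow>\<^sub>C real"
  assumes h: "compactly_null h" and nn: "\<And>n x. 0 \<le> apply_bcontfun (h n) x" and C: "\<And>n. norm (h n) \<le> C"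
  shows "\<exists>H :: nat \<Rightarrow> 'a \<Rightarrow>\<^sub>C real. (\<forall>n. norm (H n) \<le> C) \<and>
    (\<forall>k n x. n \<le> k \<longrightarrow> apply_bcontfun (h k) x \<le> apply_bcontfun (H n) x) \<and>
    (\<forall>n x. 0 \<le> apply_bcontfun (H n) x) \<and>
    (\<forall>m n x. m \<le> n \<longrightarrow> apply_bcontfun (H n) x \<le> apply_bcontfun (H m) x) \<and>
    (\<forall>x. (\<lambda>n. apply_bcontfun (H n) x) \<longlonglongrightarrow> 0)"
proof -
  define S where "S n x = (SUP k\<in>{n..}. apply_bcontfun (h k) x)" for n x
  have hC: "apply_bcontfun (h k) x \<le> C" for k x
    using order_trans[OF norm_bounded[of "h k" x] C[of k]] by simp
  have bdd: "bdd_above ((\<lambda>k. apply_bcontfun (h k) x) ` B)" for x B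
    by (rule bdd_aboveI2[of _ _ C]) (rule hC)
  have up: "apply_bcontfun (h k) x \<le> S n x" if "n \<le> k" for k n x
    unfolding S_def using that by (intro cSUP_upper bdd) simp
  have least: "S n x \<le> u" if "\<And>k. n \<le> k \<Longrightarrow> apply_bcontfun (h k) x \<le> u" for n x u
    unfolding S_def using that by (intro cSUP_least) auto
  have S0: "0 \<le> S n x" for n x using up[of n n x] nn[of n x] by simp
  have "continuous_on UNIV (S n)" for n
    unfolding continuous_on_def
  proof (intro ballI tendstoI)
    fix x and e :: real assume "e > 0"
    from compactly_null_equicontinuous[OF h half_gt_zero[OF this]]
    show "\<forall>\<^sub>F y in at x. dist (S n y) (S n x) < e"
    proof eventually_elim
      case (elim y)
      have "S n y \<le> S n x + e / 2"
      proof (rule least)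
        fix k assume "n \<le> k"
        with up[of n k x] elim[rule_format, of k]
        show "apply_bcontfun (h k) y \<le> S n x + e / 2" by linarith
      qed
      moreover have "S n x \<le> S n y + e / 2"
      proof (rule least)
        fix k assume "n \<le> k"
        with up[of n k y] elim[rule_format, of k]
        show "apply_bcontfun (h k) x \<le> S n y + e / 2" by linarith
      qed
      ultimately show ?case using \<open>e > 0\<close> unfolding dist_real_def by linarith
    qed
  qed
  moreover have "\<bar>S n x\<bar> \<le> C" for n x using S0[of n x] least[OF hC, of n x] by simp
  ultimately have "\<exists>g :: 'a \<Rightarrow>\<^sub>C real. apply_bcontfun g = S n \<and> norm g \<le> C" for n
    using bcontfun_of_continuous[of "S n" C] by metis
  then obtain H :: "nat \<Rightarrow> 'a \<Rightarrow>\<^sub>C real" where H: "\<And>n. apply_bcontfun (H n) = S n" "\<And>n. norm (H n) \<le> C"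
    by metis
  have lim: "(\<lambda>n. S n x) \<longlonglongrightarrow> 0" for x
  proof (rule LIMSEQ_I)
    fix e :: real assume "e > 0"
    then obtain N where N: "\<And>k. k \<ge> N \<Longrightarrow> norm (apply_bcontfun (h k) x - 0) < e / 2"
      using LIMSEQ_D[OF compactly_null_tendsto[OF h, of x], of "e / 2"] by auto
    have "S n x \<le> e / 2" if "n \<ge> N" for n
    proof (rule least)
      fix k assume "n \<le> k"
      then show "apply_bcontfun (h k) x \<le> e / 2" using N[of k] that by simp
    qed
    then have "norm (S n x - 0) < e" if "n \<ge> N" for n
      using S0[of n x] \<open>e > 0\<close> that by fastforce
    then show "\<exists>N. \<forall>n\<ge>N. norm (S n x - 0) < e" by blast
  qed
  have "S n x \<le> S m x" if "m \<le> n" for m n x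
    by (rule least) (use that up in auto)
  with H lim S0 up show ?thesis by (intro exI[of _ H]) simp
qed

lemma apply_bcontfun_sum: "apply_bcontfun (\<Sum>i\<in>I. f i) x = (\<Sum>i\<in>I. apply_bcontfun (f i) x)"
  for f :: "'i \<Rightarrow> 'a::topological_space \<Rightarrow>\<^sub>C real"
  by (induction I rule: infinite_finite_induct) auto

text \<open>
  Let \<open>H\<^sub>n = sup {h\<^sub>k | k \<ge> n}\<close>, which is continuous and decreases to \<open>0\<close>. Along a sparse sequence of
  indices, with consecutive members \<open>m < n\<close>, the functions \<open>max 0 (h\<^sub>m - H\<^sub>n) \<le> H\<^sub>m - H\<^sub>n\<close> have telescoping
  majorants, so that all their subseries are bounded and continuous although their supports may
  overlap. This replaces uniform tightness.
\<close>

lemma weakly_null_compactly_null_nonneg: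
  fixes \<mu> :: "nat \<Rightarrow> 'a::metric_space baire_measure" and h :: "nat \<Rightarrow> 'a \<Rightarrow>\<^sub>C real"
  assumes \<mu>: "\<And>f. (\<lambda>n. blinfun_apply (bm_functional (\<mu> n)) f) \<longlonglongrightarrow> 0"
    and h: "compactly_null h" and nn: "\<And>n x. 0 \<le> apply_bcontfun (h n) x" and C: "\<And>n. norm (h n) \<le> C"
  shows "(\<lambda>n. blinfun_apply (bm_functional (\<mu> n)) (h n)) \<longlonglongrightarrow> 0"
proof (rule ccontr)
  let ?I = "\<lambda>n. blinfun_apply (bm_functional (\<mu> n))"
  assume "\<not> ?thesis"
  then obtain e where e: "e > 0" and "\<And>N. \<exists>n\<ge>N. \<not> \<bar>?I n (h n)\<bar> < e"
    unfolding lim_sequentially dist_real_def diff_zero by blast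
  then have big: "\<exists>n\<ge>N. e \<le> \<bar>?I n (h n)\<bar>" for N using not_less by blast
  obtain H :: "nat \<Rightarrow> 'a \<Rightarrow>\<^sub>C real" where H: "\<forall>n. norm (H n) \<le> C"
    "\<forall>k n x. n \<le> k \<longrightarrow> apply_bcontfun (h k) x \<le> apply_bcontfun (H n) x"
    "\<forall>n x. 0 \<le> apply_bcontfun (H n) x"
    "\<forall>m n x. m \<le> n \<longrightarrow> apply_bcontfun (H n) x \<le> apply_bcontfun (H m) x"
    "\<forall>x. (\<lambda>n. apply_bcontfun (H n) x) \<longlonglongrightarrow> 0"
    using compactly_null_decreasing_majorant[OF h nn C] by (elim exE conjE)
  note HC = H(1)[rule_format] and Hh = H(2)[rule_format] and H0 = H(3)[rule_format]
    and Hdec = H(4)[rule_format] and Hlim = H(5)[rule_format]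
  have "\<exists>g :: 'a \<Rightarrow>\<^sub>C real. apply_bcontfun g = (\<lambda>x. max 0 (apply_bcontfun (h k) x - apply_bcontfun (H n) x)) \<and> norm g \<le> C"
    for k n
  proof -
    have c: "continuous_on UNIV (\<lambda>x. max 0 (apply_bcontfun (h k) x - apply_bcontfun (H n) x))"
      by (intro continuous_intros) auto
    have b: "\<bar>max 0 (apply_bcontfun (h k) x - apply_bcontfun (H n) x)\<bar> \<le> C" for x
      using abs_bcontfun_le[of "h k" x] C[of k] H0[of n x] nn[of k x] by linarith
    show ?thesis by (rule bcontfun_of_continuous[OF c b]) (intro exI conjI)
  qed
  then obtain G :: "nat \<Rightarrow> nat \<Rightarrow> 'a \<Rightarrow>\<^sub>C real" where
    G: "\<And>k n. apply_bcontfun (G k n) = (\<lambda>x. max 0 (apply_bcontfun (h k) x - apply_bcontfun (H n) x))"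
    and GC: "\<And>k n. norm (G k n) \<le> C" by metis
  \<comment> \<open>For fixed \<open>k\<close> the cut disappears as \<open>n\<close> grows, because
    \<open>H n\<close> decreases to 0. So the next index can be taken so large that an integral of
    size at least \<open>e\<close> keeps more than \<open>e / 2\<close>.\<close>
  have "(\<lambda>n. ?I k (G k n)) \<longlonglongrightarrow> ?I k (h k)" for k
  proof (rule bm_functional_dominated_convergence[OF GC])
    fix x
    have "(\<lambda>n. max 0 (apply_bcontfun (h k) x - apply_bcontfun (H n) x)) \<longlonglongrightarrow> max 0 (apply_bcontfun (h k) x - 0)"
      by (intro tendsto_intros Hlim)
    then show "(\<lambda>n. apply_bcontfun (G k n) x) \<longlonglongrightarrow> apply_bcontfun (h k) x" using nn[of k x] by (simp add: G)
  qed
  then have lim: "(\<lambda>n. \<bar>?I k (G k n)\<bar>) \<longlonglongrightarrow> \<bar>?I k (h k)\<bar>" for k by (intro tendsto_rabs)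
  have "\<exists>n. e \<le> \<bar>?I n (h n)\<bar> \<and> k < n \<and> e / 2 < \<bar>?I k (G k n)\<bar>" if "e \<le> \<bar>?I k (h k)\<bar>" for k
  proof -
    have "\<forall>\<^sub>F n in sequentially. e / 2 < \<bar>?I k (G k n)\<bar>"
      using that e by (intro order_tendstoD(1)[OF lim]) linarith
    then obtain N where N: "\<And>n. n \<ge> N \<Longrightarrow> e / 2 < \<bar>?I k (G k n)\<bar>" by (auto simp: eventually_sequentially)
    obtain n where "n \<ge> max N (Suc k)" "e \<le> \<bar>?I n (h n)\<bar>" using big by blast
    with N show ?thesis by (intro exI[of _ n]) simp
  qed
  moreover have "\<exists>n. e \<le> \<bar>?I n (h n)\<bar>" using big by blast
  ultimately obtain s where s: "\<And>j. s j < s (Suc j)" "\<And>j. e / 2 < \<bar>?I (s j) (G (s j) (s (Suc j)))\<bar>"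
    using dependent_nat_choice[of "\<lambda>_ k. e \<le> \<bar>?I k (h k)\<bar>" "\<lambda>_ k n. k < n \<and> e / 2 < \<bar>?I k (G k n)\<bar>"]
    by metis
  have mono: "strict_mono s" using s(1) by (simp add: strict_mono_Suc_iff)
  then have sub: "filterlim s sequentially sequentially" by (rule filterlim_subseq)
  define g where "g j = G (s j) (s (Suc j))" for j
  have g0: "0 \<le> apply_bcontfun (g j) x" for j x by (simp add: g_def G)
  have gH: "apply_bcontfun (g j) x \<le> apply_bcontfun (H (s j)) x - apply_bcontfun (H (s (Suc j))) x" for j x
    using Hh[of "s j" "s j" x] Hdec[of "s j" "s (Suc j)" x] s(1)[of j] by (simp add: g_def G)
  have block: "(\<Sum>j\<in>{m..<n}. apply_bcontfun (g j) x) \<le> apply_bcontfun (H (s m)) x" for m n x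
  proof (cases "m \<le> n")
    case True
    have "(\<Sum>j\<in>{m..<n}. apply_bcontfun (g j) x)
        \<le> (\<Sum>j\<in>{m..<n}. apply_bcontfun (H (s j)) x - apply_bcontfun (H (s (Suc j))) x)"
      by (intro sum_mono gH)
    also have "\<dots> = apply_bcontfun (H (s m)) x - apply_bcontfun (H (s n)) x"
      using sum_Suc_diff'[OF True, of "\<lambda>j. - apply_bcontfun (H (s j)) x"] by simp
    finally show ?thesis using H0[of "s n" x] by simp
  qed (simp add: H0)
  have summ: "summable (\<lambda>j. apply_bcontfun (g j) x)" for x
  proof (rule bounded_imp_summable)
    show "(\<Sum>j\<le>n. apply_bcontfun (g j) x) \<le> apply_bcontfun (H (s 0)) x" for n
      using block[where m = 0 and n = "Suc n"] by (simp only: atLeast0LessThan lessThan_Suc_atMost)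
  qed (rule g0)
  \<comment> \<open>Rows are the measures, columns the bumps \<open>g j\<close>; the diagonal
    entries exceed \<open>e / 2\<close> in size by the choice of \<open>s\<close>. For each set
    \<open>A\<close> of columns the row sum has to be the integral of one function that does not
    depend on the row, so that weak convergence applies to it.\<close>
  let ?a = "\<lambda>n j. ?I (s n) (g j)"
  have "\<exists>F :: 'a \<Rightarrow>\<^sub>C real. \<forall>n. (\<lambda>j. indicator A j * ?a n j) sums ?I (s n) F" for A
  proof -
    let ?f = "\<lambda>j x. indicator A j * apply_bcontfun (g j) x"
    have f0: "0 \<le> ?f j x" for j x using g0 by simp
    have fg: "?f j x \<le> apply_bcontfun (g j) x" for j x using g0 by (simp add: indicator_def)
    have fs: "summable (\<lambda>j. ?f j x)" for x
      by (rule summable_comparison_test'[OF summ[of x], of 0]) (use f0 fg in auto)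
    have part: "(\<Sum>j<m. ?f j x) \<le> apply_bcontfun (H (s 0)) x" for m x
    proof -
      have "(\<Sum>j<m. ?f j x) \<le> (\<Sum>j<m. apply_bcontfun (g j) x)" by (intro sum_mono fg)
      also have "\<dots> \<le> apply_bcontfun (H (s 0)) x" using block[where m = 0 and n = m] by (simp add: lessThan_atLeast0)
      finally show ?thesis .
    qed
    define S where "S x = (\<Sum>j. ?f j x)" for x
    have tail: "0 \<le> S x - (\<Sum>j<m. ?f j x)" "S x - (\<Sum>j<m. ?f j x) \<le> apply_bcontfun (H (s m)) x" for m x
    proof -
      have eq: "S x - (\<Sum>j<m. ?f j x) = (\<Sum>j. ?f (j + m) x)"
        unfolding S_def using suminf_split_initial_segment[OF fs, of x m] by simp
      show "0 \<le> S x - (\<Sum>j<m. ?f j x)"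
        unfolding eq by (intro suminf_nonneg summable_ignore_initial_segment fs f0)
      show "S x - (\<Sum>j<m. ?f j x) \<le> apply_bcontfun (H (s m)) x"
        unfolding eq
      proof (rule suminf_le_const[OF summable_ignore_initial_segment[OF fs]])
        fix n
        have "(\<Sum>j<n. ?f (j + m) x) \<le> (\<Sum>j<n. apply_bcontfun (g (j + m)) x)" by (intro sum_mono fg)
        also have "\<dots> = (\<Sum>j\<in>{m..<n + m}. apply_bcontfun (g j) x)"
          using sum.shift_bounds_nat_ivl[of "\<lambda>j. apply_bcontfun (g j) x" 0 m n] by (simp add: lessThan_atLeast0)
        also have "\<dots> \<le> apply_bcontfun (H (s m)) x" by (rule block)
        finally show "(\<Sum>j<n. ?f (j + m) x) \<le> apply_bcontfun (H (s m)) x" .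
      qed
    qed
    \<comment> \<open>Convergence of the series is locally uniform: its tail from \<open>m\<close>
      on is below \<open>H (s m)\<close>, which is continuous and small at \<open>x\<close> for
      suitable \<open>m\<close>, hence small near \<open>x\<close>.\<close>
    have S: "continuous_on UNIV S"
      unfolding continuous_on_def
    proof (intro ballI tendstoI)
      fix x and r :: real assume r: "r > 0"
      have "(\<lambda>m. apply_bcontfun (H (s m)) x) \<longlonglongrightarrow> 0" by (rule filterlim_compose[OF Hlim sub])
      then have "\<forall>\<^sub>F m in sequentially. apply_bcontfun (H (s m)) x < r / 3"
        by (rule order_tendstoD(2)) (use r in simp)
      then obtain m where m: "apply_bcontfun (H (s m)) x < r / 3"
        using eventually_happens'[OF sequentially_bot] by blast
      have cH: "(apply_bcontfun f \<longlongrightarrow> apply_bcontfun f x) (at x)" for f :: "'a \<Rightarrow>\<^sub>C real"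
        using continuous_on_apply_bcontfun[of UNIV f] by (auto simp: continuous_on_def)
      have "\<forall>\<^sub>F y in at x. apply_bcontfun (H (s m)) y < r / 3" by (rule order_tendstoD(2)[OF cH m])
      moreover have "((\<lambda>y. \<Sum>j<m. ?f j y) \<longlongrightarrow> (\<Sum>j<m. ?f j x)) (at x)"
        by (intro tendsto_intros cH)
      then have "\<forall>\<^sub>F y in at x. dist (\<Sum>j<m. ?f j y) (\<Sum>j<m. ?f j x) < r / 3"
        by (rule tendstoD) (use r in simp)
      ultimately show "\<forall>\<^sub>F y in at x. dist (S y) (S x) < r"
      proof eventually_elim
        case (elim y)
        show ?case
          using elim m tail[of y m] tail[of x m] unfolding dist_real_def by linarith
      qed
    qed
    have SC: "\<bar>S x\<bar> \<le> C" for x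
      using tail[of x 0] abs_bcontfun_le[of "H (s 0)" x] HC[of "s 0"] by simp
    obtain F :: "'a \<Rightarrow>\<^sub>C real" where F: "apply_bcontfun F = S"
      by (rule bcontfun_of_continuous[OF S SC])
    let ?P = "\<lambda>m. \<Sum>j<m. indicator A j *\<^sub>R g j"
    have P: "apply_bcontfun (?P m) x = (\<Sum>j<m. ?f j x)" for m x
      by (simp only: apply_bcontfun_sum scaleR_bcontfun.rep_eq real_scaleR_def)
    have PC: "norm (?P m) \<le> C" for m
    proof (rule norm_bound)
      fix x
      have "0 \<le> (\<Sum>j<m. ?f j x)" by (intro sum_nonneg f0)
      then show "norm (apply_bcontfun (?P m) x) \<le> C"
        unfolding P using part[of x m] abs_bcontfun_le[of "H (s 0)" x] HC[of "s 0"] by simp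
    qed
    have "(\<lambda>m. ?I (s n) (?P m)) \<longlonglongrightarrow> ?I (s n) F" for n
    proof (rule bm_functional_dominated_convergence[OF PC])
      show "(\<lambda>m. apply_bcontfun (?P m) x) \<longlonglongrightarrow> apply_bcontfun F x" for x
        unfolding P F S_def by (rule summable_LIMSEQ[OF fs])
    qed
    then have "(\<lambda>j. indicator A j * ?a n j) sums ?I (s n) F" for n
      unfolding sums_def blinfun.sum_right blinfun.scaleR_right real_scaleR_def .
    then show ?thesis by blast
  qed
  then obtain F :: "nat set \<Rightarrow> 'a \<Rightarrow>\<^sub>C real" where F: "\<And>A n. (\<lambda>j. indicator A j * ?a n j) sums ?I (s n) (F A)"
    by metis
  have "(\<lambda>n. ?a n n) \<longlonglongrightarrow> 0"
  proof (rule gliding_hump[where a = ?a])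
    show "summable (\<lambda>j. indicator A j * ?a n j)" for A n using F by (rule sums_summable)
    show "(\<lambda>n. \<Sum>j. indicator A j * ?a n j) \<longlonglongrightarrow> 0" for A
      unfolding sums_unique[OF F, symmetric] by (rule filterlim_compose[OF \<mu> sub])
  qed
  from LIMSEQ_D[OF this half_gt_zero[OF e]] obtain j where "\<bar>?a j j\<bar> < e / 2" by auto
  with s(2)[of j] show False by (simp add: g_def)
qed

lemma bcontfun_pos_neg_parts:
  fixes h :: "'a::topological_space \<Rightarrow>\<^sub>C real"
  obtains p q :: "'a \<Rightarrow>\<^sub>C real" where "h = p - q"
    "apply_bcontfun p = (\<lambda>x. max 0 (apply_bcontfun h x))" "apply_bcontfun q = (\<lambda>x. max 0 (- apply_bcontfun h x))"
    "norm p \<le> norm h" "norm q \<le> norm h"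
proof -
  have c: "continuous_on UNIV (\<lambda>x. max 0 (apply_bcontfun h x))" "continuous_on UNIV (\<lambda>x. max 0 (- apply_bcontfun h x))"
    by (intro continuous_intros; simp)+
  have b: "\<bar>max 0 (apply_bcontfun h x)\<bar> \<le> norm h" "\<bar>max 0 (- apply_bcontfun h x)\<bar> \<le> norm h" for x
    using abs_bcontfun_le[of h x] by linarith+
  obtain p :: "'a \<Rightarrow>\<^sub>C real" where p: "apply_bcontfun p = (\<lambda>x. max 0 (apply_bcontfun h x))" "norm p \<le> norm h"
    using bcontfun_of_continuous[OF c(1) b(1)] .
  obtain q :: "'a \<Rightarrow>\<^sub>C real" where q: "apply_bcontfun q = (\<lambda>x. max 0 (- apply_bcontfun h x))" "norm q \<le> norm h"
    using bcontfun_of_continuous[OF c(2) b(2)] .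
  have "h = p - q" by (rule bcontfun_eqI) (simp add: p q)
  then show thesis by (rule that[OF _ p(1) q(1) p(2) q(2)])
qed

lemma weakly_null_compactly_null:
  fixes \<mu> :: "nat \<Rightarrow> 'a::metric_space baire_measure" and h :: "nat \<Rightarrow> 'a \<Rightarrow>\<^sub>C real"
  assumes \<mu>: "\<And>f. (\<lambda>n. blinfun_apply (bm_functional (\<mu> n)) f) \<longlonglongrightarrow> 0"
    and h: "compactly_null h" and C: "\<And>n. norm (h n) \<le> C"
  shows "(\<lambda>n. blinfun_apply (bm_functional (\<mu> n)) (h n)) \<longlonglongrightarrow> 0"
proof -
  have "\<exists>p q :: 'a \<Rightarrow>\<^sub>C real. h n = p - q \<and> apply_bcontfun p = (\<lambda>x. max 0 (apply_bcontfun (h n) x)) \<and>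
      apply_bcontfun q = (\<lambda>x. max 0 (- apply_bcontfun (h n) x)) \<and> norm p \<le> norm (h n) \<and> norm q \<le> norm (h n)" for n
    by (rule bcontfun_pos_neg_parts[of "h n"]) blast
  then obtain p q :: "nat \<Rightarrow> 'a \<Rightarrow>\<^sub>C real" where pq: "\<And>n. h n = p n - q n"
    and p: "\<And>n. apply_bcontfun (p n) = (\<lambda>x. max 0 (apply_bcontfun (h n) x))"
    and q: "\<And>n. apply_bcontfun (q n) = (\<lambda>x. max 0 (- apply_bcontfun (h n) x))"
    and nC: "\<And>n. norm (p n) \<le> norm (h n)" "\<And>n. norm (q n) \<le> norm (h n)" by metis
  have "compactly_null p" "compactly_null q" by (rule compactly_null_le[OF h]; simp add: p q)+
  then have "(\<lambda>n. blinfun_apply (bm_functional (\<mu> n)) (p n) - blinfun_apply (bm_functional (\<mu> n)) (q n)) \<longlonglongrightarrow> 0 - 0"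
    using nC C by (intro tendsto_diff weakly_null_compactly_null_nonneg[OF \<mu>])
      (auto simp: p q intro: order_trans)
  then show ?thesis by (simp add: pq blinfun.diff_right)
qed

text \<open>If \<open>\<phi> (h k)\<close> does not tend to 0, pick for each \<open>n\<close> first
  \<open>k n\<close> with \<open>\<mu> n\<close> small but \<open>\<phi>\<close> large on
  \<open>h (k n)\<close>, then \<open>m n\<close> with \<open>\<mu> (m n)\<close> close to
  \<open>\<phi>\<close> there. The differences \<open>\<mu> (m n) - \<mu> n\<close> are weakly null
  and contradict \<open>weakly_null_compactly_null\<close>; two errors of \<open>e / 4\<close> leave
  \<open>e / 2\<close>.\<close>

lemma weak_limit_compactly_null:
  fixes \<mu> :: "nat \<Rightarrow> 'a::metric_space baire_measure" and h :: "nat \<Rightarrow> 'a \<Rightarrow>\<^sub>C real"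
  assumes \<mu>: "\<And>f. (\<lambda>n. blinfun_apply (bm_functional (\<mu> n)) f) \<longlonglongrightarrow> \<phi> f"
    and h: "compactly_null h" and C: "\<And>n. norm (h n) \<le> C"
  shows "(\<lambda>n. \<phi> (h n)) \<longlonglongrightarrow> 0"
proof (rule ccontr)
  let ?I = "\<lambda>n. blinfun_apply (bm_functional (\<mu> n))"
  assume "\<not> ?thesis"
  then obtain e where e: "e > 0" and "\<And>N. \<exists>n\<ge>N. \<not> \<bar>\<phi> (h n)\<bar> < e"
    unfolding lim_sequentially dist_real_def diff_zero by blast
  then have big: "\<exists>n\<ge>N. e \<le> \<bar>\<phi> (h n)\<bar>" for N using not_less by blast
  have "\<exists>k m. n \<le> k \<and> n \<le> m \<and> e / 2 \<le> \<bar>?I m (h k) - ?I n (h k)\<bar>" for n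
  proof -
    have "(\<lambda>k. ?I n (h k)) \<longlonglongrightarrow> ?I n 0"
      by (rule bm_functional_dominated_convergence[OF C]) (use compactly_null_tendsto[OF h] in simp)
    then have "(\<lambda>k. ?I n (h k)) \<longlonglongrightarrow> 0" by (simp add: blinfun.zero_right)
    from LIMSEQ_D[OF this, of "e / 4"] e obtain K where K: "\<And>k. k \<ge> K \<Longrightarrow> \<bar>?I n (h k)\<bar> < e / 4" by auto
    obtain k where k: "k \<ge> max K n" "e \<le> \<bar>\<phi> (h k)\<bar>" using big by blast
    from LIMSEQ_D[OF \<mu>, of "e / 4" "h k"] e obtain M where M: "\<And>m. m \<ge> M \<Longrightarrow> \<bar>?I m (h k) - \<phi> (h k)\<bar> < e / 4" by auto
    have "\<bar>?I (max M n) (h k) - \<phi> (h k)\<bar> < e / 4" "\<bar>?I n (h k)\<bar> < e / 4" using M[of "max M n"] K[of k] k by auto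
    then have "e / 2 \<le> \<bar>?I (max M n) (h k) - ?I n (h k)\<bar>" using k(2) by linarith
    then show ?thesis using k(1) by (intro exI[of _ k] exI[of _ "max M n"]) auto
  qed
  then obtain k m where k: "\<And>n. n \<le> k n" and m: "\<And>n. n \<le> m n"
    and diff: "\<And>n. e / 2 \<le> \<bar>?I (m n) (h (k n)) - ?I n (h (k n))\<bar>" by metis
  have top: "filterlim k sequentially sequentially" "filterlim m sequentially sequentially"
    using k m by (auto intro: filterlim_at_top_mono[OF filterlim_ident])
  have "(\<lambda>n. blinfun_apply (bm_functional (\<mu> (m n) - \<mu> n)) f) \<longlonglongrightarrow> 0" for f
    using tendsto_diff[OF filterlim_compose[OF \<mu>[of f] top(2)] \<mu>[of f]]
    by (simp add: bm_functional_diff blinfun.diff_left)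
  from weakly_null_compactly_null[OF this compactly_null_compose[OF h top(1)] C]
  have "(\<lambda>n. ?I (m n) (h (k n)) - ?I n (h (k n))) \<longlonglongrightarrow> 0"
    by (simp add: bm_functional_diff blinfun.diff_left)
  from LIMSEQ_D[OF this half_gt_zero[OF e]] obtain n where "\<bar>?I (m n) (h (k n)) - ?I n (h (k n))\<bar> < e / 2"
    by auto
  with diff[of n] show False by simp
qed

section \<open>The Riesz representation theorem\<close>

definition pos_bcont :: "('a::topological_space \<Rightarrow> real) set" where
  "pos_bcont = {f. continuous_on UNIV f \<and> (\<forall>x. 0 \<le> f x) \<and> (\<exists>B. \<forall>x. f x \<le> B)}"

lemma pos_bcontI: "continuous_on UNIV f \<Longrightarrow> (\<And>x. 0 \<le> f x) \<Longrightarrow> (\<And>x. f x \<le> B) \<Longrightarrow> f \<in> pos_bcont"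
  by (auto simp: pos_bcont_def)

lemma pos_bcont_continuous: "f \<in> pos_bcont \<Longrightarrow> continuous_on UNIV f"
  and pos_bcont_nonneg: "f \<in> pos_bcont \<Longrightarrow> 0 \<le> f x"
  by (auto simp: pos_bcont_def)

lemma pos_bcont_bounded: "f \<in> pos_bcont \<Longrightarrow> \<exists>B. \<forall>x. f x \<le> B"
  by (auto simp: pos_bcont_def)

lemma pos_bcont_le:
  assumes "g \<in> pos_bcont" "continuous_on UNIV f" "\<And>x. 0 \<le> f x" "\<And>x. f x \<le> g x"
  shows "f \<in> pos_bcont"
proof -
  obtain B where "\<forall>x. g x \<le> B" using pos_bcont_bounded[OF assms(1)] by blast
  then have "f x \<le> B" for x using assms(4)[of x] order_trans by blast
  with assms show ?thesis by (intro pos_bcontI)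
qed

lemma pos_bcont_add:
  assumes "f \<in> pos_bcont" "g \<in> pos_bcont"
  shows "(\<lambda>x. f x + g x) \<in> pos_bcont"
proof -
  obtain B C where "\<forall>x. f x \<le> B" "\<forall>x. g x \<le> C" using assms[THEN pos_bcont_bounded] by blast
  then have "f x + g x \<le> B + C" for x by (simp add: add_mono)
  moreover have "0 \<le> f x + g x" for x using assms[THEN pos_bcont_nonneg, of x] by simp
  moreover have "continuous_on UNIV (\<lambda>x. f x + g x)"
    by (rule continuous_on_add[OF assms[THEN pos_bcont_continuous]])
  ultimately show ?thesis by (intro pos_bcontI)
qed

lemma pos_bcont_scale:
  assumes "f \<in> pos_bcont" "0 \<le> c"
  shows "(\<lambda>x. c * f x) \<in> pos_bcont"
proof -
  obtain B where "\<forall>x. f x \<le> B" using pos_bcont_bounded[OF assms(1)] by blast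
  then show ?thesis
    using assms by (intro pos_bcontI[of _ "c * B"] continuous_intros mult_left_mono mult_nonneg_nonneg)
      (auto simp: pos_bcont_def)
qed

lemma pos_bcont_const: "0 \<le> c \<Longrightarrow> (\<lambda>_. c) \<in> pos_bcont"
  by (rule pos_bcontI[of _ c]) auto

lemma open_eq_positive_set:
  fixes U :: "'a::metric_space set"
  assumes "open U"
  shows "\<exists>d :: 'a \<Rightarrow> real. continuous_on UNIV d \<and> (\<forall>x. 0 \<le> d x) \<and> (\<forall>x. 0 < d x \<longleftrightarrow> x \<in> U)"
proof (cases "U = UNIV")
  case True
  then show ?thesis by (intro exI[of _ "\<lambda>_. 1"]) auto
next
  case False
  have *: "0 < infdist x (- U) \<longleftrightarrow> x \<in> U" for x
    using in_closed_iff_infdist_zero[OF closed_Compl[OF assms], of x] False infdist_nonneg[of x "- U"]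
    by (auto simp: less_le)
  show ?thesis
    by (intro exI[of _ "\<lambda>x. infdist x (- U)"] conjI continuous_intros allI infdist_nonneg *)
qed

text \<open>Daniell's axioms, on the cone alone since the intended instance
  \<open>upper_part\<close> is a supremum that makes sense only there. \<open>J_smooth\<close> takes
  the place of compact support in the Riesz construction.\<close>

locale smooth_positive_functional =
  fixes J :: "('a::metric_space \<Rightarrow> real) \<Rightarrow> real"
  assumes J_add: "\<And>f g. f \<in> pos_bcont \<Longrightarrow> g \<in> pos_bcont \<Longrightarrow> J (\<lambda>x. f x + g x) = J f + J g"
    and J_scale: "\<And>f c. f \<in> pos_bcont \<Longrightarrow> 0 \<le> c \<Longrightarrow> J (\<lambda>x. c * f x) = c * J f"
    and J_nonneg: "\<And>f. f \<in> pos_bcont \<Longrightarrow> 0 \<le> J f"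
    and J_smooth: "\<And>h. (\<And>n. h n \<in> pos_bcont) \<Longrightarrow> (\<And>n x. h (Suc n) x \<le> h n x) \<Longrightarrow>
      (\<And>x. (\<lambda>n::nat. h n x) \<longlonglongrightarrow> 0) \<Longrightarrow> (\<lambda>n. J (h n)) \<longlonglongrightarrow> 0"
begin

lemma J_mono:
  assumes f: "f \<in> pos_bcont" and g: "g \<in> pos_bcont" and le: "\<And>x. f x \<le> g x"
  shows "J f \<le> J g"
proof -
  have "(\<lambda>x. g x - f x) \<in> pos_bcont"
    using f g le pos_bcont_nonneg[OF f]
    by (intro pos_bcont_le[OF g] continuous_on_diff pos_bcont_continuous[OF f] pos_bcont_continuous[OF g]) auto
  then show ?thesis using J_add[OF f, of "\<lambda>x. g x - f x"] J_nonneg[of "\<lambda>x. g x - f x"] by simp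
qed

lemma J_zero: "J (\<lambda>_. 0) = 0"
  using J_scale[OF pos_bcont_const[of 0], of 0] by simp

lemma J_sum:
  assumes "finite I" "\<And>i. i \<in> I \<Longrightarrow> f i \<in> pos_bcont"
  shows "(\<lambda>x. \<Sum>i\<in>I. f i x) \<in> pos_bcont \<and> J (\<lambda>x. \<Sum>i\<in>I. f i x) = (\<Sum>i\<in>I. J (f i))"
  using assms
proof (induction I rule: finite_induct)
  case empty
  then show ?case by (simp add: J_zero pos_bcont_const)
next
  case (insert i I)
  then show ?case using J_add[of "f i" "\<lambda>x. \<Sum>i\<in>I. f i x"] by (simp add: pos_bcont_add)
qed

text \<open>The Riesz content, with test functions that need neither compact support nor a support
  inside \<open>U\<close>.\<close>

definition inner_content :: "'a set \<Rightarrow> ennreal" where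
  "inner_content U = (SUP f\<in>{f \<in> pos_bcont. \<forall>x. f x \<le> indicator U x}. ennreal (J f))"

lemma inner_content_upper: "f \<in> pos_bcont \<Longrightarrow> (\<And>x. f x \<le> indicator U x) \<Longrightarrow> ennreal (J f) \<le> inner_content U"
  unfolding inner_content_def by (intro SUP_upper) auto

lemma inner_content_least:
  "(\<And>f. f \<in> pos_bcont \<Longrightarrow> (\<And>x. f x \<le> indicator U x) \<Longrightarrow> ennreal (J f) \<le> c) \<Longrightarrow> inner_content U \<le> c"
  unfolding inner_content_def by (intro SUP_least) auto

lemma inner_content_mono: "U \<subseteq> V \<Longrightarrow> inner_content U \<le> inner_content V"
  by (intro inner_content_least inner_content_upper) (assumption, rule order_trans, assumption, auto simp: indicator_def)

lemma inner_content_empty: "inner_content {} = 0"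
proof -
  have "ennreal (J f) \<le> 0" if "f \<in> pos_bcont" "\<And>x. f x \<le> indicator {} x" for f
    using J_mono[OF that(1) pos_bcont_const[of 0]] that(2) by (simp add: J_zero ennreal_neg)
  then show ?thesis using inner_content_least[of "{}" 0] by simp
qed

lemma inner_content_finite: "inner_content U < \<infinity>"
proof -
  have "ennreal (J f) \<le> ennreal (J (\<lambda>_. 1))" if "f \<in> pos_bcont" "\<And>x. f x \<le> indicator U x" for f
  proof (intro ennreal_leI J_mono that(1) pos_bcont_const)
    show "f x \<le> 1" for x using that(2)[of x] by (cases "x \<in> U") auto
  qed simp
  then have "inner_content U \<le> ennreal (J (\<lambda>_. 1))" by (rule inner_content_least)
  then show ?thesis using ennreal_less_top order.strict_trans1 by fastforce
qed

text \<open>The functions \<open>p n\<close> increase to 1 on the union, and \<open>f\<close>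
  vanishes outside it, so \<open>J_smooth\<close> disposes of the product of \<open>f\<close> with
  \<open>1 - p n\<close>. As \<open>min 1\<close> is subadditive, the product of \<open>f\<close>
  with \<open>p n\<close> lies below a finite sum of functions, each admissible for its own
  \<open>U i\<close>.\<close>

lemma inner_content_subadditive:
  assumes U: "\<And>i::nat. open (U i)"
  shows "inner_content (\<Union>i. U i) \<le> (\<Sum>i. inner_content (U i))"
proof (rule inner_content_least)
  fix f assume f: "f \<in> pos_bcont" and fU: "\<And>x. f x \<le> indicator (\<Union>i. U i) x"
  obtain d :: "nat \<Rightarrow> 'a \<Rightarrow> real" where d: "\<And>i. continuous_on UNIV (d i)" "\<And>i x. 0 \<le> d i x"
    "\<And>i x. 0 < d i x \<longleftrightarrow> x \<in> U i"
    using open_eq_positive_set[OF U] by metis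
  \<comment> \<open>At a point of the union some \<open>d i\<close> is positive but possibly small;
    the factor \<open>n\<close> makes the sum reach 1 eventually.\<close>
  define p where "p n x = min 1 (\<Sum>i<n. real n * d i x)" for n :: nat and x
  have p: "0 \<le> p n x" "p n x \<le> 1" for n x using d(2) by (auto simp: p_def intro: sum_nonneg)
  have pc: "continuous_on UNIV (p n)" for n unfolding p_def by (intro continuous_intros d(1))
  note f0 = pos_bcont_nonneg[OF f] and fc = pos_bcont_continuous[OF f]
  have part1: "(\<lambda>x. f x * p n x) \<in> pos_bcont" for n
    using p f0 by (intro pos_bcont_le[OF f] continuous_intros fc pc) (auto simp: mult_left_le)
  have part2: "(\<lambda>x. f x * (1 - p n x)) \<in> pos_bcont" for n
    using p f0 by (intro pos_bcont_le[OF f] continuous_intros fc pc) (auto simp: mult_left_le)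
  have split: "J f = J (\<lambda>x. f x * p n x) + J (\<lambda>x. f x * (1 - p n x))" for n
    using J_add[OF part1 part2, of n n] by (simp add: algebra_simps)
  have "(\<lambda>n. J (\<lambda>x. f x * (1 - p n x))) \<longlonglongrightarrow> 0"
  proof (rule J_smooth[OF part2])
    fix n x
    have "(\<Sum>i<n. real n * d i x) \<le> (\<Sum>i<Suc n. real (Suc n) * d i x)"
      using d(2) by (intro order_trans[OF sum_mono sum_mono2]) (auto intro!: mult_right_mono)
    then have "p n x \<le> p (Suc n) x" by (simp add: p_def min_le_iff_disj del: sum.lessThan_Suc)
    then show "f x * (1 - p (Suc n) x) \<le> f x * (1 - p n x)" using f0 by (intro mult_left_mono) auto
  next
    fix x
    show "(\<lambda>n. f x * (1 - p n x)) \<longlonglongrightarrow> 0"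
    proof (cases "x \<in> (\<Union>i. U i)")
      case False
      then have "f x = 0" using fU[of x] f0[of x] by simp
      then show ?thesis by simp
    next
      case True
      then obtain i where i: "0 < d i x" using d(3) by auto
      obtain N where N: "1 / d i x < real N" using reals_Archimedean2 by blast
      have "p n x = 1" if "n \<ge> max (Suc i) N" for n
      proof -
        have "1 \<le> real N * d i x" using N i by (simp add: field_simps)
        also have "\<dots> \<le> real n * d i x" using that i by (intro mult_right_mono) auto
        also have "\<dots> \<le> (\<Sum>i<n. real n * d i x)"
          using that d(2) by (intro member_le_sum) auto
        finally show ?thesis by (simp add: p_def)
      qed
      then have "\<forall>\<^sub>F n in sequentially. f x * (1 - p n x) = 0"
        unfolding eventually_sequentially by (intro exI[of _ "max (Suc i) N"]) simp
      then show ?thesis by (rule tendsto_eventually)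
    qed
  qed
  moreover have "ennreal (J f) \<le> (\<Sum>i. inner_content (U i)) + ennreal (J (\<lambda>x. f x * (1 - p n x)))" for n
  proof -
    let ?q = "\<lambda>i x. f x * min 1 (real n * d i x)"
    have q: "?q i \<in> pos_bcont" for i
      using d f0 by (intro pos_bcont_le[OF f] continuous_intros fc) (auto simp: mult_left_le)
    have min_sum: "min 1 (\<Sum>i<k. a i) \<le> (\<Sum>i<k. min 1 (a i))" if "\<And>i. 0 \<le> a i" for k and a :: "nat \<Rightarrow> real"
    proof (induction k)
      case (Suc k)
      have "min 1 (A + a k) \<le> min 1 A + min 1 (a k)" if "0 \<le> A" for A
        using that \<open>\<And>i. 0 \<le> a i\<close>[of k] by (auto simp: min_def)
      from this[of "\<Sum>i<k. a i"] Suc that show ?case by (simp add: sum_nonneg)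
    qed simp
    have "J (\<lambda>x. f x * p n x) \<le> J (\<lambda>x. \<Sum>i<n. ?q i x)"
    proof (rule J_mono)
      show "(\<lambda>x. f x * p n x) \<in> pos_bcont" by (rule part1)
      show "(\<lambda>x. \<Sum>i<n. ?q i x) \<in> pos_bcont" using J_sum[of "{..<n}" ?q] q by auto
      show "f x * p n x \<le> (\<Sum>i<n. ?q i x)" for x
        unfolding p_def sum_distrib_left[of "f x", symmetric]
        using f0 d(2) by (intro mult_left_mono min_sum[of "\<lambda>i. real n * d i x" n]) auto
    qed
    also have "\<dots> = (\<Sum>i<n. J (?q i))" using J_sum[of "{..<n}" ?q] q by auto
    finally have "ennreal (J (\<lambda>x. f x * p n x)) \<le> ennreal (\<Sum>i<n. J (?q i))" by (rule ennreal_leI)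
    also have "\<dots> = (\<Sum>i<n. ennreal (J (?q i)))" using J_nonneg[OF q] by simp
    also have "\<dots> \<le> (\<Sum>i<n. inner_content (U i))"
    proof (intro sum_mono inner_content_upper q)
      fix i x
      have "f x \<le> 1" using fU[of x] by (cases "x \<in> (\<Union>i. U i)") auto
      moreover have "d i x = 0" if "x \<notin> U i" using d(2)[of i x] d(3)[of i x] that by linarith
      ultimately show "?q i x \<le> indicator (U i) x"
        using f0[of x] d(2)[of i x] by (cases "x \<in> U i") (auto simp: mult_le_one)
    qed
    also have "\<dots> \<le> (\<Sum>i. inner_content (U i))" by (intro sum_le_suminf) auto
    finally have "ennreal (J (\<lambda>x. f x * p n x)) \<le> (\<Sum>i. inner_content (U i))" .
    then show ?thesis
      unfolding split[of n] using J_nonneg[OF part1] J_nonneg[OF part2] by (simp add: add_right_mono)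
  qed
  ultimately have "ennreal (J f) \<le> (\<Sum>i. inner_content (U i)) + ennreal 0"
    by (intro tendsto_lowerbound[OF tendsto_add[OF tendsto_const tendsto_ennrealI]]) auto
  then show "ennreal (J f) \<le> (\<Sum>i. inner_content (U i))" by simp
qed

section \<open>Caratheodory's construction for the outer content\<close>

definition outer_content :: "'a set \<Rightarrow> ennreal" where
  "outer_content A = (INF U\<in>{U. open U \<and> A \<subseteq> U}. inner_content U)"

lemma outer_content_lower: "open U \<Longrightarrow> A \<subseteq> U \<Longrightarrow> outer_content A \<le> inner_content U"
  unfolding outer_content_def by (intro INF_lower) auto

lemma outer_content_open: "open U \<Longrightarrow> outer_content U = inner_content U"
  by (intro antisym outer_content_lower) (auto simp: outer_content_def intro!: INF_greatest inner_content_mono)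

lemma outer_content_mono: "A \<subseteq> B \<Longrightarrow> outer_content A \<le> outer_content B"
  unfolding outer_content_def by (intro INF_superset_mono) auto

lemma outer_measure_space_outer_content: "outer_measure_space UNIV outer_content"
  unfolding outer_measure_space_def
proof (intro conjI)
  show "positive UNIV outer_content"
    by (simp add: positive_def outer_content_open inner_content_empty)
  show "increasing UNIV outer_content"
    by (simp add: increasing_def outer_content_mono)
  show "countably_subadditive UNIV outer_content"
    unfolding countably_subadditive_def
  proof (intro allI impI)
    fix A :: "nat \<Rightarrow> 'a set"
    show "outer_content (\<Union>i. A i) \<le> (\<Sum>i. outer_content (A i))"
    proof (rule ennreal_le_epsilon)
      fix e :: real assume e: "0 < e" and fin: "(\<Sum>i. outer_content (A i)) < top"
      have "\<exists>U. open U \<and> A i \<subseteq> U \<and> inner_content U \<le> outer_content (A i) + ennreal (e * (1/2) ^ Suc i)" for i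
      proof -
        have "outer_content (A i) < top" using fin by (rule ennreal_suminf_lessD)
        then have "outer_content (A i) < outer_content (A i) + ennreal (e * (1/2) ^ Suc i)"
          using e by (auto simp: less_top)
        then obtain U where "open U" "A i \<subseteq> U" "inner_content U < outer_content (A i) + ennreal (e * (1/2) ^ Suc i)"
          unfolding outer_content_def[of "A i"] INF_less_iff by blast
        then show ?thesis by (intro exI[of _ U]) (auto intro: less_imp_le)
      qed
      then obtain U where U: "\<And>i. open (U i)" "\<And>i. A i \<subseteq> U i"
        "\<And>i. inner_content (U i) \<le> outer_content (A i) + ennreal (e * (1/2) ^ Suc i)" by metis
      have "outer_content (\<Union>i. A i) \<le> inner_content (\<Union>i. U i)" using U by (intro outer_content_lower) auto
      also have "\<dots> \<le> (\<Sum>i. inner_content (U i))" by (rule inner_content_subadditive[OF U(1)])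
      also have "\<dots> \<le> (\<Sum>i. outer_content (A i) + ennreal (e * (1/2) ^ Suc i))"
        using U(3) by (intro suminf_le) auto
      also have "\<dots> = (\<Sum>i. outer_content (A i)) + (\<Sum>i. ennreal (e * (1/2) ^ Suc i))"
        by (intro suminf_add[symmetric]) auto
      also have "(\<Sum>i. ennreal (e * (1/2) ^ Suc i)) = ennreal e"
        using e sums_mult[OF power_half_series, of e] by (intro suminf_ennreal_eq) auto
      finally show "outer_content (\<Union>i. A i) \<le> (\<Sum>i. outer_content (A i)) + ennreal e" .
    qed
  qed
qed

text \<open>As \<open>f\<close> vanishes off \<open>V\<close>, the set \<open>A - V\<close> is
  caught in the open set \<open>W\<close> where \<open>f\<close> is below \<open>d\<close>; the
  complement of the closed support of \<open>f\<close> could miss points of \<open>A - V\<close>. If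
  \<open>g\<close> is admissible for \<open>W\<close>, then \<open>f + g\<close> is at most
  \<open>1 + d\<close> on \<open>U\<close> and 0 elsewhere: where \<open>f\<close> reaches
  \<open>d\<close>, \<open>g\<close> vanishes. So \<open>J f + J g\<close> is at most
  \<open>1 + d\<close> times the content of \<open>U\<close>.\<close>

lemma outer_content_split_open:
  assumes V: "open V"
  shows "outer_content (V \<inter> A) + outer_content (A - V) \<le> outer_content A"
  unfolding outer_content_def[of A]
proof (rule INF_greatest)
  fix U assume "U \<in> {U. open U \<and> A \<subseteq> U}"
  then have U: "open U" "A \<subseteq> U" by auto
  obtain M where M: "inner_content U = ennreal M" "0 \<le> M"
    using inner_content_finite[of U] by (cases "inner_content U") auto
  have main: "ennreal (J f) + outer_content (A - V) \<le> ennreal M"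
    if f: "f \<in> pos_bcont" and fUV: "\<And>x. f x \<le> indicator (U \<inter> V) x" for f
  proof (rule ennreal_le_epsilon)
    fix e :: real assume e: "0 < e"
    \<comment> \<open>Chosen so that the surplus \<open>d * M\<close> is at most \<open>e\<close>;
      the added 1 covers \<open>M = 0\<close>.\<close>
    define d where "d = e / (M + 1)"
    have d: "d > 0" "d * M \<le> e" using e M(2) by (auto simp: d_def field_simps)
    define W where "W = U \<inter> {x. f x < d}"
    have "open W"
      unfolding W_def using U(1) pos_bcont_continuous[OF f] by (intro open_Int open_Collect_less) auto
    moreover have "A - V \<subseteq> W"
    proof
      fix x assume x: "x \<in> A - V"
      then have "f x \<le> 0" using fUV[of x] by simp
      with x U(2) d(1) show "x \<in> W" by (auto simp: W_def)
    qed
    ultimately have "outer_content (A - V) \<le> inner_content W" by (rule outer_content_lower)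
    also have "\<dots> \<le> ennreal ((1 + d) * M - J f)"
    proof (rule inner_content_least)
      fix g assume g: "g \<in> pos_bcont" and gW: "\<And>x. g x \<le> indicator W x"
      have fg: "(\<lambda>x. f x + g x) \<in> pos_bcont" by (rule pos_bcont_add[OF f g])
      have "ennreal (J (\<lambda>x. inverse (1 + d) * (f x + g x))) \<le> inner_content U"
      proof (intro inner_content_upper pos_bcont_scale fg)
        fix x
        have "f x + g x \<le> (1 + d) * indicator U x"
          using fUV[of x] gW[of x] d(1)
          by (cases "x \<in> U"; cases "x \<in> V"; cases "f x < d") (auto simp: W_def)
        then show "inverse (1 + d) * (f x + g x) \<le> indicator U x"
          using d(1) by (simp add: inverse_eq_divide pos_divide_le_eq mult.commute)
      qed (use d in simp)
      then have "inverse (1 + d) * (J f + J g) \<le> M"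
        using J_scale[OF fg, of "inverse (1 + d)"] J_add[OF f g] d M by (simp add: ennreal_le_iff)
      then have "J f + J g \<le> (1 + d) * M"
        using d(1) by (simp add: inverse_eq_divide pos_divide_le_eq mult.commute)
      then show "ennreal (J g) \<le> ennreal ((1 + d) * M - J f)" by (intro ennreal_leI) simp
    qed
    finally have "ennreal (J f) + outer_content (A - V) \<le> ennreal (J f) + ennreal ((1 + d) * M - J f)"
      by (rule add_left_mono)
    also have "\<dots> = ennreal ((1 + d) * M)"
    proof (subst ennreal_plus[symmetric])
      have "ennreal (J f) \<le> ennreal M"
        using inner_content_upper[OF f, of U] order_trans[OF fUV] M(1) by (auto simp: indicator_def)
      then have "J f \<le> M" using M(2) by (simp add: ennreal_le_iff)
      moreover have "0 \<le> d * M" using d(1) M(2) by simp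
      ultimately show "0 \<le> (1 + d) * M - J f" by (simp add: algebra_simps)
    qed (use J_nonneg[OF f] in auto)
    also have "\<dots> \<le> ennreal (M + e)" using d by (intro ennreal_leI) (simp add: algebra_simps)
    also have "\<dots> = ennreal M + ennreal e" using M e by (intro ennreal_plus) auto
    finally show "ennreal (J f) + outer_content (A - V) \<le> ennreal M + ennreal e" .
  qed
  have "outer_content (V \<inter> A) \<le> inner_content (U \<inter> V)"
    using U V by (intro outer_content_lower) auto
  then have "outer_content (V \<inter> A) + outer_content (A - V) \<le> inner_content (U \<inter> V) + outer_content (A - V)"
    by (rule add_right_mono)
  also have "\<dots> = (SUP f\<in>{f \<in> pos_bcont. \<forall>x. f x \<le> indicator (U \<inter> V) x}. ennreal (J f) + outer_content (A - V))"
    unfolding inner_content_def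
    by (rule ennreal_SUP_add_left[symmetric]) (auto intro!: exI[of _ "\<lambda>_. 0"] pos_bcont_const)
  also have "\<dots> \<le> ennreal M" using main by (intro SUP_least) auto
  finally show "outer_content (V \<inter> A) + outer_content (A - V) \<le> inner_content U" by (simp add: M)
qed

definition riesz_measure :: "'a measure" where
  "riesz_measure = measure_of UNIV (sets borel) outer_content"

lemma sets_riesz_measure: "sets riesz_measure = sets borel"
  unfolding riesz_measure_def using sets.sets_measure_of_eq[of "borel :: 'a measure"] by simp

lemma space_riesz_measure: "space riesz_measure = UNIV"
  using sets_eq_imp_space_eq[OF sets_riesz_measure] by simp

text \<open>Open sets satisfy Caratheodory's criterion, by \<open>outer_content_split_open\<close>
  and finite subadditivity, so the sigma-algebra of sets satisfying it contains the Borel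
  sets.\<close>

lemma emeasure_riesz_measure:
  assumes "A \<in> sets borel"
  shows "emeasure riesz_measure A = outer_content A"
proof -
  interpret sigma_algebra "UNIV :: 'a set" UNIV using sigma_algebra_Pow[of "UNIV :: 'a set"] by simp
  let ?L = "lambda_system UNIV UNIV outer_content"
  have L: "measure_space UNIV ?L outer_content"
    by (rule caratheodory_lemma[OF outer_measure_space_outer_content])
  then have sL: "sigma_algebra UNIV ?L" by (simp add: measure_space_def)
  have "V \<in> ?L" if "open V" for V
  proof -
    have "outer_content A \<le> outer_content (V \<inter> A) + outer_content (A - V)" for A
    proof -
      have "subadditive UNIV outer_content"
        using outer_measure_space_outer_content unfolding outer_measure_space_def
        by (intro countably_subadditive_subadditive) auto
      moreover have "(V \<inter> A) \<inter> (A - V) = {}" "(V \<inter> A) \<union> (A - V) = A" by auto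
      ultimately show ?thesis using subadditiveD[of UNIV outer_content "V \<inter> A" "A - V"] by simp
    qed
    then have "outer_content (V \<inter> A) + outer_content ((UNIV - V) \<inter> A) = outer_content A" for A
      using outer_content_split_open[OF that, of A] by (intro antisym) (auto simp: Diff_eq Int_commute)
    then show ?thesis by (simp add: lambda_system_def)
  qed
  then have "sets borel \<subseteq> ?L"
    unfolding borel_def using sigma_algebra.sigma_sets_subset[OF sL, of "{S. open S}"]
    by (subst sets_measure_of) auto
  then have ms: "measure_space UNIV (sets borel) outer_content"
    using measure_down[OF L] sets.sigma_algebra_axioms[of "borel :: 'a measure"] by simp
  show ?thesis
    unfolding riesz_measure_def
    by (rule emeasure_measure_of_sigma) (use ms assms in \<open>auto simp: measure_space_def\<close>)
qed

lemma finite_measure_riesz_measure: "finite_measure riesz_measure"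
proof
  have "emeasure riesz_measure UNIV = inner_content UNIV"
    by (simp add: emeasure_riesz_measure outer_content_open)
  then show "emeasure riesz_measure (space riesz_measure) \<noteq> \<infinity>"
    using inner_content_finite[of UNIV] by (simp add: space_riesz_measure)
qed

lemma riesz_measure_open: "open U \<Longrightarrow> ennreal (measure riesz_measure U) = inner_content U"
  using finite_measure.emeasure_eq_measure[OF finite_measure_riesz_measure, of U]
  by (simp add: emeasure_riesz_measure outer_content_open)

end

context smooth_positive_functional
begin

text \<open>
  Cutting \<open>f\<close> into slices \<open>g\<^sub>i\<close> of height \<open>1/n\<close>, both \<open>n J(g\<^sub>i)\<close> and \<open>n \<integral>g\<^sub>i\<close> lie between the measures of
  \<open>{f > (i+1)/n}\<close> and \<open>{f > i/n}\<close>.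
\<close>

lemma riesz_measure_integral_aux:
  fixes n :: nat
  assumes f: "f \<in> pos_bcont" and f1: "\<And>x. f x \<le> 1" and n: "n > 0"
  shows "\<bar>J f - (LINT x|riesz_measure. f x)\<bar> \<le> measure riesz_measure UNIV / n"
proof -
  interpret finite_measure riesz_measure by (rule finite_measure_riesz_measure)
  define M where "M i = measure riesz_measure {x. real i / n < f x}" for i
  define g where "g i x = min (f x) (real (Suc i) / n) - min (f x) (real i / n)" for i x
  note f0 = pos_bcont_nonneg[OF f] and fc = pos_bcont_continuous[OF f]
  have op: "open {x. real i / n < f x}" for i by (intro open_Collect_less fc) auto
  have step: "real (Suc i) / n = real i / n + 1 / n" for i by (simp add: add_divide_distrib)
  have np: "0 < 1 / real n" using n by simp
  have gb: "0 \<le> g i x" "g i x \<le> 1 / n" for i x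
    unfolding g_def step using np by linarith+
  have g_upper: "n * g i x \<le> indicator {x. real i / n < f x} x" for i x
  proof (cases "real i / n < f x")
    case True
    then show ?thesis using gb(2)[of i x] n by (simp add: field_simps)
  next
    case False
    then have "g i x = 0" unfolding g_def step using np by linarith
    then show ?thesis by simp
  qed
  have g_lower: "indicator {x. real (Suc i) / n < f x} x \<le> n * g i x" for i x
  proof (cases "real (Suc i) / n < f x")
    case True
    then have "g i x = 1 / n" unfolding g_def step using np by linarith
    then show ?thesis using n by (simp add: indicator_def)
  next
    case False
    then show ?thesis using gb(1)[of i x] n by simp
  qed
  have g: "g i \<in> pos_bcont" for i
    using gb unfolding g_def by (intro pos_bcontI[of _ "1 / n"] continuous_intros fc) auto
  have ng: "(\<lambda>x. n * g i x) \<in> pos_bcont" for i by (rule pos_bcont_scale[OF g]) simp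
  have sum_g: "(\<Sum>i<n. g i x) = f x" for x
  proof -
    have "(\<Sum>i<n. g i x) = min (f x) (real n / n) - min (f x) (real 0 / n)"
      unfolding g_def by (rule sum_lessThan_telescope)
    then show ?thesis using f0[of x] f1[of x] n by (simp add: min_def)
  qed
  have Ju: "n * J (g i) \<le> M i" for i
  proof -
    have "ennreal (J (\<lambda>x. n * g i x)) \<le> ennreal (M i)"
      unfolding M_def riesz_measure_open[OF op] by (rule inner_content_upper[OF ng g_upper])
    then show ?thesis using J_scale[OF g, of n i] by (simp add: M_def ennreal_le_iff)
  qed
  have Jl: "M (Suc i) \<le> n * J (g i)" for i
  proof -
    have "ennreal (M (Suc i)) \<le> ennreal (J (\<lambda>x. n * g i x))"
      unfolding M_def riesz_measure_open[OF op]
      by (rule inner_content_least) (intro ennreal_leI J_mono ng order_trans[OF _ g_lower])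
    then show ?thesis using J_scale[OF g, of n i] J_nonneg[OF g, of i] by (simp add: ennreal_le_iff)
  qed
  have intg: "integrable riesz_measure (g i)" for i
  proof (rule integrable_const_bound)
    show "AE x in riesz_measure. norm (g i x) \<le> 1 / n" using gb by simp
    show "g i \<in> borel_measurable riesz_measure"
      unfolding measurable_cong_sets[OF sets_riesz_measure refl]
      using pos_bcont_continuous[OF g] by (rule borel_measurable_continuous_onI)
  qed
  have int_ind: "integrable riesz_measure (indicator {x. real i / n < f x} :: 'a \<Rightarrow> real)" for i
    using op by (intro integrable_real_indicator) (auto simp: sets_riesz_measure less_top[symmetric])
  have M_int: "(LINT x|riesz_measure. indicator {x. real i / n < f x} x) = M i" for i
    using op by (simp add: M_def sets_riesz_measure)
  have Iu: "n * (LINT x|riesz_measure. g i x) \<le> M i" for i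
    using integral_mono[OF integrable_mult_right[OF intg] int_ind g_upper]
    unfolding M_int integral_mult_right_zero .
  have Il: "M (Suc i) \<le> n * (LINT x|riesz_measure. g i x)" for i
    using integral_mono[OF int_ind integrable_mult_right[OF intg] g_lower]
    unfolding M_int integral_mult_right_zero .
  have "J f = (\<Sum>i<n. J (g i))" using J_sum[of "{..<n}" g] g by (simp add: sum_g)
  moreover have "(LINT x|riesz_measure. f x) = (\<Sum>i<n. LINT x|riesz_measure. g i x)"
    by (subst Bochner_Integration.integral_sum[symmetric]) (simp_all add: intg sum_g)
  ultimately have "n * \<bar>J f - (LINT x|riesz_measure. f x)\<bar>
      = \<bar>\<Sum>i<n. n * J (g i) - n * (LINT x|riesz_measure. g i x)\<bar>"
    by (simp add: sum_subtractf sum_distrib_left[symmetric] right_diff_distrib[symmetric] abs_mult)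
  also have "\<dots> \<le> (\<Sum>i<n. \<bar>n * J (g i) - n * (LINT x|riesz_measure. g i x)\<bar>)" by (rule sum_abs)
  \<comment> \<open>Both numbers lie between \<open>M (Suc i)\<close> and \<open>M i\<close>. The
    lengths of these intervals telescope, so \<open>n\<close> times the error is at most the total
    mass.\<close>
  also have "\<dots> \<le> (\<Sum>i<n. M i - M (Suc i))"
  proof (rule sum_mono)
    fix i
    show "\<bar>n * J (g i) - n * (LINT x|riesz_measure. g i x)\<bar> \<le> M i - M (Suc i)"
      using Ju[of i] Jl[of i] Iu[of i] Il[of i] by linarith
  qed
  also have "\<dots> = M 0 - M n" by (rule sum_lessThan_telescope')
  also have "\<dots> \<le> measure riesz_measure UNIV"
    using bounded_measure[of "{x. real 0 / n < f x}"] measure_nonneg[of riesz_measure "{x. real n / n < f x}"]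
    unfolding M_def space_riesz_measure by linarith
  finally show ?thesis using n by (simp add: pos_le_divide_eq mult.commute)
qed

lemma riesz_measure_integral:
  assumes f: "f \<in> pos_bcont"
  shows "(LINT x|riesz_measure. f x) = J f"
proof -
  obtain B where B: "\<forall>x. f x \<le> B" using pos_bcont_bounded[OF f] by blast
  \<comment> \<open>Scales \<open>f\<close> below 1, as the slicing requires; the added 1 keeps the
    divisor positive.\<close>
  define c where "c = inverse (\<bar>B\<bar> + 1)"
  have c: "0 < c" by (simp add: c_def)
  have cf: "(\<lambda>x. c * f x) \<in> pos_bcont" using c by (intro pos_bcont_scale[OF f]) simp
  have cf1: "c * f x \<le> 1" for x
  proof -
    have "f x \<le> \<bar>B\<bar> + 1" using B[rule_format, of x] by linarith
    then show ?thesis unfolding c_def by (simp add: inverse_eq_divide pos_divide_le_eq)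
  qed
  let ?d = "\<bar>J (\<lambda>x. c * f x) - (LINT x|riesz_measure. c * f x)\<bar>"
  have "?d \<le> measure riesz_measure UNIV / Suc n" for n
    using riesz_measure_integral_aux[OF cf cf1, of "Suc n"] by simp
  moreover have "(\<lambda>n. measure riesz_measure UNIV / Suc n) \<longlonglongrightarrow> 0"
    using tendsto_mult_right_zero[OF LIMSEQ_inverse_real_of_nat, of "measure riesz_measure UNIV"]
    by (simp add: divide_inverse)
  ultimately have "?d \<le> 0" by (intro tendsto_lowerbound) auto
  then have "c * (LINT x|riesz_measure. f x) = c * J f" using J_scale[OF f, of c] c by simp
  then show ?thesis using c by simp
qed

end

text \<open>The open sets where \<open>h n\<close> is below \<open>e\<close> increase and cover
  \<open>K\<close>. The lemma links the two notions of null sequence: decreasing pointwise in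
  \<open>J_smooth\<close>, uniform on compact sets in \<open>compactly_null\<close>.\<close>

lemma dini:
  fixes h :: "nat \<Rightarrow> 'a::topological_space \<Rightarrow> real"
  assumes "compact K" and cont: "\<And>n. continuous_on UNIV (h n)" and nn: "\<And>n x. 0 \<le> h n x"
    and dec: "\<And>n x. h (Suc n) x \<le> h n x" and lim: "\<And>x. (\<lambda>n. h n x) \<longlonglongrightarrow> 0"
  shows "uniform_limit K h (\<lambda>_. 0) sequentially"
  unfolding uniform_limit_iff
proof (intro allI impI)
  fix e :: real assume e: "e > 0"
  have mono: "h n x \<le> h m x" if "m \<le> n" for m n x
    using that by (induction rule: dec_induct) (auto intro: order_trans dec)
  let ?\<C> = "range (\<lambda>n. {x. h n x < e})"
  have "\<exists>n. h n x < e" for x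
  proof -
    have "\<forall>\<^sub>F n in sequentially. h n x < e" by (rule order_tendstoD(2)[OF lim e])
    then show ?thesis using eventually_happens'[OF sequentially_bot] by blast
  qed
  then have "K \<subseteq> \<Union>?\<C>" by blast
  moreover have "\<forall>U\<in>?\<C>. open U" using cont by (auto intro!: open_Collect_less)
  ultimately obtain \<D> where D: "\<D> \<subseteq> ?\<C>" "finite \<D>" "K \<subseteq> \<Union>\<D>"
    using \<open>compact K\<close> unfolding compact_eq_Heine_Borel by meson
  then obtain I where I: "finite I" "\<D> = (\<lambda>n. {x. h n x < e}) ` I"
    using finite_subset_image[of \<D> "\<lambda>n. {x. h n x < e}" UNIV] by blast
  have "dist (h n x) 0 < e" if "n \<ge> Max (insert 0 I)" "x \<in> K" for n x
  proof -
    obtain i where i: "i \<in> I" "h i x < e" using D(3) I(2) \<open>x \<in> K\<close> by blast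
    then have "i \<le> n" using that(1) I(1) by simp
    then show ?thesis using mono[of i n x] i nn[of n x] by (simp add: dist_real_def)
  qed
  then show "\<forall>\<^sub>F n in sequentially. \<forall>x\<in>K. dist (h n x) 0 < e"
    unfolding eventually_sequentially by blast
qed

section \<open>The positive part of a bounded functional\<close>

text \<open>Kantorovich's formula for the positive part of \<open>\<phi>\<close> in the order dual,
  read on the cone.\<close>

definition upper_part :: "(('a::topological_space \<Rightarrow>\<^sub>C real) \<Rightarrow> real) \<Rightarrow> ('a \<Rightarrow> real) \<Rightarrow> real" where
  "upper_part \<phi> f = (SUP g\<in>{g \<in> pos_bcont. \<forall>x. g x \<le> f x}. \<phi> (Bcontfun g))"

lemma pos_bcont_imp_bcontfun: "f \<in> pos_bcont \<Longrightarrow> f \<in> bcontfun"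
  unfolding pos_bcont_def by (force intro: bcontfun_normI)

lemma apply_Bcontfun_pos: "f \<in> pos_bcont \<Longrightarrow> apply_bcontfun (Bcontfun f) = f"
  by (simp add: Bcontfun_inverse pos_bcont_imp_bcontfun)

lemma Bcontfun_pos_add: "f \<in> pos_bcont \<Longrightarrow> g \<in> pos_bcont \<Longrightarrow> Bcontfun (\<lambda>x. f x + g x) = Bcontfun f + Bcontfun g"
  by (rule bcontfun_eqI) (simp add: apply_Bcontfun_pos pos_bcont_add)

lemma Bcontfun_pos_scale: "f \<in> pos_bcont \<Longrightarrow> 0 \<le> c \<Longrightarrow> Bcontfun (\<lambda>x. c * f x) = c *\<^sub>R Bcontfun f"
  by (rule bcontfun_eqI) (simp add: apply_Bcontfun_pos pos_bcont_scale)

lemma norm_Bcontfun_pos_le: "f \<in> pos_bcont \<Longrightarrow> (\<And>x. f x \<le> B) \<Longrightarrow> norm (Bcontfun f) \<le> B"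
  by (rule norm_bound) (simp add: apply_Bcontfun_pos pos_bcont_nonneg)

context
  fixes \<phi> :: "('a::metric_space \<Rightarrow>\<^sub>C real) \<Rightarrow> real"
  assumes lin: "bounded_linear \<phi>"
begin

interpretation \<phi>: bounded_linear \<phi> by (rule lin)

lemma upper_part_bdd:
  assumes "f \<in> pos_bcont"
  shows "bdd_above ((\<lambda>g. \<phi> (Bcontfun g)) ` {g \<in> pos_bcont. \<forall>x. g x \<le> f x})"
proof -
  obtain B where B: "\<forall>x. f x \<le> B" using pos_bcont_bounded[OF assms] by blast
  obtain K where K: "K > 0" "\<And>g. norm (\<phi> g) \<le> norm g * K" using \<phi>.pos_bounded by blast
  show ?thesis
  proof (rule bdd_aboveI2)
    fix g assume g: "g \<in> {g \<in> pos_bcont. \<forall>x. g x \<le> f x}"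
    then have "norm (Bcontfun g) \<le> B" using B by (intro norm_Bcontfun_pos_le) (auto intro: order_trans)
    then have "norm (Bcontfun g) * K \<le> B * K" using K(1) by simp
    with K(2)[of "Bcontfun g"] show "\<phi> (Bcontfun g) \<le> B * K" by simp
  qed
qed

lemma upper_part_upper:
  "f \<in> pos_bcont \<Longrightarrow> g \<in> pos_bcont \<Longrightarrow> (\<And>x. g x \<le> f x) \<Longrightarrow> \<phi> (Bcontfun g) \<le> upper_part \<phi> f"
  unfolding upper_part_def by (intro cSUP_upper upper_part_bdd) auto

lemma upper_part_least:
  "f \<in> pos_bcont \<Longrightarrow> (\<And>g. g \<in> pos_bcont \<Longrightarrow> (\<And>x. g x \<le> f x) \<Longrightarrow> \<phi> (Bcontfun g) \<le> c) \<Longrightarrow> upper_part \<phi> f \<le> c"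
  unfolding upper_part_def by (intro cSUP_least) auto

lemma upper_part_approx:
  assumes "f \<in> pos_bcont" "e > 0"
  shows "\<exists>g\<in>pos_bcont. (\<forall>x. g x \<le> f x) \<and> upper_part \<phi> f - e < \<phi> (Bcontfun g)"
proof (rule ccontr)
  assume "\<not> ?thesis"
  then have "upper_part \<phi> f \<le> upper_part \<phi> f - e" using assms(1) by (intro upper_part_least) (auto simp: not_less)
  with assms(2) show False by simp
qed

lemma upper_part_nonneg: "f \<in> pos_bcont \<Longrightarrow> 0 \<le> upper_part \<phi> f"
proof -
  assume f: "f \<in> pos_bcont"
  have "Bcontfun (\<lambda>_. 0) = (0 :: 'a \<Rightarrow>\<^sub>C real)"
    by (rule bcontfun_eqI) (simp add: apply_Bcontfun_pos pos_bcont_const)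
  then show ?thesis
    using upper_part_upper[OF f pos_bcont_const[of 0]] pos_bcont_nonneg[OF f] by (simp add: \<phi>.zero)
qed

text \<open>Superadditivity adds two near-optimal competitors. The converse is the Riesz
  decomposition property: a competitor \<open>h\<close> below the sum of \<open>f\<close> and
  \<open>g\<close> is the minimum of \<open>h\<close> and \<open>f\<close> plus a remainder below
  \<open>g\<close>.\<close>

lemma upper_part_add:
  assumes f: "f \<in> pos_bcont" and g: "g \<in> pos_bcont"
  shows "upper_part \<phi> (\<lambda>x. f x + g x) = upper_part \<phi> f + upper_part \<phi> g"
proof (rule antisym)
  note fg = pos_bcont_add[OF f g]
  show "upper_part \<phi> (\<lambda>x. f x + g x) \<le> upper_part \<phi> f + upper_part \<phi> g"
  proof (rule upper_part_least[OF fg])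
    fix h assume h: "h \<in> pos_bcont" and le: "\<And>x. h x \<le> f x + g x"
    let ?p = "\<lambda>x. min (h x) (f x)" and ?q = "\<lambda>x. h x - min (h x) (f x)"
    note c = pos_bcont_continuous[OF h] pos_bcont_continuous[OF f]
    have p: "?p \<in> pos_bcont"
      using pos_bcont_nonneg[OF h] pos_bcont_nonneg[OF f] by (intro pos_bcont_le[OF f] continuous_intros c) auto
    have q: "?q \<in> pos_bcont"
      using pos_bcont_nonneg[OF f] by (intro pos_bcont_le[OF h] continuous_intros c) (auto simp: min_def intro: pos_bcont_nonneg[OF h])
    have "Bcontfun h = Bcontfun ?p + Bcontfun ?q" using Bcontfun_pos_add[OF p q] by simp
    then have "\<phi> (Bcontfun h) = \<phi> (Bcontfun ?p) + \<phi> (Bcontfun ?q)" by (simp add: \<phi>.add)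
    also have "\<phi> (Bcontfun ?p) \<le> upper_part \<phi> f" by (rule upper_part_upper[OF f p]) simp
    also have "\<phi> (Bcontfun ?q) \<le> upper_part \<phi> g"
    proof (rule upper_part_upper[OF g q])
      show "h x - min (h x) (f x) \<le> g x" for x
        using le[of x] pos_bcont_nonneg[OF g, of x] by (simp add: min_def)
    qed
    finally show "\<phi> (Bcontfun h) \<le> upper_part \<phi> f + upper_part \<phi> g" by simp
  qed
  show "upper_part \<phi> f + upper_part \<phi> g \<le> upper_part \<phi> (\<lambda>x. f x + g x)"
  proof (rule field_le_epsilon)
    fix e :: real assume "e > 0"
    then obtain p q where p: "p \<in> pos_bcont" "\<forall>x. p x \<le> f x" "upper_part \<phi> f - e / 2 < \<phi> (Bcontfun p)"
      and q: "q \<in> pos_bcont" "\<forall>x. q x \<le> g x" "upper_part \<phi> g - e / 2 < \<phi> (Bcontfun q)"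
      using upper_part_approx[OF f, of "e / 2"] upper_part_approx[OF g, of "e / 2"] by auto
    have "\<phi> (Bcontfun p) + \<phi> (Bcontfun q) = \<phi> (Bcontfun (\<lambda>x. p x + q x))"
      by (simp add: Bcontfun_pos_add p q \<phi>.add)
    also have "\<dots> \<le> upper_part \<phi> (\<lambda>x. f x + g x)"
      using p q by (intro upper_part_upper fg pos_bcont_add) (auto intro: add_mono)
    finally show "upper_part \<phi> f + upper_part \<phi> g \<le> upper_part \<phi> (\<lambda>x. f x + g x) + e"
      using p(3) q(3) by linarith
  qed
qed

lemma upper_part_scale_le:
  assumes f: "f \<in> pos_bcont" and c: "0 < c"
  shows "c * upper_part \<phi> f \<le> upper_part \<phi> (\<lambda>x. c * f x)"
proof -
  have "upper_part \<phi> f \<le> inverse c * upper_part \<phi> (\<lambda>x. c * f x)"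
  proof (rule upper_part_least[OF f])
    fix g assume g: "g \<in> pos_bcont" and le: "\<And>x. g x \<le> f x"
    have "c * \<phi> (Bcontfun g) = \<phi> (Bcontfun (\<lambda>x. c * g x))"
      using c by (simp add: Bcontfun_pos_scale[OF g] \<phi>.scaleR)
    also have "\<dots> \<le> upper_part \<phi> (\<lambda>x. c * f x)"
      using c le by (intro upper_part_upper pos_bcont_scale f g) auto
    finally show "\<phi> (Bcontfun g) \<le> inverse c * upper_part \<phi> (\<lambda>x. c * f x)"
      using c by (simp add: field_simps)
  qed
  then show ?thesis using c by (simp add: field_simps)
qed

lemma upper_part_scale:
  assumes f: "f \<in> pos_bcont" and c: "0 \<le> c"
  shows "upper_part \<phi> (\<lambda>x. c * f x) = c * upper_part \<phi> f"
proof (cases "c = 0")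
  case True
  have "upper_part \<phi> (\<lambda>_. 0) = upper_part \<phi> (\<lambda>_. 0) + upper_part \<phi> (\<lambda>_. 0)"
    using upper_part_add[OF pos_bcont_const[of 0] pos_bcont_const[of 0]] by simp
  then show ?thesis using True by simp
next
  case False
  then have "0 < c" using c by simp
  then show ?thesis
    \<comment> \<open>The second instance, scaling \<open>c * f\<close> by \<open>inverse c\<close>,
      gives the reverse inequality.\<close>
    using upper_part_scale_le[OF f \<open>0 < c\<close>] upper_part_scale_le[OF pos_bcont_scale[OF f c], of "inverse c"]
    by (simp add: field_simps)
qed

context
  assumes null: "\<And>h C. compactly_null h \<Longrightarrow> (\<And>n. norm (h n) \<le> C) \<Longrightarrow> (\<lambda>n. \<phi> (h n)) \<longlonglongrightarrow> 0"
begin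

text \<open>Near-optimal competitors \<open>g n\<close>, with error \<open>1 / Suc n\<close>, lie
  below \<open>h n\<close>. Dini's theorem makes \<open>h\<close> null on compact sets, hence also
  \<open>g\<close>, so that \<open>\<phi>\<close> tends to 0 along \<open>g\<close>. The
  \<open>g n\<close> need not decrease, which is why \<open>null\<close> is assumed for all bounded
  sequences null on compact sets.\<close>

lemma upper_part_smooth:
  fixes h :: "nat \<Rightarrow> 'a \<Rightarrow> real"
  assumes h: "\<And>n. h n \<in> pos_bcont" and dec: "\<And>n x. h (Suc n) x \<le> h n x" and lim: "\<And>x. (\<lambda>n. h n x) \<longlonglongrightarrow> 0"
  shows "(\<lambda>n. upper_part \<phi> (h n)) \<longlonglongrightarrow> 0"
proof -
  have "\<exists>g. g \<in> pos_bcont \<and> (\<forall>x. g x \<le> h n x) \<and> upper_part \<phi> (h n) - 1 / Suc n < \<phi> (Bcontfun g)" for n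
    using upper_part_approx[OF h[of n], of "1 / Suc n"] by auto
  then obtain g where g: "\<And>n. g n \<in> pos_bcont" "\<And>n x. g n x \<le> h n x"
    "\<And>n. upper_part \<phi> (h n) - 1 / Suc n < \<phi> (Bcontfun (g n))" by metis
  have "compactly_null (\<lambda>n. Bcontfun (h n))"
    unfolding compactly_null_def apply_Bcontfun_pos[OF h]
    by (intro allI impI dini) (auto intro: dec lim pos_bcont_continuous[OF h] pos_bcont_nonneg[OF h])
  then have "compactly_null (\<lambda>n. Bcontfun (g n))"
    by (rule compactly_null_le)
      (use g pos_bcont_nonneg[OF g(1)] pos_bcont_nonneg[OF h] in \<open>simp add: apply_Bcontfun_pos h\<close>)
  moreover obtain B where B: "\<forall>x. h 0 x \<le> B" using pos_bcont_bounded[OF h] by blast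
  have "h n x \<le> h 0 x" for n x by (induction n) (auto intro: order_trans[OF dec])
  then have "norm (Bcontfun (g n)) \<le> B" for n
    using g(2) B by (intro norm_Bcontfun_pos_le[OF g(1)]) (meson order_trans)
  ultimately have "(\<lambda>n. \<phi> (Bcontfun (g n))) \<longlonglongrightarrow> 0" by (intro null)
  from tendsto_add[OF this LIMSEQ_inverse_real_of_nat]
  have up: "(\<lambda>n. \<phi> (Bcontfun (g n)) + inverse (real (Suc n))) \<longlonglongrightarrow> 0" by simp
  show ?thesis
  proof (rule tendsto_sandwich[OF _ _ tendsto_const up])
    show "\<forall>\<^sub>F n in sequentially. 0 \<le> upper_part \<phi> (h n)" using upper_part_nonneg[OF h] by simp
    show "\<forall>\<^sub>F n in sequentially. upper_part \<phi> (h n) \<le> \<phi> (Bcontfun (g n)) + inverse (real (Suc n))"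
    proof (rule always_eventually, rule allI)
      fix n
      show "upper_part \<phi> (h n) \<le> \<phi> (Bcontfun (g n)) + inverse (real (Suc n))"
        using g(3)[of n] unfolding inverse_eq_divide by linarith
    qed
  qed
qed

lemma smooth_positive_functional_upper_part: "smooth_positive_functional (upper_part \<phi>)"
  by standard (simp_all add: upper_part_add upper_part_scale upper_part_nonneg upper_part_smooth)

end

end

text \<open>For \<open>g\<close> below \<open>f\<close>, the value \<open>\<phi> g\<close> is
  \<open>\<phi> f\<close> plus the value of \<open>- \<phi>\<close> at \<open>f - g\<close>, which
  competes in the positive part of \<open>- \<phi>\<close>. The supremum over \<open>g\<close> gives
  one inequality; the other is the same for \<open>- \<phi>\<close>.\<close>

lemma upper_part_diff:
  fixes \<phi> :: "('a::metric_space \<Rightarrow>\<^sub>C real) \<Rightarrow> real"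
  assumes lin: "bounded_linear \<phi>" and f: "f \<in> pos_bcont"
  shows "upper_part \<phi> f - upper_part (\<lambda>g. - \<phi> g) f = \<phi> (Bcontfun f)"
proof -
  have half: "upper_part \<psi> f \<le> \<psi> (Bcontfun f) + upper_part (\<lambda>g. - \<psi> g) f"
    if \<psi>: "bounded_linear \<psi>" for \<psi> :: "('a \<Rightarrow>\<^sub>C real) \<Rightarrow> real"
  proof (rule upper_part_least[OF \<psi> f])
    fix g assume g: "g \<in> pos_bcont" and le: "\<And>x. g x \<le> f x"
    have d: "(\<lambda>x. f x - g x) \<in> pos_bcont"
      using le pos_bcont_nonneg[OF g]
      by (intro pos_bcont_le[OF f] continuous_on_diff pos_bcont_continuous[OF f] pos_bcont_continuous[OF g]) auto
    have "Bcontfun f = Bcontfun g + Bcontfun (\<lambda>x. f x - g x)" using Bcontfun_pos_add[OF g d] by simp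
    then have "\<psi> (Bcontfun f) = \<psi> (Bcontfun g) + \<psi> (Bcontfun (\<lambda>x. f x - g x))"
      by (simp add: linear_add bounded_linear.linear[OF \<psi>])
    moreover have "- \<psi> (Bcontfun (\<lambda>x. f x - g x)) \<le> upper_part (\<lambda>g. - \<psi> g) f"
      using pos_bcont_nonneg[OF g] by (intro upper_part_upper[OF bounded_linear_minus[OF \<psi>] f d]) simp
    ultimately show "\<psi> (Bcontfun g) \<le> \<psi> (Bcontfun f) + upper_part (\<lambda>g. - \<psi> g) f" by simp
  qed
  show ?thesis using half[OF lin] half[OF bounded_linear_minus[OF lin]] by simp
qed

section \<open>The representing signed measure\<close>

lemma baire_measure_of_diff:
  fixes M N :: "'a::topological_space measure"
  assumes M: "finite_measure M" "sets M = sets baire_algebra" and N: "finite_measure N" "sets N = sets baire_algebra"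
  shows "\<exists>\<mu> :: 'a baire_measure. \<forall>A\<in>sets baire_algebra. bm_value \<mu> A = measure M A - measure N A"
proof -
  interpret M: finite_measure M by (rule M(1))
  interpret N: finite_measure N by (rule N(1))
  define m where "m A = (if A \<in> sets (baire_algebra :: 'a measure) then measure M A - measure N A else 0)" for A
  have "(\<lambda>n. m (A n)) sums m (\<Union>n. A n)"
    if A: "range A \<subseteq> sets baire_algebra" "disjoint_family A" for A :: "nat \<Rightarrow> 'a set"
  proof -
    have "(\<lambda>n. measure M (A n) - measure N (A n)) sums (measure M (\<Union>n. A n) - measure N (\<Union>n. A n))"
      using A M N by (intro sums_diff M.finite_measure_UNION N.finite_measure_UNION) auto
    then show ?thesis using A(1) by (simp add: m_def range_subsetD sets.countable_UN)
  qed
  moreover have "bdd_above (variation_sums m)"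
  proof (rule bdd_variationI)
    fix P :: "'a set set" assume P: "finite P" "P \<subseteq> sets baire_algebra" "disjoint P"
    have df: "disjoint_family_on (\<lambda>A. A) P" using P(3) by (auto simp: disjoint_family_on_def disjoint_def)
    have "(\<Sum>A\<in>P. \<bar>m A\<bar>) \<le> (\<Sum>A\<in>P. measure M A + measure N A)"
    proof (rule sum_mono)
      fix A
      show "\<bar>m A\<bar> \<le> measure M A + measure N A"
        using measure_nonneg[of M A] measure_nonneg[of N A] by (auto simp: m_def abs_le_iff)
    qed
    also have "\<dots> = measure M (\<Union>A\<in>P. A) + measure N (\<Union>A\<in>P. A)"
      using M.finite_measure_finite_Union[of P "\<lambda>A. A"] N.finite_measure_finite_Union[of P "\<lambda>A. A"] P df M N
      by (simp add: sum.distrib)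
    also have "\<dots> \<le> measure M (space M) + measure N (space N)"
      by (intro add_mono M.bounded_measure N.bounded_measure)
    finally show "(\<Sum>A\<in>P. \<bar>m A\<bar>) \<le> measure M (space M) + measure N (space N)" .
  qed
  moreover have "m A = 0" if "A \<notin> sets baire_algebra" for A using that by (simp add: m_def)
  ultimately have "m \<in> bounded_baire_measures" unfolding bounded_baire_measures_def by blast
  then show ?thesis by (intro exI[of _ "Abs_baire_measure m"]) (simp add: Abs_bm_value m_def)
qed

text \<open>The positive parts of \<open>\<phi>\<close> and \<open>- \<phi>\<close> each come from a
  finite measure. Whether these are the Jordan parts of \<open>\<mu>\<close> never enters:
  \<open>bm_integral_eq_diff\<close> compares the integrals through level sums.\<close>

lemma riesz_representation:
  fixes \<phi> :: "('a::metric_space \<Rightarrow>\<^sub>C real) \<Rightarrow> real"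
  assumes lin: "bounded_linear \<phi>"
    and null: "\<And>h C. compactly_null h \<Longrightarrow> (\<And>n. norm (h n) \<le> C) \<Longrightarrow> (\<lambda>n. \<phi> (h n)) \<longlonglongrightarrow> 0"
  shows "\<exists>\<mu> :: 'a baire_measure. \<forall>f. blinfun_apply (bm_functional \<mu>) f = \<phi> f"
proof -
  note lin' = bounded_linear_minus[OF lin]
  have null': "(\<lambda>n. - \<phi> (h n)) \<longlonglongrightarrow> 0" if "compactly_null h" "\<And>n. norm (h n) \<le> C" for h C
    using tendsto_minus[OF null[OF that]] by simp
  interpret P: smooth_positive_functional "upper_part \<phi>"
    by (rule smooth_positive_functional_upper_part[OF lin null])
  interpret N: smooth_positive_functional "upper_part (\<lambda>f. - \<phi> f)"
    by (rule smooth_positive_functional_upper_part[OF lin' null'])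
  have s: "sets P.riesz_measure = sets baire_algebra" "sets N.riesz_measure = sets baire_algebra"
    by (simp_all add: P.sets_riesz_measure N.sets_riesz_measure sets_baire_eq_borel)
  obtain \<mu> :: "'a baire_measure" where
    \<mu>: "\<And>A. A \<in> sets baire_algebra \<Longrightarrow> bm_value \<mu> A = measure P.riesz_measure A - measure N.riesz_measure A"
    using baire_measure_of_diff[OF P.finite_measure_riesz_measure s(1) N.finite_measure_riesz_measure s(2)] by blast
  have pos: "blinfun_apply (bm_functional \<mu>) g = \<phi> g" if "\<And>x. 0 \<le> apply_bcontfun g x" for g
  proof -
    have "apply_bcontfun g x \<le> norm g" for x using abs_bcontfun_le[of g x] by simp
    then have g: "apply_bcontfun g \<in> pos_bcont" using that by (intro pos_bcontI) auto
    have "level_sum (bm_value \<mu>) g (norm g) \<longlonglongrightarrow> (LINT x|P.riesz_measure. apply_bcontfun g x) - (LINT x|N.riesz_measure. apply_bcontfun g x)"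
      by (rule bm_integral_eq_diff[OF P.finite_measure_riesz_measure s(1) N.finite_measure_riesz_measure s(2) \<mu>
            bcontfun_measurable_baire abs_bcontfun_le])
    from LIMSEQ_unique[OF level_sum_bcontfun this]
    have "blinfun_apply (bm_functional \<mu>) g = upper_part \<phi> (apply_bcontfun g) - upper_part (\<lambda>g. - \<phi> g) (apply_bcontfun g)"
      by (simp add: bm_functional_apply P.riesz_measure_integral[OF g] N.riesz_measure_integral[OF g])
    also have "\<dots> = \<phi> g" using upper_part_diff[OF lin g] by (simp add: apply_bcontfun_inverse)
    finally show ?thesis .
  qed
  have "blinfun_apply (bm_functional \<mu>) f = \<phi> f" for f
  proof -
    obtain p q :: "'a \<Rightarrow>\<^sub>C real" where f: "f = p - q"
      and pq: "apply_bcontfun p = (\<lambda>x. max 0 (apply_bcontfun f x))" "apply_bcontfun q = (\<lambda>x. max 0 (- apply_bcontfun f x))"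
      by (rule bcontfun_pos_neg_parts[of f])
    have "\<phi> f = \<phi> p - \<phi> q" unfolding f by (rule linear_diff[OF bounded_linear.linear[OF lin]])
    also have "\<phi> p = blinfun_apply (bm_functional \<mu>) p" by (rule pos[symmetric]) (simp add: pq)
    also have "\<phi> q = blinfun_apply (bm_functional \<mu>) q" by (rule pos[symmetric]) (simp add: pq)
    finally show ?thesis by (simp add: f blinfun.diff_right)
  qed
  then show ?thesis by blast
qed

section \<open>The weak topology on measures\<close>

lemma bm_functional_zero: "bm_functional 0 = 0"
  using bm_functional_diff[of 0 0] by simp

lemma bounded_linear_bm_functional: "bounded_linear (\<lambda>\<mu>. blinfun_apply (bm_functional \<mu>) f)"
  by (rule bounded_linear_intro[where K = "norm f"])
    (use abs_bm_functional_le in \<open>simp_all add: bm_functional_add bm_functional_scaleR blinfun.add_left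
      blinfun.scaleR_left mult.commute\<close>)

definition weak_seminorms :: "('a::topological_space baire_measure \<Rightarrow> real) set" where
  "weak_seminorms = range (\<lambda>f \<mu>. \<bar>blinfun_apply (bm_functional \<mu>) f\<bar>)"

lemma weak_measure_topology_eq: "weak_measure_topology = seminorm_topology weak_seminorms"
  by (simp add: weak_measure_topology_def weak_seminorms_def)

lemma weak_seminorms_nonempty: "weak_seminorms \<noteq> {}"
  by (simp add: weak_seminorms_def)

lemma seminorm_weak_seminorms: "\<forall>p\<in>weak_seminorms. seminorm p"
  by (auto simp: weak_seminorms_def seminorm_def bm_functional_add bm_functional_scaleR
      blinfun.add_left blinfun.scaleR_left abs_mult)

lemmas weak_seminorm_facts = weak_seminorms_nonempty seminorm_weak_seminorms

lemma limitin_weak_measure_topology: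
  "limitin weak_measure_topology \<mu> \<nu> F \<longleftrightarrow>
    (\<forall>f. ((\<lambda>n. blinfun_apply (bm_functional (\<mu> n)) f) \<longlongrightarrow> blinfun_apply (bm_functional \<nu>) f) F)"
  unfolding weak_measure_topology_eq limitin_seminorm_topology[OF weak_seminorm_facts]
  by (simp add: weak_seminorms_def bm_functional_diff blinfun.diff_left tendsto_rabs_zero_iff LIM_zero_iff)

text \<open>The weak topology is an initial topology, so later continuity proofs can work with one
  \<open>f\<close> at a time.\<close>

lemma continuous_map_weak_measure_topology:
  "continuous_map X weak_measure_topology \<mu> \<longleftrightarrow>
    (\<forall>f. continuous_map X euclideanreal (\<lambda>x. blinfun_apply (bm_functional (\<mu> x)) f))"
proof
  assume c: "continuous_map X weak_measure_topology \<mu>"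
  show "\<forall>f. continuous_map X euclideanreal (\<lambda>x. blinfun_apply (bm_functional (\<mu> x)) f)"
  proof
    fix f
    have "\<exists>U. openin X U \<and> x \<in> U \<and> (\<forall>y\<in>U. blinfun_apply (bm_functional (\<mu> y)) f \<in> ball (blinfun_apply (bm_functional (\<mu> x)) f) e)"
      if "x \<in> topspace X" "e > 0" for x e
    proof -
      have "\<exists>U. openin X U \<and> x \<in> U \<and> (\<forall>y\<in>U. \<bar>blinfun_apply (bm_functional (\<mu> y - \<mu> x)) f\<bar> < e)"
        using c that unfolding weak_measure_topology_eq continuous_map_seminorm_topology[OF weak_seminorm_facts]
        by (simp add: weak_seminorms_def)
      then show ?thesis
        by (simp add: bm_functional_diff blinfun.diff_left dist_real_def abs_minus_commute)
    qed
    note nhd = this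
    have "openin X {x \<in> topspace X. blinfun_apply (bm_functional (\<mu> x)) f \<in> V}" if "open V" for V
    proof (subst openin_subopen, intro ballI)
      fix x assume "x \<in> {x \<in> topspace X. blinfun_apply (bm_functional (\<mu> x)) f \<in> V}"
      then obtain e where e: "e > 0" "ball (blinfun_apply (bm_functional (\<mu> x)) f) e \<subseteq> V" "x \<in> topspace X"
        using \<open>open V\<close> unfolding open_contains_ball by blast
      from nhd[OF e(3,1)] obtain U where U: "openin X U" "x \<in> U"
        "\<forall>y\<in>U. blinfun_apply (bm_functional (\<mu> y)) f \<in> ball (blinfun_apply (bm_functional (\<mu> x)) f) e"
        by (elim exE conjE)
      with e(2) openin_subset[OF U(1)]
      show "\<exists>U. openin X U \<and> x \<in> U \<and> U \<subseteq> {x \<in> topspace X. blinfun_apply (bm_functional (\<mu> x)) f \<in> V}"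
        by (intro exI[of _ U]) blast
    qed
    then show "continuous_map X euclideanreal (\<lambda>x. blinfun_apply (bm_functional (\<mu> x)) f)"
      by (simp add: continuous_map_def)
  qed
next
  assume c: "\<forall>f. continuous_map X euclideanreal (\<lambda>x. blinfun_apply (bm_functional (\<mu> x)) f)"
  have "\<exists>U. openin X U \<and> x \<in> U \<and> (\<forall>y\<in>U. \<bar>blinfun_apply (bm_functional (\<mu> y - \<mu> x)) f\<bar> < e)"
    if "x \<in> topspace X" "e > 0" for f x e
  proof (intro exI conjI)
    let ?U = "{y \<in> topspace X. blinfun_apply (bm_functional (\<mu> y)) f \<in> ball (blinfun_apply (bm_functional (\<mu> x)) f) e}"
    show "openin X ?U" using c by (intro openin_continuous_map_preimage[of X euclideanreal]) auto
    show "x \<in> ?U" using that by simp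
    show "\<forall>y\<in>?U. \<bar>blinfun_apply (bm_functional (\<mu> y - \<mu> x)) f\<bar> < e"
      by (simp add: bm_functional_diff blinfun.diff_left dist_real_def abs_minus_commute)
  qed
  then show "continuous_map X weak_measure_topology \<mu>"
    unfolding weak_measure_topology_eq continuous_map_seminorm_topology[OF weak_seminorm_facts]
    by (simp add: weak_seminorms_def)
qed

lemma continuous_map_bm_functional:
  "continuous_map weak_measure_topology euclideanreal (\<lambda>\<mu>. blinfun_apply (bm_functional \<mu>) f)"
  by (rule spec[OF iffD1[OF continuous_map_weak_measure_topology continuous_map_id[unfolded id_def]]])

lemma topspace_weak_measure_topology: "topspace weak_measure_topology = UNIV"
  unfolding weak_measure_topology_eq by (rule topspace_seminorm_topology[OF weak_seminorm_facts])

text \<open>The bound \<open>C\<close> passes to the limit functional and makes it norm continuous;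
  \<open>weak_limit_compactly_null\<close> supplies the other hypothesis of
  \<open>riesz_representation\<close>.\<close>

lemma weak_sequentially_complete:
  fixes \<mu> :: "nat \<Rightarrow> 'a::metric_space baire_measure"
  assumes C: "\<And>n. norm (\<mu> n) \<le> C" and Cauchy: "Cauchy_wrt weak_measure_topology \<mu>"
  shows "\<exists>\<nu>. limitin weak_measure_topology \<mu> \<nu> sequentially"
proof -
  let ?I = "\<lambda>n. blinfun_apply (bm_functional (\<mu> n))"
  define \<phi> where "\<phi> f = lim (\<lambda>n. ?I n f)" for f
  have lim: "(\<lambda>n. ?I n f) \<longlonglongrightarrow> \<phi> f" for f
  proof -
    have "Cauchy (\<lambda>n. ?I n f)"
      unfolding Cauchy_iff
    proof (intro allI impI)
      fix e :: real assume "e > 0"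
      \<comment> \<open>Written with \<open>\<nu> - 0\<close> to match a generating ball centred at
        0.\<close>
      let ?U = "{\<nu>. \<bar>blinfun_apply (bm_functional (\<nu> - 0)) f\<bar> < e}"
      have "openin weak_measure_topology ?U"
        unfolding weak_measure_topology_eq using \<open>e > 0\<close>
        by (intro openin_seminorm_ball[of "\<lambda>\<nu>. \<bar>blinfun_apply (bm_functional \<nu>) f\<bar>"]) (auto simp: weak_seminorms_def)
      moreover have "0 \<in> ?U"
        using \<open>e > 0\<close> by (simp add: bm_functional_zero blinfun.zero_left)
      ultimately have "\<exists>N. \<forall>m\<ge>N. \<forall>n\<ge>N. \<mu> m - \<mu> n \<in> ?U" using Cauchy unfolding Cauchy_wrt_def by blast
      then show "\<exists>M. \<forall>m\<ge>M. \<forall>n\<ge>M. norm (?I m f - ?I n f) < e"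
        by (simp add: bm_functional_diff blinfun.diff_left)
    qed
    then show ?thesis unfolding \<phi>_def using Cauchy_convergent convergent_LIMSEQ_iff by blast
  qed
  have "bounded_linear \<phi>"
  proof (rule bounded_linear_intro)
    fix f g :: "'a \<Rightarrow>\<^sub>C real" and c :: real
    show "\<phi> (f + g) = \<phi> f + \<phi> g"
      using tendsto_add[OF lim[of f] lim[of g]] by (intro LIMSEQ_unique[OF lim]) (simp add: blinfun.add_right)
    show "\<phi> (c *\<^sub>R f) = c *\<^sub>R \<phi> f"
      using tendsto_mult_left[OF lim[of f], of c] by (intro LIMSEQ_unique[OF lim]) (simp add: blinfun.scaleR_right)
    show "norm (\<phi> f) \<le> norm f * C"
    proof (rule tendsto_upperbound[OF tendsto_norm[OF lim]])
      show "\<forall>\<^sub>F n in sequentially. norm (?I n f) \<le> norm f * C"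
      proof (rule always_eventually, rule allI)
        fix n
        have "norm (?I n f) \<le> norm f * norm (\<mu> n)" using abs_bm_functional_le by simp
        also have "\<dots> \<le> norm f * C" by (intro mult_left_mono C) simp
        finally show "norm (?I n f) \<le> norm f * C" .
      qed
    qed simp
  qed
  moreover have "(\<lambda>k. \<phi> (h k)) \<longlonglongrightarrow> 0" if "compactly_null h" "\<And>k. norm (h k) \<le> B" for h B
    by (rule weak_limit_compactly_null[OF lim that])
  ultimately obtain \<nu> :: "'a baire_measure" where "\<forall>f. blinfun_apply (bm_functional \<nu>) f = \<phi> f"
    using riesz_representation by blast
  with lim show ?thesis unfolding limitin_weak_measure_topology by (intro exI[of _ \<nu>]) simp
qed

lemma bicontinuous_space_weak_measure_topology:
  "bicontinuous_space (weak_measure_topology :: 'a::polish_space baire_measure topology)"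
proof
  let ?\<tau> = "weak_measure_topology :: 'a baire_measure topology"
  show "locally_convex_topology ?\<tau>"
    unfolding weak_measure_topology_eq by (rule locally_convex_seminorm_topology[OF weak_seminorm_facts])
  show "Hausdorff_space ?\<tau>"
    unfolding Hausdorff_space_def
  proof (intro allI impI)
    fix \<mu> \<nu> :: "'a baire_measure" assume "\<mu> \<in> topspace ?\<tau> \<and> \<nu> \<in> topspace ?\<tau> \<and> \<mu> \<noteq> \<nu>"
    then have "bm_functional \<mu> \<noteq> bm_functional \<nu>" using injD[OF inj_bm_functional] by blast
    then obtain f where "blinfun_apply (bm_functional \<mu>) f \<noteq> blinfun_apply (bm_functional \<nu>) f"
      using blinfun_eqI by blast
    from hausdorff[OF this] obtain U V where UV: "open U" "open V" "blinfun_apply (bm_functional \<mu>) f \<in> U"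
      "blinfun_apply (bm_functional \<nu>) f \<in> V" "U \<inter> V = {}" by blast
    let ?P = "\<lambda>U. {\<kappa> \<in> topspace ?\<tau>. blinfun_apply (bm_functional \<kappa>) f \<in> U}"
    have "openin ?\<tau> (?P U)" "openin ?\<tau> (?P V)"
      using UV by (auto intro!: openin_continuous_map_preimage[OF continuous_map_bm_functional] simp del: topspace_euclidean)
    then show "\<exists>U V. openin ?\<tau> U \<and> openin ?\<tau> V \<and> \<mu> \<in> U \<and> \<nu> \<in> V \<and> disjnt U V"
      using UV by (intro exI[of _ "?P U"] exI[of _ "?P V"]) (auto simp: topspace_weak_measure_topology disjnt_def)
  qed
  show "open U" if "openin ?\<tau> U" for U
  proof -
    \<comment> \<open>Coarser than the norm topology means that the identity is continuous, and this
      can be tested on the functionals.\<close>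
    have "continuous_map euclidean ?\<tau> (\<lambda>\<mu>. \<mu>)"
      unfolding continuous_map_weak_measure_topology
      by (simp add: linear_continuous_on bounded_linear_bm_functional)
    from openin_continuous_map_preimage[OF this that] show ?thesis by simp
  qed
  show "\<exists>\<nu>\<in>S. limitin ?\<tau> \<mu> \<nu> sequentially"
    if S: "closedin ?\<tau> S" "bounded S" "range \<mu> \<subseteq> S" and Cauchy: "Cauchy_wrt ?\<tau> \<mu>" for S \<mu>
  proof -
    obtain C where "\<forall>\<nu>\<in>S. norm \<nu> \<le> C" using S(2) by (auto simp: bounded_iff)
    then obtain \<nu> where \<nu>: "limitin ?\<tau> \<mu> \<nu> sequentially"
      using weak_sequentially_complete[OF _ Cauchy] S(3) by (meson range_subsetD)
    moreover have "\<nu> \<in> S"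
      by (rule limitin_closedin[OF \<nu> S(1)]) (use S(3) in \<open>auto simp: image_subset_iff\<close>)
    ultimately show ?thesis by blast
  qed
  show "norm \<mu> = (SUP \<phi>\<in>{\<phi> :: 'a baire_measure \<Rightarrow>\<^sub>L real.
      continuous_map ?\<tau> euclideanreal (blinfun_apply \<phi>) \<and> norm \<phi> \<le> 1}. \<bar>blinfun_apply \<phi> \<mu>\<bar>)" for \<mu>
  proof (rule antisym)
    let ?D = "{\<phi> :: 'a baire_measure \<Rightarrow>\<^sub>L real. continuous_map ?\<tau> euclideanreal (blinfun_apply \<phi>) \<and> norm \<phi> \<le> 1}"
    have le: "\<bar>blinfun_apply \<phi> \<mu>\<bar> \<le> norm \<mu>" if "\<phi> \<in> ?D" for \<phi>
    proof -
      have "\<bar>blinfun_apply \<phi> \<mu>\<bar> \<le> norm \<phi> * norm \<mu>" using norm_blinfun[of \<phi> \<mu>] by simp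
      also have "\<dots> \<le> 1 * norm \<mu>" using that by (intro mult_right_mono) auto
      finally show ?thesis by simp
    qed
    have "0 \<in> ?D" by (simp add: zero_blinfun.rep_eq)
    then show "(SUP \<phi>\<in>?D. \<bar>blinfun_apply \<phi> \<mu>\<bar>) \<le> norm \<mu>" using le by (intro cSUP_least) auto
    show "norm \<mu> \<le> (SUP \<phi>\<in>?D. \<bar>blinfun_apply \<phi> \<mu>\<bar>)"
    \<comment> \<open>Evaluations at functions of the unit ball are weakly continuous of norm at
      most 1, and they alone already reach the variation norm.\<close>
    proof (rule norm_baire_measure_le)
      fix f :: "'a \<Rightarrow>\<^sub>C real" assume f: "norm f \<le> 1"
      define \<phi> where "\<phi> = Blinfun (\<lambda>\<mu>. blinfun_apply (bm_functional \<mu>) f)"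
      have \<phi>: "blinfun_apply \<phi> = (\<lambda>\<mu>. blinfun_apply (bm_functional \<mu>) f)"
        unfolding \<phi>_def by (rule bounded_linear_Blinfun_apply[OF bounded_linear_bm_functional])
      have "norm \<phi> \<le> norm f"
        by (rule norm_blinfun_bound) (use abs_bm_functional_le in \<open>simp_all add: \<phi>\<close>)
      then have "\<phi> \<in> ?D" using f by (simp add: \<phi> continuous_map_bm_functional)
      then have "\<bar>blinfun_apply \<phi> \<mu>\<bar> \<le> (SUP \<phi>\<in>?D. \<bar>blinfun_apply \<phi> \<mu>\<bar>)"
        using le by (intro cSUP_upper bdd_aboveI2) auto
      then show "blinfun_apply (bm_functional \<mu>) f \<le> (SUP \<phi>\<in>?D. \<bar>blinfun_apply \<phi> \<mu>\<bar>)"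
        by (simp add: \<phi>)
    qed
  qed
qed

section \<open>Limits in the compact-open topology\<close>

lemma limitin_compact_open_topology:
  "limitin compact_open_topology h l sequentially \<longleftrightarrow> compactly_null (\<lambda>n. h n - l)"
proof -
  let ?p = "\<lambda>K f. SUP x\<in>K. \<bar>apply_bcontfun f x\<bar>"
  let ?P = "{?p K | K :: 'a set. compact K \<and> K \<noteq> {}}"
  have bdd: "bdd_above ((\<lambda>x. \<bar>apply_bcontfun f x\<bar>) ` K)" for f :: "'a \<Rightarrow>\<^sub>C real" and K
    by (rule bdd_aboveI2) (rule abs_bcontfun_le)
  have up: "x \<in> K \<Longrightarrow> \<bar>apply_bcontfun f x\<bar> \<le> ?p K f" for x K and f :: "'a \<Rightarrow>\<^sub>C real"
    by (rule cSUP_upper[OF _ bdd])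
  have sn: "seminorm (?p K)" if K: "K \<noteq> {}" for K :: "'a set"
    unfolding seminorm_def
  proof (intro conjI allI)
    fix f g :: "'a \<Rightarrow>\<^sub>C real" and c :: real
    show "?p K (f + g) \<le> ?p K f + ?p K g"
    proof (rule cSUP_least[OF K])
      fix x assume "x \<in> K"
      from up[OF this, of f] up[OF this, of g]
      show "\<bar>apply_bcontfun (f + g) x\<bar> \<le> ?p K f + ?p K g" by simp
    qed
    have le: "?p K (c *\<^sub>R f) \<le> \<bar>c\<bar> * ?p K f" for c and f :: "'a \<Rightarrow>\<^sub>C real"
      by (rule cSUP_least[OF K]) (auto simp: abs_mult intro!: mult_left_mono up)
    show "?p K (c *\<^sub>R f) = \<bar>c\<bar> * ?p K f"
    proof (rule antisym[OF le])
      show "\<bar>c\<bar> * ?p K f \<le> ?p K (c *\<^sub>R f)"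
      proof (cases "c = 0")
        case True
        obtain x where "x \<in> K" using K by blast
        from up[OF this, of "c *\<^sub>R f"] show ?thesis using True by simp
      next
        case False
        then show ?thesis using le[of "inverse c" "c *\<^sub>R f"] by (simp add: field_simps)
      qed
    qed
  qed
  have "?P \<noteq> {}" using compact_sing[of undefined] by blast
  moreover have "\<forall>p\<in>?P. seminorm p" using sn by auto
  ultimately have "limitin compact_open_topology h l sequentially \<longleftrightarrow> (\<forall>p\<in>?P. (\<lambda>n. p (h n - l)) \<longlonglongrightarrow> 0)"
    unfolding compact_open_topology_def by (rule limitin_seminorm_topology)
  also have "\<dots> \<longleftrightarrow> (\<forall>K. compact K \<and> K \<noteq> {} \<longrightarrow> (\<lambda>n. ?p K (h n - l)) \<longlonglongrightarrow> 0)" by auto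
  also have "\<dots> \<longleftrightarrow> compactly_null (\<lambda>n. h n - l)"
  proof -
    have "(\<lambda>n. ?p K (h n - l)) \<longlonglongrightarrow> 0 \<longleftrightarrow> uniform_limit K (\<lambda>n. apply_bcontfun (h n - l)) (\<lambda>_. 0) sequentially"
      if K: "K \<noteq> {}" for K
    proof
      assume lim: "(\<lambda>n. ?p K (h n - l)) \<longlonglongrightarrow> 0"
      show "uniform_limit K (\<lambda>n. apply_bcontfun (h n - l)) (\<lambda>_. 0) sequentially"
        unfolding uniform_limit_iff
      proof (intro allI impI)
        fix e :: real assume "e > 0"
        from order_tendstoD(2)[OF lim this]
        show "\<forall>\<^sub>F n in sequentially. \<forall>x\<in>K. dist (apply_bcontfun (h n - l) x) 0 < e"
        proof eventually_elim
          case (elim n)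
          show ?case using order.strict_trans1[OF up elim] by (simp add: dist_real_def del: minus_bcontfun.rep_eq)
        qed
      qed
    next
      assume lim: "uniform_limit K (\<lambda>n. apply_bcontfun (h n - l)) (\<lambda>_. 0) sequentially"
      show "(\<lambda>n. ?p K (h n - l)) \<longlonglongrightarrow> 0"
      proof (rule tendstoI)
        fix e :: real assume e: "e > 0"
        then have "\<forall>\<^sub>F n in sequentially. \<forall>x\<in>K. dist (apply_bcontfun (h n - l) x) 0 < e / 2"
          using lim unfolding uniform_limit_iff by (meson half_gt_zero)
        then show "\<forall>\<^sub>F n in sequentially. dist (?p K (h n - l)) 0 < e"
        proof eventually_elim
          case (elim n)
          have "?p K (h n - l) \<le> e / 2" by (rule cSUP_least[OF K]) (use elim in \<open>auto simp: dist_real_def less_imp_le\<close>)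
          with e seminorm_nonneg[OF sn[OF K], of "h n - l"] show ?case by (simp add: dist_real_def)
        qed
      qed
    qed
    \<comment> \<open>\<open>compact_open_topology\<close> leaves out the empty compact set,
      \<open>compactly_null\<close> includes it.\<close>
    moreover have "uniform_limit {} (\<lambda>n. apply_bcontfun (h n - l)) (\<lambda>_. 0) sequentially"
      by (simp add: uniform_limit_iff)
    ultimately show ?thesis unfolding compactly_null_def by metis
  qed
  finally show ?thesis .
qed

section \<open>The adjoint semigroup\<close>

lemma compactly_null_imp_limitin: "compactly_null h \<Longrightarrow> limitin compact_open_topology h 0 sequentially"
  by (simp add: limitin_compact_open_topology)

context
  fixes T :: "real \<Rightarrow> ('a::polish_space \<Rightarrow>\<^sub>C real) \<Rightarrow>\<^sub>L ('a \<Rightarrow>\<^sub>C real)"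
  assumes T: "bicontinuous_semigroup compact_open_topology (\<lambda>t. blinfun_apply (T t))"
begin

interpretation bicontinuous_semigroup compact_open_topology "\<lambda>t. blinfun_apply (T t)" by (rule T)

lemma compactly_null_semigroup:
  assumes h: "compactly_null h" and C: "\<And>n. norm (h n) \<le> C" and t: "t \<ge> 0"
  shows "compactly_null (\<lambda>n. blinfun_apply (T t) (h n))"
proof -
  note lim = compactly_null_imp_limitin[OF h]
  have "bounded (range h)" using C by (auto simp: bounded_iff)
  \<comment> \<open>Instantiated with the one-point interval from \<open>t\<close> to
    \<open>t\<close>.\<close>
  from locally_bi_equicontinuous[OF this lim t order_refl]
  have "limitin compact_open_topology (\<lambda>n. blinfun_apply (T t) (h n)) 0 sequentially"
    using limitin_topspace[OF lim] by (simp add: limitin_def)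
  then show ?thesis by (simp add: limitin_compact_open_topology)
qed

text \<open>\<open>inv\<close> returns a genuine preimage only on the range of
  \<open>bm_functional\<close>, so the composite functional must be shown to be a measure.
  \<open>T t\<close> keeps a bounded sequence null on compact sets bounded and null, and dominated
  convergence for \<open>\<mu>\<close> then gives the hypothesis of
  \<open>riesz_representation\<close>.\<close>

lemma bm_functional_measure_adjoint:
  assumes t: "t \<ge> 0"
  shows "bm_functional (measure_adjoint (T t) \<mu>) = banach_adjoint (T t) (bm_functional \<mu>)"
proof -
  let ?\<phi> = "\<lambda>f. blinfun_apply (bm_functional \<mu>) (blinfun_apply (T t) f)"
  have "bounded_linear ?\<phi>"
    using blinfun.bounded_linear_right[of "bm_functional \<mu> o\<^sub>L T t"] by simp
  moreover have "(\<lambda>n. ?\<phi> (h n)) \<longlonglongrightarrow> 0" if h: "compactly_null h" and C: "\<And>n. norm (h n) \<le> C" for h C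
  proof -
    have "norm (blinfun_apply (T t) (h n)) \<le> norm (T t) * C" for n
      using norm_blinfun[of "T t" "h n"] mult_left_mono[OF C[of n] norm_ge_zero[of "T t"]] by linarith
    then have "(\<lambda>n. ?\<phi> (h n)) \<longlonglongrightarrow> blinfun_apply (bm_functional \<mu>) 0"
      using compactly_null_tendsto[OF compactly_null_semigroup[OF h C t]]
      by (intro bm_functional_dominated_convergence) auto
    then show ?thesis by (simp add: blinfun.zero_right)
  qed
  ultimately obtain \<nu> :: "'a baire_measure" where "\<forall>f. blinfun_apply (bm_functional \<nu>) f = ?\<phi> f"
    using riesz_representation[of ?\<phi>] by blast
  then have "bm_functional \<nu> = banach_adjoint (T t) (bm_functional \<mu>)"
    by (intro blinfun_eqI) (simp add: banach_adjoint_def)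
  then show ?thesis
    unfolding measure_adjoint_def by (intro f_inv_into_f) (metis rangeI)
qed

lemma measure_adjoint_apply:
  "t \<ge> 0 \<Longrightarrow> blinfun_apply (bm_functional (measure_adjoint (T t) \<mu>)) f =
    blinfun_apply (bm_functional \<mu>) (blinfun_apply (T t) f)"
  by (simp add: bm_functional_measure_adjoint banach_adjoint_def)

lemma measure_eqI:
  "(\<And>f. blinfun_apply (bm_functional \<mu>) f = blinfun_apply (bm_functional \<nu>) f) \<Longrightarrow> \<mu> = \<nu>"
  for \<mu> \<nu> :: "'a baire_measure"
  by (rule injD[OF inj_bm_functional]) (rule blinfun_eqI)

lemma norm_measure_adjoint_le:
  assumes "t \<ge> 0"
  shows "norm (measure_adjoint (T t) \<mu>) \<le> norm \<mu> * norm (T t)"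
proof -
  have "norm (measure_adjoint (T t) \<mu>) = norm (bm_functional \<mu> o\<^sub>L T t)"
    unfolding norm_bm_functional[symmetric] bm_functional_measure_adjoint[OF assms] banach_adjoint_def ..
  also have "\<dots> \<le> norm \<mu> * norm (T t)"
    using norm_blinfun_compose[of "bm_functional \<mu>" "T t"] by (simp add: norm_bm_functional)
  finally show ?thesis .
qed

lemma bounded_linear_measure_adjoint: "t \<ge> 0 \<Longrightarrow> bounded_linear (measure_adjoint (T t))"
  by (rule bounded_linear_intro[where K = "norm (T t)"])
    (auto intro!: measure_eqI simp: measure_adjoint_apply bm_functional_add bm_functional_scaleR
      blinfun.add_left blinfun.scaleR_left norm_measure_adjoint_le)

lemma semigroup_locally_bounded: "\<exists>B. \<forall>t\<in>{0..b}. norm (T t) \<le> B"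
proof -
  obtain C0 where C0: "\<forall>t\<in>{0..1}. onorm (blinfun_apply (T t)) \<le> C0" using locally_bounded by blast
  \<comment> \<open>At least 1, so that the bound \<open>C ^ n * C\<close> does not decrease with
    \<open>n\<close> and also covers times up to 1. For longer times one unit is split off, at the
    price of one factor \<open>C\<close>.\<close>
  define C where "C = max 1 C0"
  have C: "norm (T t) \<le> C" if "t \<in> {0..1}" for t
    using C0 that by (auto simp: C_def norm_blinfun.rep_eq intro: max.coboundedI2)
  have "\<forall>t\<in>{0..real n}. norm (T t) \<le> C ^ n * C" for n
  proof (induction n)
    case 0
    then show ?case using C[of 0] by simp
  next
    case (Suc n)
    show ?case
    proof
      fix t assume t: "t \<in> {0..real (Suc n)}"
      show "norm (T t) \<le> C ^ Suc n * C"
      proof (cases "t \<le> 1")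
        case True
        have "1 * C \<le> C ^ Suc n * C" by (intro mult_right_mono one_le_power) (simp_all add: C_def)
        with C[of t] True t show ?thesis by simp
      next
        case False
        have "T t = T (t - 1) o\<^sub>L T 1"
          using semigroup_add[of 1 "t - 1"] False by (intro blinfun_eqI) (simp add: fun_eq_iff)
        then have "norm (T t) \<le> norm (T (t - 1)) * norm (T 1)" by (simp add: norm_blinfun_compose)
        also have "\<dots> \<le> (C ^ n * C) * C"
          using Suc t False C[of 1] by (intro mult_mono) (auto simp: C_def)
        finally show ?thesis by (simp add: mult_ac)
      qed
    qed
  qed
  moreover obtain n where "b \<le> real n" using real_arch_simple by blast
  ultimately show ?thesis by (meson atLeastAtMost_iff order_trans)
qed

lemma semigroup_orbit_tendsto:
  assumes s: "\<And>n. s n \<ge> 0" "t \<ge> 0" "s \<longlonglongrightarrow> t"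
  shows "compactly_null (\<lambda>n. blinfun_apply (T (s n)) f - blinfun_apply (T t) f)"
    and "\<exists>B. \<forall>n. norm (blinfun_apply (T (s n)) f) \<le> B"
proof -
  have "limitin (top_of_set {0..}) s t sequentially" using s by (simp add: limitin_subtopology)
  from continuous_map_limit[OF orbit_continuous this]
  show "compactly_null (\<lambda>n. blinfun_apply (T (s n)) f - blinfun_apply (T t) f)"
    by (simp add: limitin_compact_open_topology o_def)
  obtain b where "\<And>n. norm (s n) \<le> b" using convergent_imp_Bseq[OF convergentI[OF s(3)]] unfolding Bseq_def by blast
  then have "s n \<in> {0..b}" for n using s(1)[of n] by (simp add: abs_le_iff)
  moreover obtain B where "\<forall>t\<in>{0..b}. norm (T t) \<le> B" using semigroup_locally_bounded by blast
  ultimately have B: "norm (T (s n)) \<le> B" for n by blast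
  have "norm (blinfun_apply (T (s n)) f) \<le> B * norm f" for n
    using norm_blinfun[of "T (s n)" f] mult_right_mono[OF B[of n] norm_ge_zero[of f]] by linarith
  then show "\<exists>B. \<forall>n. norm (blinfun_apply (T (s n)) f) \<le> B" by blast
qed

text \<open>On the half-line continuity can be tested along sequences, which is the form that
  dominated convergence needs; the common bound comes from
  \<open>semigroup_locally_bounded\<close>.\<close>

lemma measure_adjoint_orbit_continuous:
  "continuous_map (top_of_set {0..}) weak_measure_topology (\<lambda>t. measure_adjoint (T t) \<mu>)"
  unfolding continuous_map_weak_measure_topology
proof
  fix f
  have "continuous_on {0..} (\<lambda>t. blinfun_apply (bm_functional \<mu>) (blinfun_apply (T t) f))"
  proof (rule continuous_on_sequentiallyI)
    fix s :: "nat \<Rightarrow> real" and t assume s: "\<forall>n. s n \<in> {0..}" "t \<in> {0..}" "s \<longlonglongrightarrow> t"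
    have s0: "\<And>n. s n \<ge> 0" "t \<ge> 0" using s by auto
    obtain B where B: "\<And>n. norm (blinfun_apply (T (s n)) f) \<le> B"
      using semigroup_orbit_tendsto(2)[OF s0 s(3)] by blast
    show "(\<lambda>n. blinfun_apply (bm_functional \<mu>) (blinfun_apply (T (s n)) f)) \<longlonglongrightarrow>
        blinfun_apply (bm_functional \<mu>) (blinfun_apply (T t) f)"
      using compactly_null_tendsto[OF semigroup_orbit_tendsto(1)[OF s0 s(3)], of f]
      by (intro bm_functional_dominated_convergence[OF B]) (simp add: LIM_zero_iff)
  qed
  then have "continuous_on {0..} (\<lambda>t. blinfun_apply (bm_functional (measure_adjoint (T t) \<mu>)) f)"
    by (rule continuous_on_eq) (simp add: measure_adjoint_apply)
  then show "continuous_map (top_of_set {0..}) euclideanreal (\<lambda>t. blinfun_apply (bm_functional (measure_adjoint (T t) \<mu>)) f)"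
    by simp
qed

lemma measure_adjoint_uniformly_null:
  assumes \<mu>: "limitin weak_measure_topology \<mu> 0 sequentially" and a: "0 \<le> a" and e: "e > 0"
  shows "\<forall>\<^sub>F n in sequentially. \<forall>t\<in>{a..b}. \<bar>blinfun_apply (bm_functional (\<mu> n)) (blinfun_apply (T t) f)\<bar> < e"
proof (rule ccontr)
  let ?I = "\<lambda>n. blinfun_apply (bm_functional (\<mu> n))"
  have null: "(\<lambda>n. ?I n g) \<longlonglongrightarrow> 0" for g
    using \<mu> by (simp add: limitin_weak_measure_topology bm_functional_zero blinfun.zero_left)
  assume "\<not> ?thesis"
  then obtain r :: "nat \<Rightarrow> nat" where r: "strict_mono r" "\<forall>n. \<exists>t\<in>{a..b}. e \<le> \<bar>?I (r n) (blinfun_apply (T t) f)\<bar>"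
    by (auto simp: not_less dest!: not_eventually_sequentiallyD)
  then obtain t where t: "\<And>n. t n \<in> {a..b}" "\<And>n. e \<le> \<bar>?I (r n) (blinfun_apply (T (t n)) f)\<bar>" by metis
  obtain l s where l: "l \<in> {a..b}" "strict_mono s" "(t \<circ> s) \<longlonglongrightarrow> l"
    using seq_compactE[OF compact_imp_seq_compact[OF compact_Icc]] t(1) by metis
  have t0: "\<And>n. t (s n) \<ge> 0" "l \<ge> 0"
  proof -
    show "t (s n) \<ge> 0" for n using t(1)[of "s n"] a by auto
    show "l \<ge> 0" using l(1) a by auto
  qed
  have lim: "(\<lambda>n. t (s n)) \<longlonglongrightarrow> l" using l(3) by (simp add: o_def)
  \<comment> \<open>The moving function is the null sequence \<open>h\<close> plus the fixed
    function \<open>T l f\<close>; \<open>weakly_null_compactly_null\<close> handles the first and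
    weak convergence the second.\<close>
  define h where "h n = blinfun_apply (T (t (s n))) f - blinfun_apply (T l) f" for n
  obtain B where B: "\<And>n. norm (blinfun_apply (T (t (s n))) f) \<le> B"
    using semigroup_orbit_tendsto(2)[OF t0 lim] by blast
  have hB: "norm (h n) \<le> B + norm (blinfun_apply (T l) f)" for n
    unfolding h_def using norm_triangle_ineq4 B[of n] by (meson add_right_mono order_trans)
  have rs: "filterlim (\<lambda>n. r (s n)) sequentially sequentially"
    using strict_mono_compose[OF r(1) l(2)] by (simp add: filterlim_subseq o_def)
  have null': "(\<lambda>n. ?I (r (s n)) g) \<longlonglongrightarrow> 0" for g by (rule filterlim_compose[OF null rs])
  have "(\<lambda>n. ?I (r (s n)) (h n)) \<longlonglongrightarrow> 0"
    using semigroup_orbit_tendsto(1)[OF t0 lim]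
    by (intro weakly_null_compactly_null[OF null' _ hB]) (simp add: h_def)
  from tendsto_add[OF this null'[of "blinfun_apply (T l) f"]]
  have "(\<lambda>n. ?I (r (s n)) (blinfun_apply (T (t (s n))) f)) \<longlonglongrightarrow> 0"
    by (simp add: h_def blinfun.diff_right)
  from LIMSEQ_D[OF this e] obtain n where "\<bar>?I (r (s n)) (blinfun_apply (T (t (s n))) f)\<bar> < e" by auto
  with t(2)[of "s n"] show False by simp
qed

lemma bicontinuous_semigroup_measure_adjoint:
  "bicontinuous_semigroup (weak_measure_topology :: 'a baire_measure topology) (\<lambda>t. measure_adjoint (T t))"
proof (intro bicontinuous_semigroup.intro bicontinuous_semigroup_axioms.intro
    bicontinuous_space_weak_measure_topology)
  show "bounded_linear (measure_adjoint (T t))" if "t \<ge> 0" for t using that by (rule bounded_linear_measure_adjoint)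
  show "measure_adjoint (T 0) = (id :: 'a baire_measure \<Rightarrow> _)"
    using semigroup_zero by (auto intro!: ext measure_eqI simp: measure_adjoint_apply)
  show "measure_adjoint (T (t + s)) = measure_adjoint (T t) \<circ> measure_adjoint (T s)" if "s \<ge> 0" "t \<ge> 0" for s t
  proof (rule ext, rule measure_eqI)
    fix \<mu> f
    show "blinfun_apply (bm_functional (measure_adjoint (T (t + s)) \<mu>)) f =
        blinfun_apply (bm_functional ((measure_adjoint (T t) \<circ> measure_adjoint (T s)) \<mu>)) f"
      \<comment> \<open>Adjoints reverse the order of composition, so the law is used with
        \<open>s\<close> and \<open>t\<close> exchanged.\<close>
      using that semigroup_add[of t s] by (simp add: measure_adjoint_apply add.commute)
  qed
  show "continuous_map (top_of_set {0..}) weak_measure_topology (\<lambda>t. measure_adjoint (T t) \<mu>)" for \<mu>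
    by (rule measure_adjoint_orbit_continuous)
  show "\<exists>C. \<forall>t\<in>{0..1}. onorm (measure_adjoint (T t)) \<le> C"
  proof -
    obtain B where B: "\<forall>t\<in>{0..1}. norm (T t) \<le> B" using semigroup_locally_bounded by blast
    have "onorm (measure_adjoint (T t)) \<le> B" if "t \<in> {0..1}" for t
    proof (rule onorm_bound)
      fix \<mu> :: "'a baire_measure"
      have "norm (measure_adjoint (T t) \<mu>) \<le> norm \<mu> * norm (T t)" using that by (intro norm_measure_adjoint_le) simp
      also have "\<dots> \<le> B * norm \<mu>" using B that by (subst mult.commute) (intro mult_right_mono, auto)
      finally show "norm (measure_adjoint (T t) \<mu>) \<le> B * norm \<mu>" .
    next
      show "0 \<le> B" using B that norm_ge_zero[of "T t"] by (blast intro: order_trans)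
    qed
    then show ?thesis by blast
  qed
  fix \<mu> :: "nat \<Rightarrow> 'a baire_measure" and a b :: real
    and U :: "'a baire_measure set"
  assume \<mu>: "limitin weak_measure_topology \<mu> 0 sequentially" and a: "0 \<le> a"
    and U: "openin weak_measure_topology U" "0 \<in> U"
  \<comment> \<open>A weak neighbourhood of 0 involves only finitely many functions, so the uniform
    estimate for a single \<open>f\<close> suffices.\<close>
  obtain F e where F: "finite F" "F \<subseteq> weak_seminorms" "e > 0" "{\<nu>. \<forall>p\<in>F. p (\<nu> - 0) < e} \<subseteq> U"
    using U by (elim seminorm_topology_nhd[OF seminorm_weak_seminorms, folded weak_measure_topology_eq])
  have "\<forall>\<^sub>F n in sequentially. \<forall>p\<in>F. \<forall>t\<in>{a..b}. p (measure_adjoint (T t) (\<mu> n)) < e"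
  proof (rule eventually_ball_finite[OF F(1)], rule ballI)
    fix p :: "'a baire_measure \<Rightarrow> real" assume "p \<in> F"
    then obtain f where p: "p = (\<lambda>\<nu>. \<bar>blinfun_apply (bm_functional \<nu>) f\<bar>)"
      using F(2) by (auto simp: weak_seminorms_def)
    show "\<forall>\<^sub>F n in sequentially. \<forall>t\<in>{a..b}. p (measure_adjoint (T t) (\<mu> n)) < e"
      using measure_adjoint_uniformly_null[OF \<mu> a F(3), of b f]
      by eventually_elim (use a in \<open>auto simp: p measure_adjoint_apply\<close>)
  qed
  then show "\<forall>\<^sub>F n in sequentially. \<forall>t\<in>{a..b}. measure_adjoint (T t) (\<mu> n) \<in> U"
    by eventually_elim (use F(4) in auto)
qed

end

theorem theorem3p5:
  fixes T :: "real \<Rightarrow> ('a::polish_space \<Rightarrow>\<^sub>C real) \<Rightarrow>\<^sub>L ('a \<Rightarrow>\<^sub>C real)"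
  assumes "bicontinuous_semigroup compact_open_topology (\<lambda>t. blinfun_apply (T t))"
  shows "(\<forall>t\<ge>0. \<forall>\<mu> :: 'a baire_measure.
            bm_functional (measure_adjoint (T t) \<mu>) = banach_adjoint (T t) (bm_functional \<mu>)) \<and>
         bicontinuous_semigroup (weak_measure_topology :: 'a baire_measure topology)
           (\<lambda>t. measure_adjoint (T t))"
  using bm_functional_measure_adjoint[OF assms] bicontinuous_semigroup_measure_adjoint[OF assms] by blast

end
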